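(* Let $n\ge 2$, $d\ge 2$ and let $U\subset A_d$ be a base-point-free subspace of codimension $2$. Then the following hold: (i) if $d=2$, then $\operatorname{codim} U^2\le 6$; (ii) if $d\ge 3$, then $\operatorname{codim} U^2\le 4$. For $d\le 4$ the bounds are tight, i.e. for each $d\in\{2,3,4\}$ there exist some $n\ge 2$ and a base-point-free subspace $U\subset A_d$ of codimension $2$ for which equality holds.
   Context: $A=\mathbb{C}[x_1,\dots,x_n]$ with its standard grading; $A_d$ is the $\mathbb{C}$-vector space of forms of degree $d$. For a linear subspace $U\subset A_d$, $U^2:=\operatorname{span}(pq : p,q\in U)\subset A_{2d}$. $\operatorname{codim} U$ is the codimension in $A_d$ and $\operatorname{codim} U^2$ is the codimension in $A_{2d}$. $U$ is called base-point-free if there is no point $\xi\in\mathbb{P}^{n-1}(\mathbb{C})$ with $f(\xi)=0$ for all $f\in U$. *)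

theory Defs
  imports Complex_Main "HOL-Library.Poly_Mapping"
begin

text \<open>
  Polynomials over the complex numbers are finitely supported maps from monomials to
  coefficients, with the (convolution) ring structure of Poly_Mapping; a monomial is a finitely
  supported exponent vector. The variables are indexed by all natural numbers; the ring
  \<open>\<complex>[x\<^sub>1,\<dots>,x\<^sub>n]\<close> consists of the polynomials that involve only the variables with index
  in \<open>{..<n}\<close>.
\<close>

type_synonym monom = "nat \<Rightarrow>\<^sub>0 nat"
type_synonym cpoly = "monom \<Rightarrow>\<^sub>0 complex"

definition cscale :: "complex \<Rightarrow> cpoly \<Rightarrow> cpoly" where
  "cscale c p = Poly_Mapping.map ((*) c) p"

lemma cscale_eq_times: "cscale c p = Poly_Mapping.single 0 c * p"
  by (simp add: cscale_def mult_map_scale_conv_mult)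

interpretation cpoly: vector_space cscale
  by unfold_locales
    (simp_all add: cscale_eq_times distrib_left distrib_right single_add mult_single
      flip: mult.assoc)

definition monom_degree :: "monom \<Rightarrow> nat" where
  "monom_degree m = (\<Sum>i\<in>Poly_Mapping.keys m. Poly_Mapping.lookup m i)"

text \<open>The space \<open>A\<^sub>d\<close> of forms of degree \<open>d\<close> (including \<open>0\<close>) in \<open>n\<close> variables:\<close>

definition forms :: "nat \<Rightarrow> nat \<Rightarrow> cpoly set" where
  "forms n d = {p. \<forall>m\<in>Poly_Mapping.keys p. Poly_Mapping.keys m \<subseteq> {..<n} \<and> monom_degree m = d}"

definition poly_eval :: "cpoly \<Rightarrow> (nat \<Rightarrow> complex) \<Rightarrow> complex" where
  "poly_eval p \<xi> = (\<Sum>m\<in>Poly_Mapping.keys p. Poly_Mapping.lookup p m *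
     (\<Prod>i\<in>Poly_Mapping.keys m. \<xi> i ^ Poly_Mapping.lookup m i))"

text \<open>
  A point of \<open>\<bbbP>\<^sup>n\<^sup>-\<^sup>1(\<complex>)\<close> is given by homogeneous coordinates \<open>\<xi> 0, \<dots>, \<xi> (n - 1)\<close>, not all
  zero; the values of \<open>\<xi>\<close> at other indices are irrelevant for polynomials in \<open>n\<close> variables.
\<close>

definition base_point_free :: "nat \<Rightarrow> cpoly set \<Rightarrow> bool" where
  "base_point_free n U \<longleftrightarrow>
     \<not> (\<exists>\<xi>. (\<exists>i<n. \<xi> i \<noteq> 0) \<and> (\<forall>f\<in>U. poly_eval f \<xi> = 0))"

definition square_space :: "cpoly set \<Rightarrow> cpoly set" where
  "square_space U = cpoly.span {p * q |p q. p \<in> U \<and> q \<in> U}"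

text \<open>
  Only used for subspaces \<open>U\<close> of \<open>forms n d\<close>; as the latter is finite-dimensional, the
  subtraction of natural numbers does not truncate.
\<close>

definition codim_in_forms :: "nat \<Rightarrow> nat \<Rightarrow> cpoly set \<Rightarrow> nat" where
  "codim_in_forms n d U = cpoly.dim (forms n d) - cpoly.dim U"

definition bpf_subspace_codim2 :: "nat \<Rightarrow> nat \<Rightarrow> cpoly set \<Rightarrow> bool" where
  "bpf_subspace_codim2 n d U \<longleftrightarrow>
     cpoly.subspace U \<and> U \<subseteq> forms n d \<and> codim_in_forms n d U = 2 \<and> base_point_free n U"

end

theory Submission
  imports Defs "HOL-Computational_Algebra.Polynomial"
begin

text \<open>
  Write \<open>U\<close> as the common kernel of two functionals \<open>\<alpha>\<close>, \<open>\<gamma>\<close> on the forms of degree \<open>d\<close>. Since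
  the Jacobian of \<open>a \<mapsto> (\<alpha> (a\<^sup>d), \<gamma> (a\<^sup>d))\<close> does not vanish identically, there are linear forms
  \<open>x\<close>, \<open>y\<close> such that \<open>x\<^sup>d\<close>, \<open>x\<^sup>d\<^sup>-\<^sup>1y\<close> is a basis of a complement of \<open>U\<close>, and a complement \<open>Z\<close> of
  \<open>\<langle>x, y\<rangle>\<close> in the linear forms with \<open>x\<^sup>d\<^sup>-\<^sup>1Z \<subseteq> U\<close>. Let a functional \<open>\<Lambda>\<close> vanish on \<open>U\<^sup>2\<close> and on the four
  forms \<open>x\<^sup>2\<^sup>d\<^sup>-\<^sup>ky\<^sup>k\<close>, \<open>k \<le> 3\<close>. Then \<open>\<Lambda>\<close> vanishes on all binary forms in \<open>x\<close>, \<open>y\<close>, it is determined by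
  its values on \<open>x\<^sup>2\<^sup>d\<^sup>-\<^sup>1z\<close> and \<open>x\<^sup>2\<^sup>d\<^sup>-\<^sup>2yz\<close> with \<open>z \<in> Z\<close>, and these satisfy a linear recursion whose
  characteristic roots are the candidates for base points of \<open>U\<close> on the line dual to \<open>\<langle>x, y\<rangle>\<close>.
  Replacing \<open>y\<close> by \<open>y + v\<close> with \<open>v \<in> Z\<close> keeps this normal form. If such a root is a base
  point for one \<open>v\<close> and moves with \<open>v\<close>, the products of elements of \<open>U\<close> with two factors from \<open>Z\<close> force the
  corresponding part of \<open>\<Lambda>\<close> to vanish (up to one dimension if \<open>d = 2\<close>); if it does not move, it is a
  base point of \<open>U\<close>. The only exception is a double root for all \<open>v\<close>, where
  \<open>\<alpha> (a\<^sup>d) = m(a)\<^sup>d\<^sup>-\<^sup>1 h(a)\<close> and \<open>\<gamma> (a\<^sup>d) = m(a)\<^sup>d\<^sup>-\<^sup>1 g(a)\<close> with linear \<open>m\<close>, \<open>g\<close>, \<open>h\<close>. Then \<open>U\<close> is, in suitable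
  coordinates, the span of all monomials but \<open>X\<^sup>d\<^sup>-\<^sup>1Y\<close> and \<open>X\<^sup>d\<^sup>-\<^sup>1V\<close>, and for \<open>d = 2\<close> the square misses
  six monomials.
\<close>

subsection \<open>Linear functionals\<close>

abbreviation const_poly :: "complex \<Rightarrow> cpoly"
  where "const_poly \<equiv> Poly_Mapping.single 0"

definition lin_functional :: "(cpoly \<Rightarrow> complex) \<Rightarrow> bool"
  where "lin_functional \<phi> \<longleftrightarrow>
    (\<forall>p q. \<phi> (p + q) = \<phi> p + \<phi> q) \<and> (\<forall>c p. \<phi> (const_poly c * p) = c * \<phi> p)"

lemma lin_functional_add: "lin_functional \<phi> \<Longrightarrow> \<phi> (p + q) = \<phi> p + \<phi> q"
  by (simp add: lin_functional_def)

lemma lin_functional_scale: "lin_functional \<phi> \<Longrightarrow> \<phi> (const_poly c * p) = c * \<phi> p"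
  by (simp add: lin_functional_def)

lemma lin_functional_zero: "lin_functional \<phi> \<Longrightarrow> \<phi> 0 = 0"
  using lin_functional_add[of \<phi> 0 0] by simp

lemma lin_functional_uminus: "lin_functional \<phi> \<Longrightarrow> \<phi> (- p) = - \<phi> p"
  using lin_functional_add[of \<phi> p "- p"] lin_functional_zero[of \<phi>]
  by (simp add: eq_neg_iff_add_eq_0 add.commute)

lemma lin_functional_diff: "lin_functional \<phi> \<Longrightarrow> \<phi> (p - q) = \<phi> p - \<phi> q"
  using lin_functional_add[of \<phi> p "- q"] by (simp add: lin_functional_uminus)

lemma lin_functional_sum: "lin_functional \<phi> \<Longrightarrow> \<phi> (sum f S) = (\<Sum>i\<in>S. \<phi> (f i))"
  by (induction S rule: infinite_finite_induct)
    (simp_all add: lin_functional_zero lin_functional_add)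

lemma lin_functional_of_nat: "lin_functional \<phi> \<Longrightarrow> \<phi> (of_nat k * p) = of_nat k * \<phi> p"
  by (metis lin_functional_scale single_of_nat)

lemma lin_functional_numeral: "lin_functional \<phi> \<Longrightarrow> \<phi> (numeral k * p) = numeral k * \<phi> p"
  by (metis lin_functional_scale single_numeral)

lemmas lin_functional_simps = lin_functional_add lin_functional_scale lin_functional_zero
  lin_functional_uminus lin_functional_diff lin_functional_of_nat lin_functional_numeral

lemma lin_functional_mult: "lin_functional \<phi> \<Longrightarrow> lin_functional (\<lambda>p. \<phi> (q * p))"
  by (simp add: lin_functional_def distrib_left mult.left_commute[of q])

lemma lin_functional_combination:
  "lin_functional \<phi> \<Longrightarrow> lin_functional \<psi> \<Longrightarrow> lin_functional (\<lambda>p. a * \<phi> p + b * \<psi> p)"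
  by (simp add: lin_functional_def algebra_simps)

lemma const_poly_mult: "const_poly a * const_poly b = const_poly (a * b)"
  by (simp add: mult_single)

lemma const_poly_power: "const_poly a ^ k = const_poly (a ^ k)"
  by (induction k) (simp_all add: const_poly_mult)

lemma span_functional_closed:
  assumes "lin_functional \<phi>" "\<And>s. s \<in> S \<Longrightarrow> \<phi> s = 0" "p \<in> cpoly.span S"
  shows "\<phi> p = 0"
  using assms(3)
  by (induction rule: cpoly.span_induct_alt)
    (simp_all add: assms lin_functional_simps cscale_eq_times)

lemma representation_lin_functional:
  assumes "cpoly.independent B"
  shows "lin_functional (\<lambda>p. cpoly.representation (cpoly.extend_basis B) p b)"
  using cpoly.independent_extend_basis[OF assms] cpoly.span_extend_basis[OF assms]
  by (simp add: lin_functional_def cpoly.representation_add cpoly.representation_scale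
      flip: cscale_eq_times)

text \<open>A maximal independent subset of S together with p extends to a basis of all polynomials,
  and the coordinate at p separates. Span membership can therefore be tested on functionals
  throughout.\<close>

lemma separating_functional:
  assumes "p \<notin> cpoly.span S"
  obtains \<phi> where "lin_functional \<phi>" "\<And>s. s \<in> S \<Longrightarrow> \<phi> s = 0" "\<phi> p \<noteq> 0"
proof -
  obtain B where B: "B \<subseteq> S" "cpoly.independent B" "S \<subseteq> cpoly.span B"
    using cpoly.maximal_independent_subset by blast
  have p: "p \<notin> cpoly.span B"
    using assms B(1) cpoly.span_mono by blast
  then have ind: "cpoly.independent (insert p B)"
    using B(2) by (simp add: cpoly.independent_insert)
  define E where "E = cpoly.extend_basis (insert p B)"
  have E: "cpoly.independent E" "insert p B \<subseteq> E"
    unfolding E_def using cpoly.independent_extend_basis[OF ind] cpoly.extend_basis_superset[OF ind]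
    by auto
  define \<phi> where "\<phi> = (\<lambda>q. cpoly.representation E q p)"
  have lin: "lin_functional \<phi>"
    unfolding \<phi>_def E_def by (rule representation_lin_functional[OF ind])
  have "\<phi> b = 0" if "b \<in> B" for b
    using cpoly.representation_basis[OF E(1), of b] that E(2) p cpoly.span_base[of b B]
    by (auto simp: \<phi>_def)
  then have "\<phi> s = 0" if "s \<in> S" for s
    using span_functional_closed[OF lin] B(3) that by blast
  moreover have "\<phi> p = 1"
    using cpoly.representation_basis[OF E(1), of p] E(2) by (simp add: \<phi>_def)
  ultimately show ?thesis
    using that[of \<phi>] lin by simp
qed

subsection \<open>Forms\<close>

lemma monom_degree_eq_sum:
  assumes "finite S" "Poly_Mapping.keys m \<subseteq> S"
  shows "monom_degree m = (\<Sum>i\<in>S. Poly_Mapping.lookup m i)"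
  unfolding monom_degree_def using assms
  by (intro sum.mono_neutral_left) (auto simp: in_keys_iff)

lemma keys_add_monom: "Poly_Mapping.keys (a + b :: monom) = Poly_Mapping.keys a \<union> Poly_Mapping.keys b"
  by (auto simp: in_keys_iff lookup_add)

lemma monom_degree_add: "monom_degree (a + b) = monom_degree a + monom_degree b"
proof -
  let ?S = "Poly_Mapping.keys a \<union> Poly_Mapping.keys b"
  have "monom_degree (a + b) = (\<Sum>i\<in>?S. Poly_Mapping.lookup (a + b) i)"
    by (rule monom_degree_eq_sum) (auto simp: keys_add_monom)
  also have "\<dots> = (\<Sum>i\<in>?S. Poly_Mapping.lookup a i) + (\<Sum>i\<in>?S. Poly_Mapping.lookup b i)"
    by (simp add: lookup_add sum.distrib)
  also have "\<dots> = monom_degree a + monom_degree b"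
    by (simp add: monom_degree_eq_sum[of ?S])
  finally show ?thesis .
qed

lemma monom_degree_single [simp]: "monom_degree (Poly_Mapping.single i k) = k"
  by (simp add: monom_degree_def)

lemma monom_degree_eq_0_iff: "monom_degree m = 0 \<longleftrightarrow> m = 0"
  by (auto simp: monom_degree_def in_keys_iff intro!: poly_mapping_eqI)

definition monoms :: "nat \<Rightarrow> nat \<Rightarrow> monom set"
  where "monoms n k = {m. Poly_Mapping.keys m \<subseteq> {..<n} \<and> monom_degree m = k}"

lemma mem_forms_iff: "p \<in> forms n k \<longleftrightarrow> Poly_Mapping.keys p \<subseteq> monoms n k"
  by (auto simp: forms_def monoms_def)

lemma forms_0 [simp]: "0 \<in> forms n k"
  by (simp add: mem_forms_iff)

lemma forms_add: "p \<in> forms n k \<Longrightarrow> q \<in> forms n k \<Longrightarrow> p + q \<in> forms n k"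
  unfolding mem_forms_iff using Poly_Mapping.keys_add[of p q] by blast

lemma forms_uminus: "p \<in> forms n k \<Longrightarrow> - p \<in> forms n k"
  by (simp add: mem_forms_iff)

lemma forms_diff: "p \<in> forms n k \<Longrightarrow> q \<in> forms n k \<Longrightarrow> p - q \<in> forms n k"
  using forms_add[of p n k "- q"] forms_uminus[of q n k] by simp

lemma forms_mult: "p \<in> forms n j \<Longrightarrow> q \<in> forms n k \<Longrightarrow> p * q \<in> forms n (j + k)"
  unfolding mem_forms_iff using keys_mult[of p q]
  by (fastforce simp: monoms_def keys_add_monom monom_degree_add)

lemma const_poly_forms [simp]: "const_poly c \<in> forms n 0"
  by (auto simp: mem_forms_iff monoms_def monom_degree_def)

lemma one_forms [simp]: "1 \<in> forms n 0"
  using const_poly_forms[of 1 n] by simp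

lemma forms_scale: "p \<in> forms n k \<Longrightarrow> const_poly c * p \<in> forms n k"
  using forms_mult[of "const_poly c" n 0 p k] by simp

lemma forms_linear_mult: "a \<in> forms n 1 \<Longrightarrow> p \<in> forms n k \<Longrightarrow> a * p \<in> forms n (Suc k)"
  using forms_mult[of a n 1 p k] by simp

lemma forms_power: "a \<in> forms n 1 \<Longrightarrow> a ^ k \<in> forms n k"
  by (induction k) (simp_all add: forms_linear_mult)

lemma forms_prod_list: "set as \<subseteq> forms n 1 \<Longrightarrow> prod_list as \<in> forms n (length as)"
  by (induction as) (simp_all add: forms_linear_mult)

lemma subspace_forms: "cpoly.subspace (forms n k)"
  by (simp add: cpoly.subspace_def forms_add forms_scale cscale_eq_times)

lemma cpoly_sum_monomials:
  fixes p :: cpoly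
  shows "p = (\<Sum>m\<in>Poly_Mapping.keys p. Poly_Mapping.single m (Poly_Mapping.lookup p m))"
  by (rule poly_mapping_eqI)
    (auto simp: lookup_sum lookup_single when_def in_keys_iff)

lemma forms_degree_0: "p \<in> forms n 0 \<Longrightarrow> \<exists>c. p = const_poly c"
proof -
  assume "p \<in> forms n 0"
  then have "Poly_Mapping.lookup p m = Poly_Mapping.lookup (const_poly (Poly_Mapping.lookup p 0)) m" for m
    by (cases "m = 0") (auto simp: mem_forms_iff monoms_def monom_degree_eq_0_iff
        lookup_single in_keys_iff)
  then show ?thesis
    using poly_mapping_eqI by blast
qed

lemma single_forms: "m \<in> monoms n k \<Longrightarrow> Poly_Mapping.single m c \<in> forms n k"
  by (simp add: mem_forms_iff)

lemma monoms_Suc: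
  assumes m: "m \<in> monoms n (Suc k)"
  obtains i m' where "i < n" "m' \<in> monoms n k" "m = Poly_Mapping.single i 1 + m'"
proof -
  have "m \<noteq> 0"
    using m by (auto simp: monoms_def monom_degree_def)
  then obtain i where i: "i \<in> Poly_Mapping.keys m"
    by (auto simp: poly_mapping_eq_iff in_keys_iff fun_eq_iff)
  define m' where "m' = m - Poly_Mapping.single i 1"
  have m_eq: "m = Poly_Mapping.single i 1 + m'"
    using i by (intro poly_mapping_eqI)
      (auto simp: m'_def lookup_add lookup_minus lookup_single when_def in_keys_iff)
  then have "i < n" "m' \<in> monoms n k"
    using m i by (auto simp: monoms_def keys_add_monom monom_degree_add)
  then show ?thesis
    using that m_eq by blast
qed

text \<open>Every monomial of degree k + 1 is a variable times a monomial of degree k.\<close>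

lemma functional_vanishes_on_forms_Suc:
  assumes "lin_functional \<phi>" "\<And>a q. a \<in> forms n 1 \<Longrightarrow> q \<in> forms n k \<Longrightarrow> \<phi> (a * q) = 0"
    and p: "p \<in> forms n (Suc k)"
  shows "\<phi> p = 0"
proof -
  have "\<phi> (Poly_Mapping.single m c) = 0" if m: "m \<in> monoms n (Suc k)" for m c
  proof -
    obtain i m' where im: "i < n" "m' \<in> monoms n k" "m = Poly_Mapping.single i 1 + m'"
      using monoms_Suc[OF m] .
    then have "Poly_Mapping.single (Poly_Mapping.single i 1) 1 \<in> forms n 1"
      "Poly_Mapping.single m' c \<in> forms n k"
      by (auto intro!: single_forms simp: monoms_def)
    then show ?thesis
      using assms(2) im(3) by (metis mult_single mult_1)
  qed
  moreover have "\<phi> p = (\<Sum>m\<in>Poly_Mapping.keys p. \<phi> (Poly_Mapping.single m (Poly_Mapping.lookup p m)))"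
    using arg_cong[OF cpoly_sum_monomials[of p], of \<phi>] lin_functional_sum[OF assms(1)] by metis
  ultimately show ?thesis
    using p by (auto simp: mem_forms_iff intro!: sum.neutral)
qed

lemma lin_functional_binomial:
  assumes "lin_functional \<phi>"
  shows "\<phi> (q * (a + const_poly r * b) ^ k) =
    (\<Sum>i\<le>k. (of_nat (k choose i) * \<phi> (q * a ^ (k - i) * b ^ i)) * r ^ i)"
proof -
  have "q * (a + const_poly r * b) ^ k = q * (const_poly r * b + a) ^ k"
    by (simp add: add.commute)
  also have "\<dots> = (\<Sum>i\<le>k. const_poly (r ^ i) * (of_nat (k choose i) * (q * a ^ (k - i) * b ^ i)))"
    unfolding binomial_ring sum_distrib_left
    by (simp add: power_mult_distrib const_poly_power algebra_simps)
  finally have "\<phi> (q * (a + const_poly r * b) ^ k) =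
      (\<Sum>i\<le>k. r ^ i * (of_nat (k choose i) * \<phi> (q * a ^ (k - i) * b ^ i)))"
    by (simp only: lin_functional_sum[OF assms] lin_functional_scale[OF assms]
        lin_functional_of_nat[OF assms])
  then show ?thesis
    by (simp only: mult.commute)
qed

text \<open>Powers of linear forms span, by polarisation in characteristic zero: the coefficient of
  r in \<phi> ((a + r b)^(k+1)) is (k+1) \<phi> (b a^k), so the induction hypothesis applies to the
  functional q \<mapsto> \<phi> (b q).\<close>

lemma functional_vanishes_on_forms:
  assumes "lin_functional \<phi>" "\<And>a. a \<in> forms n 1 \<Longrightarrow> \<phi> (a ^ k) = 0" "p \<in> forms n k"
  shows "\<phi> p = 0"
  using assms
proof (induction k arbitrary: \<phi> p)
  case 0
  then obtain c where "p = const_poly c * 1"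
    using forms_degree_0[of p n] by auto
  moreover have "\<phi> 1 = 0"
    using 0(2)[of 0] by simp
  ultimately show ?case
    using lin_functional_scale[OF 0(1), of c 1] by simp
next
  case (Suc k)
  have "\<phi> (b * q) = 0" if b: "b \<in> forms n 1" and q: "q \<in> forms n k" for b q
  proof (rule Suc.IH[OF lin_functional_mult[OF Suc.prems(1)] _ q])
    fix a assume a: "a \<in> forms n 1"
    have "\<forall>r. (\<Sum>i\<le>Suc k. (of_nat (Suc k choose i) * \<phi> (1 * a ^ (Suc k - i) * b ^ i)) * r ^ i) = 0"
      unfolding lin_functional_binomial[OF Suc.prems(1), symmetric]
      using a b Suc.prems(2) by (simp add: forms_add forms_scale del: power_Suc)
    from polyfun_eq_0[THEN iffD1, OF this, rule_format, of 1]
    show "\<phi> (b * a ^ k) = 0"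
      by (simp add: mult.commute del: of_nat_Suc)
  qed
  then show ?case
    using functional_vanishes_on_forms_Suc[OF Suc.prems(1) _ Suc.prems(3)] by blast
qed

subsection \<open>Evaluation\<close>

definition eval_monom :: "(nat \<Rightarrow> complex) \<Rightarrow> monom \<Rightarrow> complex"
  where "eval_monom \<xi> m = (\<Prod>i\<in>Poly_Mapping.keys m. \<xi> i ^ Poly_Mapping.lookup m i)"

lemma eval_monom_eq_prod:
  assumes "finite S" "Poly_Mapping.keys m \<subseteq> S"
  shows "eval_monom \<xi> m = (\<Prod>i\<in>S. \<xi> i ^ Poly_Mapping.lookup m i)"
  unfolding eval_monom_def using assms
  by (intro prod.mono_neutral_left) (auto simp: in_keys_iff)

lemma eval_monom_add: "eval_monom \<xi> (a + b) = eval_monom \<xi> a * eval_monom \<xi> b"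
proof -
  let ?S = "Poly_Mapping.keys a \<union> Poly_Mapping.keys b"
  have "eval_monom \<xi> (a + b) = (\<Prod>i\<in>?S. \<xi> i ^ Poly_Mapping.lookup (a + b) i)"
    by (rule eval_monom_eq_prod) (auto simp: keys_add_monom)
  then show ?thesis
    by (simp add: eval_monom_eq_prod[of ?S] lookup_add power_add prod.distrib)
qed

lemma poly_eval_eq_sum:
  assumes "finite S" "Poly_Mapping.keys p \<subseteq> S"
  shows "poly_eval p \<xi> = (\<Sum>m\<in>S. Poly_Mapping.lookup p m * eval_monom \<xi> m)"
  unfolding poly_eval_def eval_monom_def[symmetric] using assms
  by (intro sum.mono_neutral_left) (auto simp: in_keys_iff)

lemma poly_eval_add: "poly_eval (p + q) \<xi> = poly_eval p \<xi> + poly_eval q \<xi>"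
proof -
  let ?S = "Poly_Mapping.keys p \<union> Poly_Mapping.keys q"
  have "poly_eval (p + q) \<xi> = (\<Sum>m\<in>?S. Poly_Mapping.lookup (p + q) m * eval_monom \<xi> m)"
    by (rule poly_eval_eq_sum) (use Poly_Mapping.keys_add[of p q] in auto)
  then show ?thesis
    by (simp add: poly_eval_eq_sum[of ?S] lookup_add distrib_right sum.distrib)
qed

lemma poly_eval_0: "poly_eval 0 \<xi> = 0"
  by (simp add: poly_eval_def)

lemma poly_eval_single: "poly_eval (Poly_Mapping.single m c) \<xi> = c * eval_monom \<xi> m"
  by (subst poly_eval_eq_sum[of "{m}"]) auto

lemma poly_eval_sum: "poly_eval (sum f S) \<xi> = (\<Sum>i\<in>S. poly_eval (f i) \<xi>)"
  by (induction S rule: infinite_finite_induct) (simp_all add: poly_eval_add poly_eval_0)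

lemma poly_eval_mult: "poly_eval (p * q) \<xi> = poly_eval p \<xi> * poly_eval q \<xi>"
proof -
  have "poly_eval (p * q) \<xi> = poly_eval ((\<Sum>a\<in>Poly_Mapping.keys p. Poly_Mapping.single a (Poly_Mapping.lookup p a)) *
      (\<Sum>b\<in>Poly_Mapping.keys q. Poly_Mapping.single b (Poly_Mapping.lookup q b))) \<xi>"
    by (simp flip: cpoly_sum_monomials)
  also have "\<dots> = (\<Sum>a\<in>Poly_Mapping.keys p. \<Sum>b\<in>Poly_Mapping.keys q.
      (Poly_Mapping.lookup p a * eval_monom \<xi> a) * (Poly_Mapping.lookup q b * eval_monom \<xi> b))"
    by (simp add: sum_product poly_eval_sum mult_single poly_eval_single eval_monom_add mult_ac)
  also have "\<dots> = poly_eval p \<xi> * poly_eval q \<xi>"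
    by (simp only: sum_product poly_eval_eq_sum[OF finite_keys order_refl])
  finally show ?thesis .
qed

lemma poly_eval_lin_functional: "lin_functional (\<lambda>p. poly_eval p \<xi>)"
  by (simp add: lin_functional_def poly_eval_add poly_eval_mult poly_eval_single eval_monom_def)

lemma poly_eval_power: "poly_eval (p ^ k) \<xi> = poly_eval p \<xi> ^ k"
proof (induction k)
  case 0
  show ?case
    using poly_eval_single[of 0 1 \<xi>] by (simp add: eval_monom_def)
qed (simp add: poly_eval_mult)

definition var :: "nat \<Rightarrow> cpoly"
  where "var i = Poly_Mapping.single (Poly_Mapping.single i 1) 1"

lemma poly_eval_var: "poly_eval (var i) \<xi> = \<xi> i"
  by (simp add: var_def poly_eval_single eval_monom_def)

lemma functional_vanishes_on_linear_forms:
  assumes "lin_functional \<phi>" "\<And>i. i < n \<Longrightarrow> \<phi> (var i) = 0" "p \<in> forms n 1"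
  shows "\<phi> p = 0"
proof -
  have "\<phi> (Poly_Mapping.single m c) = 0" if m: "m \<in> monoms n 1" for m c
  proof -
    obtain i m' where im: "i < n" "m' \<in> monoms n 0" "m = Poly_Mapping.single i 1 + m'"
      using monoms_Suc[OF m[unfolded One_nat_def]] .
    then have "Poly_Mapping.single m c = const_poly c * var i"
      by (simp add: monoms_def monom_degree_eq_0_iff var_def mult_single)
    then show ?thesis
      using assms(1,2) im(1) by (simp add: lin_functional_scale)
  qed
  moreover have "\<phi> p = (\<Sum>m\<in>Poly_Mapping.keys p. \<phi> (Poly_Mapping.single m (Poly_Mapping.lookup p m)))"
    using arg_cong[OF cpoly_sum_monomials[of p], of \<phi>] lin_functional_sum[OF assms(1)] by metis
  ultimately show ?thesis
    using assms(3) by (auto simp: mem_forms_iff intro!: sum.neutral)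
qed

text \<open>A linear functional on linear forms is evaluation at a point.\<close>

lemma base_pointI:
  assumes \<phi>: "lin_functional \<phi>" and m: "lin_functional m"
    and power: "\<And>a. a \<in> forms n 1 \<Longrightarrow> \<phi> (a ^ d) = m a ^ d"
    and U: "U \<subseteq> forms n d" "\<And>p. p \<in> U \<Longrightarrow> \<phi> p = 0"
    and x: "x \<in> forms n 1" "m x \<noteq> 0"
  shows "\<not> base_point_free n U"
proof -
  define \<xi> where "\<xi> = (\<lambda>i. m (var i))"
  have eval: "poly_eval a \<xi> = m a" if "a \<in> forms n 1" for a
    using functional_vanishes_on_linear_forms[OF lin_functional_combination[OF
        poly_eval_lin_functional[of \<xi>] m, of 1 "- 1"] _ that]
    by (simp add: poly_eval_var \<xi>_def)
  have "poly_eval p \<xi> = \<phi> p" if "p \<in> forms n d" for p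
    using functional_vanishes_on_forms[OF lin_functional_combination[OF
        poly_eval_lin_functional[of \<xi>] \<phi>, of 1 "- 1"] _ that]
    by (simp add: poly_eval_power eval power)
  then have "\<forall>p\<in>U. poly_eval p \<xi> = 0"
    using U by auto
  moreover have "\<exists>i<n. \<xi> i \<noteq> 0"
    using functional_vanishes_on_linear_forms[OF m _ x(1)] x(2) by (auto simp: \<xi>_def)
  ultimately show ?thesis
    by (auto simp: base_point_free_def)
qed

subsection \<open>Polynomial functions\<close>

definition poly_fun :: "(complex \<Rightarrow> complex) \<Rightarrow> bool"
  where "poly_fun f \<longleftrightarrow> (\<exists>p. \<forall>r. f r = poly p r)"

lemma poly_fun_const [intro!]: "poly_fun (\<lambda>r. c)"
  unfolding poly_fun_def by (rule exI[of _ "[:c:]"]) simp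

lemma poly_fun_id [intro!]: "poly_fun (\<lambda>r. r)"
  unfolding poly_fun_def by (rule exI[of _ "[:0, 1:]"]) simp

lemma poly_fun_add [intro!]: "poly_fun f \<Longrightarrow> poly_fun g \<Longrightarrow> poly_fun (\<lambda>r. f r + g r)"
  unfolding poly_fun_def by (metis poly_add)

lemma poly_fun_diff [intro!]: "poly_fun f \<Longrightarrow> poly_fun g \<Longrightarrow> poly_fun (\<lambda>r. f r - g r)"
  unfolding poly_fun_def by (metis poly_diff)

lemma poly_fun_mult [intro!]: "poly_fun f \<Longrightarrow> poly_fun g \<Longrightarrow> poly_fun (\<lambda>r. f r * g r)"
  unfolding poly_fun_def by (metis poly_mult)

lemma poly_fun_power [intro!]: "poly_fun f \<Longrightarrow> poly_fun (\<lambda>r. f r ^ k)"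
  unfolding poly_fun_def by (metis poly_power)

lemma poly_fun_sum [intro!]: "(\<And>i. i \<in> S \<Longrightarrow> poly_fun (f i)) \<Longrightarrow> poly_fun (\<lambda>r. \<Sum>i\<in>S. f i r)"
  by (induction S rule: infinite_finite_induct) auto

lemma poly_fun_functional:
  "lin_functional \<phi> \<Longrightarrow> poly_fun (\<lambda>r. \<phi> (q * (a + const_poly r * b) ^ k))"
  unfolding lin_functional_binomial by auto

lemma poly_fun_functional_linear:
  assumes "lin_functional \<phi>" shows "poly_fun (\<lambda>r. \<phi> (a + const_poly r * b))"
  using poly_fun_functional[OF assms, of 1 a b 1] by simp

lemma poly_fun_nonzero:
  assumes "poly_fun f" "poly_fun g" "f r \<noteq> 0" "g s \<noteq> 0"
  shows "\<exists>t. f t \<noteq> 0 \<and> g t \<noteq> 0"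
proof -
  obtain p q where pq: "\<And>t. f t = poly p t" "\<And>t. g t = poly q t"
    using assms(1,2) unfolding poly_fun_def by blast
  then have "p * q \<noteq> 0"
    using assms(3,4) by auto
  then obtain t where "poly (p * q) t \<noteq> 0"
    using poly_all_0_iff_0 by blast
  then show ?thesis
    using pq by auto
qed

text \<open>If the values at 0 differed, the difference and the identity function would be nonzero
  at a common point.\<close>

lemma poly_fun_eq_continue:
  assumes "poly_fun f" "poly_fun g" "\<And>r. r \<noteq> 0 \<Longrightarrow> f r = g r"
  shows "f 0 = g 0"
  using poly_fun_nonzero[OF poly_fun_diff[OF assms(1,2)] poly_fun_id, of 0 1] assms(3)
  by fastforce

text \<open>The restriction of a \<mapsto> \<phi> (a^k) to the line a + r b, as a polynomial in r
  that can be differentiated; see \<open>poly_line_poly\<close>.\<close>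

definition line_poly :: "(cpoly \<Rightarrow> complex) \<Rightarrow> cpoly \<Rightarrow> cpoly \<Rightarrow> nat \<Rightarrow> complex poly"
  where "line_poly \<phi> a b k = (\<Sum>i\<le>k. monom (of_nat (k choose i) * \<phi> (a ^ (k - i) * b ^ i)) i)"

lemma poly_line_poly:
  "lin_functional \<phi> \<Longrightarrow> poly (line_poly \<phi> a b k) r = \<phi> ((a + const_poly r * b) ^ k)"
  using lin_functional_binomial[of \<phi> 1 a r b k] by (simp add: line_poly_def poly_sum poly_monom)

lemma pderiv_sum: "pderiv (sum f S) = (\<Sum>i\<in>S. pderiv (f i))"
  by (induction S rule: infinite_finite_induct) (simp_all add: pderiv_add)

lemma pderiv_line_poly:
  assumes "lin_functional \<phi>"
  shows "poly (pderiv (line_poly \<phi> a b (Suc k))) r =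
    of_nat (Suc k) * \<phi> (b * (a + const_poly r * b) ^ k)"
proof -
  have "poly (pderiv (line_poly \<phi> a b (Suc k))) r = (\<Sum>i\<le>k.
      of_nat (Suc i * (Suc k choose Suc i)) * \<phi> (a ^ (k - i) * b ^ Suc i) * r ^ i)"
    unfolding line_poly_def pderiv_sum poly_sum
    by (subst sum.atMost_Suc_shift) (simp add: pderiv_monom poly_monom algebra_simps)
  also have "\<dots> = of_nat (Suc k) * (\<Sum>i\<le>k.
      (of_nat (k choose i) * \<phi> (b * a ^ (k - i) * b ^ i)) * r ^ i)"
    unfolding Suc_times_binomial sum_distrib_left of_nat_mult by (simp add: mult_ac del: of_nat_Suc)
  finally show ?thesis
    unfolding lin_functional_binomial[OF assms] .
qed

text \<open>The hypothesis says that G/F has derivative zero. If G = X^(k+1) H with H(0) nonzero,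
  cancelling X^k and evaluating at 0 leaves (k+1) F(0) H(0) = 0, which is impossible in
  characteristic zero.\<close>

lemma wronskian_zero:
  fixes F G :: "complex poly"
  assumes "F * pderiv G = G * pderiv F" "poly F 0 \<noteq> 0" "poly G 0 = 0"
  shows "G = 0"
proof (rule ccontr)
  assume "G \<noteq> 0"
  then obtain H where H: "G = [:- 0, 1:] ^ order 0 G * H" "\<not> [:- 0, 1:] dvd H"
    using order_decomp by blast
  obtain k where k: "order 0 G = Suc k"
    using assms(3) \<open>G \<noteq> 0\<close> by (metis not0_implies_Suc order_root)
  let ?X = "[:0, 1:] :: complex poly"
  have G: "G = ?X ^ Suc k * H"
    using H(1) k by simp
  have "pderiv G = ?X ^ k * (of_nat (Suc k) * H + ?X * pderiv H)"
    unfolding G pderiv_mult pderiv_power_Suc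
    by (simp add: pderiv_pCons of_nat_poly algebra_simps del: of_nat_Suc)
  then have "?X ^ k * (F * (of_nat (Suc k) * H + ?X * pderiv H)) = ?X ^ k * (?X * H * pderiv F)"
    using assms(1) G by (simp add: mult_ac)
  then have "F * (of_nat (Suc k) * H + ?X * pderiv H) = ?X * H * pderiv F"
    by (simp del: mult_pCons_left)
  from arg_cong[OF this, of "\<lambda>p. poly p 0"]
  have "poly H 0 = 0"
    using assms(2) by (simp del: of_nat_Suc)
  then show False
    using H(2) by (simp add: poly_eq_0_iff_dvd)
qed

subsection \<open>Codimension and functionals\<close>

text \<open>Products of the variables with a spanning set in degree k span degree k + 1. Finiteness
  makes \<open>cpoly.dim\<close> a count of basis elements.\<close>

lemma forms_finitely_spanned: "\<exists>F. finite F \<and> forms n k \<subseteq> cpoly.span F"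
proof (induction k)
  case 0
  have "forms n 0 \<subseteq> cpoly.span {1}"
  proof
    fix p assume "p \<in> forms n 0"
    then obtain c where "p = cscale c 1"
      using forms_degree_0[of p n] by (auto simp: cscale_eq_times)
    then show "p \<in> cpoly.span {1}"
      by (simp add: cpoly.span_base cpoly.span_scale)
  qed
  then show ?case
    by blast
next
  case (Suc k)
  then obtain F where F: "finite F" "forms n k \<subseteq> cpoly.span F"
    by blast
  define G where "G = (\<lambda>(i, f). var i * f) ` ({..<n} \<times> F)"
  have "forms n (Suc k) \<subseteq> cpoly.span G"
  proof
    fix p assume p: "p \<in> forms n (Suc k)"
    show "p \<in> cpoly.span G"
    proof (rule ccontr)
      assume "p \<notin> cpoly.span G"
      then obtain \<phi> where \<phi>: "lin_functional \<phi>" "\<And>g. g \<in> G \<Longrightarrow> \<phi> g = 0" "\<phi> p \<noteq> 0"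
        using separating_functional by blast
      have var: "\<phi> (var i * q) = 0" if "i < n" "q \<in> forms n k" for i q
        by (rule span_functional_closed[OF lin_functional_mult[OF \<phi>(1)], where S = F])
          (use F(2) that in \<open>auto intro!: \<phi>(2) simp: G_def\<close>)
      have "\<phi> (q * a) = 0" if "a \<in> forms n 1" "q \<in> forms n k" for a q
        by (rule functional_vanishes_on_linear_forms[OF lin_functional_mult[OF \<phi>(1)] _ that(1)])
          (use var that(2) in \<open>simp add: mult.commute\<close>)
      then have "\<phi> p = 0"
        by (intro functional_vanishes_on_forms_Suc[OF \<phi>(1) _ p]) (simp add: mult.commute)
      then show False
        using \<phi>(3) by simp
    qed
  qed
  moreover have "finite G"
    using F(1) by (simp add: G_def)
  ultimately show ?case
    by blast
qed

lemma finite_independent_forms: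
  assumes "B \<subseteq> forms n k" "cpoly.independent B"
  shows "finite B"
proof -
  obtain F where "finite F" "forms n k \<subseteq> cpoly.span F"
    using forms_finitely_spanned by blast
  then show ?thesis
    using cpoly.independent_span_bound[of F B] assms by blast
qed

text \<open>By duality, T completes a basis B of the span of S to a spanning set of the forms, so at
  most \<open>card T\<close> dimensions are missing.\<close>

lemma codim_in_forms_le:
  assumes S: "S \<subseteq> forms n k" and T: "finite T" "card T \<le> t"
    and vanish: "\<And>\<phi> p. lin_functional \<phi> \<Longrightarrow> (\<And>s. s \<in> S \<Longrightarrow> \<phi> s = 0) \<Longrightarrow>
      (\<And>s. s \<in> T \<Longrightarrow> \<phi> s = 0) \<Longrightarrow> p \<in> forms n k \<Longrightarrow> \<phi> p = 0"
  shows "codim_in_forms n k (cpoly.span S) \<le> t"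
proof -
  obtain B where B: "B \<subseteq> S" "cpoly.independent B" "S \<subseteq> cpoly.span B"
    using cpoly.maximal_independent_subset by blast
  then have fin: "finite B"
    using S finite_independent_forms by blast
  have "forms n k \<subseteq> cpoly.span (B \<union> T)"
  proof
    fix p assume p: "p \<in> forms n k"
    show "p \<in> cpoly.span (B \<union> T)"
    proof (rule ccontr)
      assume "p \<notin> cpoly.span (B \<union> T)"
      then obtain \<phi> where \<phi>: "lin_functional \<phi>" "\<And>s. s \<in> B \<union> T \<Longrightarrow> \<phi> s = 0" "\<phi> p \<noteq> 0"
        using separating_functional by blast
      have "\<phi> s = 0" if "s \<in> S" for s
        using span_functional_closed[OF \<phi>(1), of B s] \<phi>(2) B(3) that by blast
      then show False
        using vanish[OF \<phi>(1) _ _ p] \<phi>(2,3) by blast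
    qed
  qed
  then have "cpoly.dim (forms n k) \<le> card (B \<union> T)"
    using cpoly.dim_le_card fin T(1) by blast
  also have "\<dots> \<le> card B + t"
    using card_Un_le[of B T] T(2) by linarith
  also have "card B = cpoly.dim (cpoly.span S)"
    using cpoly.dim_unique[of B S "card B"] B by simp
  finally show ?thesis
    by (simp add: codim_in_forms_def)
qed

text \<open>A basis of U extends by exactly two vectors s, t to a basis of the forms; the
  coordinates at s and t cut out U.\<close>

lemma codim2_functionals:
  assumes "cpoly.subspace U" "U \<subseteq> forms n d" "codim_in_forms n d U = 2"
  obtains \<phi> \<psi> s t where "lin_functional \<phi>" "lin_functional \<psi>"
    "U = {p \<in> forms n d. \<phi> p = 0 \<and> \<psi> p = 0}"
    "s \<in> forms n d" "\<phi> s = 1" "\<psi> s = 0" "t \<in> forms n d" "\<phi> t = 0" "\<psi> t = 1"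
proof -
  obtain B where B: "B \<subseteq> U" "cpoly.independent B" "U \<subseteq> cpoly.span B"
    using cpoly.maximal_independent_subset by blast
  obtain C where C: "B \<subseteq> C" "C \<subseteq> forms n d" "cpoly.independent C" "forms n d \<subseteq> cpoly.span C"
    using cpoly.maximal_independent_subset_extend[of B "forms n d"] B assms(2) by blast
  have span_B: "cpoly.span B = U"
    using B(1,3) cpoly.span_minimal[OF _ assms(1)] by blast
  have "finite C"
    using finite_independent_forms C by blast
  moreover have "cpoly.dim U = card B" "cpoly.dim (forms n d) = card C"
    using cpoly.dim_unique[of B U] cpoly.dim_unique[of C "forms n d"] B C by auto
  ultimately have "card (C - B) = 2"
    using assms(3) C(1) by (simp add: codim_in_forms_def card_Diff_subset finite_subset)
  then obtain s t where st: "C - B = {s, t}" "s \<noteq> t"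
    by (auto simp: card_2_iff)
  \<comment> \<open>Coordinates are taken in a basis of the whole polynomial space, so that the
    functionals are linear everywhere and not only on forms.\<close>
  define E where "E = cpoly.extend_basis C"
  have E: "cpoly.independent E" "C \<subseteq> E"
    unfolding E_def using cpoly.independent_extend_basis cpoly.extend_basis_superset C(3) by auto
  define coord where "coord = (\<lambda>b p. cpoly.representation E p b)"
  have lin: "lin_functional (coord b)" for b
    unfolding coord_def E_def by (rule representation_lin_functional[OF C(3)])
  have basis: "coord b c = (if b = c then 1 else 0)" if "c \<in> C" for b c
    using cpoly.representation_basis[OF E(1), of c] that E(2) by (auto simp: coord_def)
  have "U = {p \<in> forms n d. coord s p = 0 \<and> coord t p = 0}"
  proof (intro subset_antisym subsetI)
    fix p assume p: "p \<in> U"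
    have "coord b p = 0" if "b \<in> {s, t}" for b
      by (rule span_functional_closed[OF lin, of B])
        (use p B that st C(1) in \<open>auto simp: basis subset_eq\<close>)
    then show "p \<in> {p \<in> forms n d. coord s p = 0 \<and> coord t p = 0}"
      using p assms(2) by auto
  next
    fix p assume p: "p \<in> {p \<in> forms n d. coord s p = 0 \<and> coord t p = 0}"
    then have "p \<in> cpoly.span C"
      using C(4) by blast
    then have "p = (\<Sum>b\<in>C. cscale (coord b p) b)"
      using cpoly.sum_representation_eq[OF C(3) _ \<open>finite C\<close> order_refl]
        cpoly.representation_extend[OF E(1) _ E(2)]
      by (simp add: coord_def)
    also have "\<dots> = (\<Sum>b\<in>B. cscale (coord b p) b)"
      by (rule sum.mono_neutral_right) (use p st C(1) \<open>finite C\<close> in auto)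
    also have "\<dots> \<in> cpoly.span B"
      by (intro cpoly.span_sum cpoly.span_scale cpoly.span_base)
    finally show "p \<in> U"
      using span_B by simp
  qed
  moreover have "s \<in> C" "t \<in> C"
    using st by auto
  ultimately show ?thesis
    using that[of "coord s" "coord t" s t] lin basis st(2) C(2) by auto
qed

text \<open>Otherwise choose x0 whose d-th power is not killed by both functionals, and a
  combination \<gamma> that kills it. On every line through x0 the Wronskian of \<alpha> and
  \<gamma> is zero, so \<gamma> vanishes there by \<open>wronskian_zero\<close>. Hence \<gamma>
  kills all d-th powers and all forms, against the values at s and t.\<close>

lemma jacobian_nonzero:
  assumes \<phi>: "lin_functional \<phi>" and \<psi>: "lin_functional \<psi>" and d: "d > 0"
    and st: "s \<in> forms n d" "\<phi> s = 1" "\<psi> s = 0" "t \<in> forms n d" "\<phi> t = 0" "\<psi> t = 1"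
  shows "\<exists>x\<in>forms n 1. \<exists>y\<in>forms n 1.
    \<phi> (x ^ d) * \<psi> (x ^ (d - 1) * y) \<noteq> \<psi> (x ^ d) * \<phi> (x ^ (d - 1) * y)"
proof (rule ccontr)
  assume neg: "\<not> ?thesis"
  have D: "\<phi> (x ^ d) * \<psi> (x ^ (d - 1) * y) = \<psi> (x ^ d) * \<phi> (x ^ (d - 1) * y)"
    if "x \<in> forms n 1" "y \<in> forms n 1" for x y
    using neg that by auto
  obtain x0 where x0: "x0 \<in> forms n 1" "\<phi> (x0 ^ d) \<noteq> 0 \<or> \<psi> (x0 ^ d) \<noteq> 0"
    using functional_vanishes_on_forms[OF \<phi> _ st(1)] st(2) by force
  define p q where "p = \<phi> (x0 ^ d)" and "q = \<psi> (x0 ^ d)"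
  obtain a b where ab: "a * p + b * q = 1"
    using x0(2) p_def q_def by (metis add.right_neutral add.left_neutral mult_zero_left
        left_inverse)
  define \<alpha> where "\<alpha> = (\<lambda>u. a * \<phi> u + b * \<psi> u)"
  define \<gamma> where "\<gamma> = (\<lambda>u. (- q) * \<phi> u + p * \<psi> u)"
  have lin: "lin_functional \<alpha>" "lin_functional \<gamma>"
    unfolding \<alpha>_def \<gamma>_def by (intro lin_functional_combination \<phi> \<psi>)+
  have x0d: "\<alpha> (x0 ^ d) = 1" "\<gamma> (x0 ^ d) = 0"
    using ab by (simp_all add: \<alpha>_def \<gamma>_def p_def q_def)
  have D': "\<alpha> (x ^ d) * \<gamma> (x ^ (d - 1) * y) = \<gamma> (x ^ d) * \<alpha> (x ^ (d - 1) * y)"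
    if "x \<in> forms n 1" "y \<in> forms n 1" for x y
  proof -
    \<comment> \<open>The change from (\<phi>, \<psi>) to (\<alpha>, \<gamma>) multiplies the
      determinant by \<open>a * p + b * q\<close>, which is 1.\<close>
    have "\<alpha> (x ^ d) * \<gamma> (x ^ (d - 1) * y) - \<gamma> (x ^ d) * \<alpha> (x ^ (d - 1) * y) = (a * p + b * q) *
        (\<phi> (x ^ d) * \<psi> (x ^ (d - 1) * y) - \<psi> (x ^ d) * \<phi> (x ^ (d - 1) * y))"
      unfolding \<alpha>_def \<gamma>_def by (simp add: algebra_simps)
    then show ?thesis
      using D[OF that] by simp
  qed
  have "\<gamma> (c ^ d) = 0" if c: "c \<in> forms n 1" for c
  proof -
    define v where "v = c - x0"
    have v: "v \<in> forms n 1"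
      unfolding v_def using c x0(1) by (rule forms_diff)
    define F G where "F = line_poly \<alpha> x0 v d" and "G = line_poly \<gamma> x0 v d"
    obtain e where e: "d = Suc e"
      using d by (cases d) auto
    have "poly (F * pderiv G) r = poly (G * pderiv F) r" for r
      using D'[OF forms_add[OF x0(1) forms_scale[OF v, of r]] v]
      unfolding F_def G_def poly_mult poly_line_poly[OF lin(1)] poly_line_poly[OF lin(2)]
      unfolding e pderiv_line_poly[OF lin(1)] pderiv_line_poly[OF lin(2)]
      by (simp add: mult.commute mult.left_commute del: of_nat_Suc power_Suc)
    then have "F * pderiv G = G * pderiv F"
      by (simp add: poly_eq_poly_eq_iff[symmetric] fun_eq_iff)
    moreover have "poly F 0 = 1" "poly G 0 = 0"
      using x0d by (simp_all add: F_def G_def poly_line_poly lin)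
    ultimately have "G = 0"
      by (intro wronskian_zero[of F]) auto
    then have "poly G 1 = 0"
      by simp
    then show ?thesis
      by (simp add: G_def poly_line_poly lin v_def)
  qed
  then have "\<gamma> s = 0" "\<gamma> t = 0"
    using functional_vanishes_on_forms[OF lin(2)] st by blast+
  then show False
    using x0(2) st by (simp add: \<gamma>_def p_def q_def)
qed

subsection \<open>Functionals vanishing on the square\<close>

text \<open>Decomposing one linear factor at a time shows that products of x, y and elements of Z
  span the forms.\<close>

lemma functional_vanishes_on_products:
  assumes "lin_functional \<phi>"
    and decomp: "\<And>a. a \<in> forms n 1 \<Longrightarrow> \<exists>s t. \<exists>z\<in>Z. a = const_poly s * x + const_poly t * y + z"
    and "\<And>i j zs. set zs \<subseteq> Z \<Longrightarrow> i + j + length zs = k \<Longrightarrow> \<phi> (x ^ i * y ^ j * prod_list zs) = 0"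
    and "p \<in> forms n k"
  shows "\<phi> p = 0"
  using assms(1,3,4)
proof (induction k arbitrary: \<phi> p)
  case 0
  then obtain c where "p = const_poly c * 1"
    using forms_degree_0[of p n] by auto
  moreover have "\<phi> 1 = 0"
    using 0(2)[of "[]" 0 0] by simp
  ultimately show ?case
    using lin_functional_scale[OF 0(1), of c 1] by simp
next
  case (Suc k)
  have "\<phi> (a * q) = 0" if a: "a \<in> forms n 1" and q: "q \<in> forms n k" for a q
  proof (rule Suc.IH[OF lin_functional_mult[OF Suc.prems(1)] _ q])
    fix i j zs assume zs: "set zs \<subseteq> Z" "i + j + length zs = k"
    obtain s t z where z: "z \<in> Z" "a = const_poly s * x + const_poly t * y + z"
      using decomp[OF a] by blast
    have "a * (x ^ i * y ^ j * prod_list zs) = const_poly s * (x ^ Suc i * y ^ j * prod_list zs)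
        + const_poly t * (x ^ i * y ^ Suc j * prod_list zs) + x ^ i * y ^ j * prod_list (z # zs)"
      unfolding z(2) by (simp add: algebra_simps)
    then show "\<phi> (a * (x ^ i * y ^ j * prod_list zs)) = 0"
      using zs z(1) Suc.prems(2)[of zs "Suc i" j] Suc.prems(2)[of zs i "Suc j"]
        Suc.prems(2)[of "z # zs" i j]
      by (simp only: lin_functional_add[OF Suc.prems(1)] lin_functional_scale[OF Suc.prems(1)]) simp
  qed
  then show ?case
    using functional_vanishes_on_forms_Suc[OF Suc.prems(1) _ Suc.prems(3)] by blast
qed

text \<open>The first half is filled greedily: first from \<open>i\<close>, then from
  \<open>j\<close>, then from the list.\<close>

lemma split_exponents:
  fixes i j m :: nat
  assumes "i + j + length zs = 2 * m"
  obtains i1 i2 j1 j2 r1 r2 where "i = i1 + i2" "j = j1 + j2" "zs = r1 @ r2"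
    "i1 + j1 + length r1 = m" "i2 + j2 + length r2 = m"
proof -
  define i1 where "i1 = min i m"
  define j1 where "j1 = min j (m - i1)"
  define r1 where "r1 = take (m - i1 - j1) zs"
  show ?thesis
    by (rule that[of i1 "i - i1" j1 "j - j1" r1 "drop (m - i1 - j1) zs"])
      (use assms in \<open>auto simp: i1_def j1_def r1_def\<close>)
qed

definition square_functional :: "cpoly set \<Rightarrow> (cpoly \<Rightarrow> complex) \<Rightarrow> bool"
  where "square_functional U \<phi> \<longleftrightarrow> lin_functional \<phi> \<and> (\<forall>p\<in>U. \<forall>q\<in>U. \<phi> (p * q) = 0)"

text \<open>The dual form of the bound: t test vectors detect every functional that kills the square
  of U without killing all forms of degree 2d. All bounds are proved in this form and transferred by
  \<open>codim_square_space_le\<close>.\<close>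

definition square_codim_le :: "nat \<Rightarrow> nat \<Rightarrow> cpoly set \<Rightarrow> nat \<Rightarrow> bool"
  where "square_codim_le n d U t \<longleftrightarrow> (\<exists>T. finite T \<and> card T \<le> t \<and>
    (\<forall>\<phi>. square_functional U \<phi> \<longrightarrow> (\<forall>s\<in>T. \<phi> s = 0) \<longrightarrow> (\<forall>p\<in>forms n (2 * d). \<phi> p = 0)))"

lemma square_codim_le_mono: "square_codim_le n d U s \<Longrightarrow> s \<le> t \<Longrightarrow> square_codim_le n d U t"
  unfolding square_codim_le_def using le_trans by blast

lemma codim_square_space_le:
  assumes "U \<subseteq> forms n d" "square_codim_le n d U t"
  shows "codim_in_forms n (2 * d) (square_space U) \<le> t"
proof -
  obtain T where T: "finite T" "card T \<le> t" "\<And>\<phi> p. square_functional U \<phi> \<Longrightarrow>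
      (\<forall>s\<in>T. \<phi> s = 0) \<Longrightarrow> p \<in> forms n (2 * d) \<Longrightarrow> \<phi> p = 0"
    using assms(2) unfolding square_codim_le_def by blast
  have "{p * q |p q. p \<in> U \<and> q \<in> U} \<subseteq> forms n (2 * d)"
    using assms(1) forms_mult[of _ n d _ d] by (auto simp: mult_2)
  then show ?thesis
    unfolding square_space_def
  proof (rule codim_in_forms_le[OF _ T(1,2)])
    fix \<phi> p
    assume "lin_functional \<phi>" "\<And>s. s \<in> {p * q |p q. p \<in> U \<and> q \<in> U} \<Longrightarrow> \<phi> s = 0"
      "\<And>s. s \<in> T \<Longrightarrow> \<phi> s = 0" "p \<in> forms n (2 * d)"
    then show "\<phi> p = 0"
      using T(3)[of \<phi> p] by (force simp: square_functional_def)
  qed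
qed

subsection \<open>Normal form of a pencil\<close>

text \<open>The two functionals are normalised to be dual to x^d and x^(d-1) y, which thus span a
  complement of U.\<close>

locale pencil =
  fixes n d :: nat and U :: "cpoly set" and \<alpha> \<gamma> :: "cpoly \<Rightarrow> complex" and x y :: cpoly
  assumes d: "2 \<le> d"
    and lin_\<alpha>: "lin_functional \<alpha>" and lin_\<gamma>: "lin_functional \<gamma>"
    and U_eq: "U = {p \<in> forms n d. \<alpha> p = 0 \<and> \<gamma> p = 0}"
    and x: "x \<in> forms n 1" and y: "y \<in> forms n 1"
    and \<alpha>_x: "\<alpha> (x ^ d) = 1" and \<gamma>_x: "\<gamma> (x ^ d) = 0"
    and \<alpha>_y: "\<alpha> (x ^ (d - 1) * y) = 0" and \<gamma>_y: "\<gamma> (x ^ (d - 1) * y) = 1"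
begin

definition Z :: "cpoly set"
  where "Z = {z \<in> forms n 1. \<alpha> (x ^ (d - 1) * z) = 0 \<and> \<gamma> (x ^ (d - 1) * z) = 0}"

definition \<alpha>c :: "nat \<Rightarrow> complex" where "\<alpha>c k = \<alpha> (x ^ (d - k) * y ^ k)"
definition \<gamma>c :: "nat \<Rightarrow> complex" where "\<gamma>c k = \<gamma> (x ^ (d - k) * y ^ k)"
definition \<alpha>b :: "nat \<Rightarrow> cpoly \<Rightarrow> complex" where "\<alpha>b k z = \<alpha> (x ^ (d - 1 - k) * y ^ k * z)"
definition \<gamma>b :: "nat \<Rightarrow> cpoly \<Rightarrow> complex" where "\<gamma>b k z = \<gamma> (x ^ (d - 1 - k) * y ^ k * z)"

text \<open>
  \<open>\<beta>\<close> is a common root of all \<open>\<chi> k\<close> iff \<open>\<alpha> + \<beta> \<gamma>\<close> is, on binary forms in \<open>x\<close> and \<open>y\<close>,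
  the evaluation at \<open>(1, \<beta>)\<close>.
\<close>

definition \<chi> :: "nat \<Rightarrow> complex \<Rightarrow> complex" where "\<chi> k \<beta> = \<beta> ^ k - \<gamma>c k * \<beta> - \<alpha>c k"
text \<open>Minus half the derivative of \<chi> 2 \<beta>, with \<beta> fixed, when y moves in
  direction z. At a simple root \<beta> of \<chi> 2 it is nonzero exactly if the root moves to first
  order.\<close>

definition \<eta> :: "cpoly \<Rightarrow> complex \<Rightarrow> complex" where "\<eta> z \<beta> = \<alpha>b 1 z + \<gamma>b 1 z * \<beta>"

lemmas functional_simps = lin_functional_simps[OF lin_\<alpha>] lin_functional_simps[OF lin_\<gamma>]

lemma Z_forms: "z \<in> Z \<Longrightarrow> z \<in> forms n 1"
  by (simp add: Z_def)

lemma Z_add: "z \<in> Z \<Longrightarrow> w \<in> Z \<Longrightarrow> z + w \<in> Z"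
  by (simp add: Z_def forms_add distrib_left functional_simps)

lemma Z_scale: "z \<in> Z \<Longrightarrow> const_poly c * z \<in> Z"
  by (simp add: Z_def forms_scale mult.left_commute[of _ "const_poly c"] functional_simps)

lemma Z_zero: "0 \<in> Z"
  by (simp add: Z_def functional_simps)

lemma power_d: "x ^ (d - 1) * x = x ^ d"
  using d power_Suc2[of x "d - 1"] by simp

lemma decompose:
  assumes "a \<in> forms n 1"
  shows "\<exists>z\<in>Z. a = const_poly (\<alpha> (x ^ (d - 1) * a)) * x + const_poly (\<gamma> (x ^ (d - 1) * a)) * y + z"
proof -
  define s t where "s = \<alpha> (x ^ (d - 1) * a)" and "t = \<gamma> (x ^ (d - 1) * a)"
  define z where "z = a - const_poly s * x - const_poly t * y"
  have "x ^ (d - 1) * z = x ^ (d - 1) * a - const_poly s * x ^ d - const_poly t * (x ^ (d - 1) * y)"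
    unfolding z_def by (simp add: algebra_simps flip: power_d)
  then have "z \<in> Z"
    using assms x y \<alpha>_x \<gamma>_x \<alpha>_y \<gamma>_y
    by (simp add: Z_def z_def forms_diff forms_scale functional_simps s_def t_def)
  moreover have "a = const_poly s * x + const_poly t * y + z"
    by (simp add: z_def)
  ultimately show ?thesis
    unfolding s_def t_def by blast
qed

text \<open>For v in Z the form x^(d-1) v lies in U, so the shift keeps the normalisation; Z depends
  on x only and stays the same.\<close>

lemma pencil_shift: "v \<in> Z \<Longrightarrow> pencil n d U \<alpha> \<gamma> x (y + v)"
  using d lin_\<alpha> lin_\<gamma> U_eq x y \<alpha>_x \<gamma>_x \<alpha>_y \<gamma>_y
  by unfold_locales
    (simp_all add: Z_def forms_add distrib_left functional_simps)

lemma reduced_mem: "h \<in> forms n d \<Longrightarrow>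
    h - const_poly (\<alpha> h) * x ^ d - const_poly (\<gamma> h) * (x ^ (d - 1) * y) \<in> U"
proof -
  assume h: "h \<in> forms n d"
  have "x ^ (d - 1) * y \<in> forms n d"
    using forms_linear_mult[OF y forms_power[OF x, of "d - 1"]] d by (simp add: mult.commute)
  then have "h - const_poly (\<alpha> h) * x ^ d - const_poly (\<gamma> h) * (x ^ (d - 1) * y) \<in> forms n d"
    by (intro forms_diff forms_scale forms_power x h)
  then show ?thesis
    using \<alpha>_x \<gamma>_x \<alpha>_y \<gamma>_y by (simp add: U_eq functional_simps)
qed

end

section \<open>Values of a functional that vanishes on the square\<close>

locale pencil_functional = pencil +
  fixes \<Lambda> :: "cpoly \<Rightarrow> complex"
  assumes square: "square_functional U \<Lambda>"
    and low: "\<And>k. k \<le> 3 \<Longrightarrow> \<Lambda> (x ^ (2 * d - k) * y ^ k) = 0"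
begin

definition E :: "nat \<Rightarrow> cpoly \<Rightarrow> complex"
  where "E k z = \<Lambda> (x ^ (2 * d - 1 - k) * y ^ k * z)"

definition F :: "nat \<Rightarrow> cpoly \<Rightarrow> cpoly \<Rightarrow> complex"
  where "F k z w = \<Lambda> (x ^ (2 * d - 2 - k) * y ^ k * z * w)"

lemma lin_\<Lambda>: "lin_functional \<Lambda>"
  using square by (simp add: square_functional_def)

lemma \<Lambda>_square: "p \<in> U \<Longrightarrow> q \<in> U \<Longrightarrow> \<Lambda> (p * q) = 0"
  using square by (simp add: square_functional_def)

text \<open>Subtracting multiples of x^d and x^(d-1) y puts both factors into U, where their product
  is killed. In the expansion the products of two subtracted terms vanish by \<open>low\<close>, and
  only mixed terms survive.\<close>

lemma \<Lambda>_mult: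
  assumes "h \<in> forms n d" "h' \<in> forms n d"
  shows "\<Lambda> (h * h') = \<alpha> h * \<Lambda> (x ^ d * h') + \<gamma> h * \<Lambda> (x ^ (d - 1) * y * h')
    + \<alpha> h' * \<Lambda> (x ^ d * h) + \<gamma> h' * \<Lambda> (x ^ (d - 1) * y * h)"
proof -
  define X Y where "X = x ^ d" and "Y = x ^ (d - 1) * y"
  have e: "2 * d - 0 = d + d" "2 * d - 1 = d + (d - 1)" "2 * d - 2 = (d - 1) + (d - 1)"
    using d by auto
  have "X * X = x ^ (2 * d - 0) * y ^ 0" "X * Y = x ^ (2 * d - 1) * y ^ 1"
    "Y * Y = x ^ (2 * d - 2) * y ^ 2"
    unfolding X_def Y_def e by (simp_all only: power_add power2_eq_square power_0 power_one_right mult_1_right mult_1_left mult_ac)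
  then have low': "\<Lambda> (X * X) = 0" "\<Lambda> (X * Y) = 0" "\<Lambda> (Y * Y) = 0"
    using low[of 0] low[of 1] low[of 2] by simp_all
  define s t s' t' where st: "s = \<alpha> h" "t = \<gamma> h" "s' = \<alpha> h'" "t' = \<gamma> h'"
  have "\<Lambda> ((h - const_poly s * X - const_poly t * Y) * (h' - const_poly s' * X - const_poly t' * Y)) = 0"
    unfolding X_def Y_def st
    by (rule \<Lambda>_square[OF reduced_mem[OF assms(1)] reduced_mem[OF assms(2)]])
  moreover have "(h - const_poly s * X - const_poly t * Y) * (h' - const_poly s' * X - const_poly t' * Y)
      = h * h' - const_poly s * (X * h') - const_poly t * (Y * h') - const_poly s' * (X * h)
        - const_poly t' * (Y * h) + const_poly s * (const_poly s' * (X * X))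
        + const_poly s * (const_poly t' * (X * Y)) + const_poly t * (const_poly s' * (X * Y))
        + const_poly t * (const_poly t' * (Y * Y))"
    by (simp add: algebra_simps)
  ultimately show ?thesis
    unfolding X_def[symmetric] Y_def[symmetric] st[symmetric]
    by (simp only: lin_functional_add[OF lin_\<Lambda>] lin_functional_diff[OF lin_\<Lambda>]
        lin_functional_scale[OF lin_\<Lambda>]) (simp add: low' algebra_simps)
qed

lemma monomial_forms: "i + j = k \<Longrightarrow> x ^ i * y ^ j \<in> forms n k"
  using forms_mult[OF forms_power[OF x] forms_power[OF y]] by blast

text \<open>For j at least 4, split y^j into two powers with exponents between 2 and d. The mixed
  terms of \<open>\<Lambda>_mult\<close> then have y-exponents at most max(j1, j2) + 1 < j, so the
  four values in \<open>low\<close> start the induction.\<close>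

lemma \<Lambda>_binary: "i + j = 2 * d \<Longrightarrow> \<Lambda> (x ^ i * y ^ j) = 0"
proof (induction j arbitrary: i rule: less_induct)
  case (less j)
  show ?case
  proof (cases "j \<le> 3")
    case True
    moreover have "i = 2 * d - j"
      using less.prems by simp
    ultimately show ?thesis
      using low by simp
  next
    case False
    define j1 j2 where "j1 = min d (j - 2)" and "j2 = j - j1"
    have j: "j1 \<le> d" "j2 \<le> d" "2 \<le> j1" "2 \<le> j2" "j = j1 + j2" "i = (d - j1) + (d - j2)"
      using False less.prems d by (auto simp: j1_def j2_def)
    have mult: "x ^ a * (x ^ b * y ^ c) = x ^ (a + b) * y ^ c"
      "x ^ a * y * (x ^ b * y ^ c) = x ^ (a + b) * y ^ Suc c" for a b c
      by (simp_all add: power_add mult_ac)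
    have "\<Lambda> (x ^ (d + (d - j1)) * y ^ j1) = 0" "\<Lambda> (x ^ (d - 1 + (d - j1)) * y ^ Suc j1) = 0"
      "\<Lambda> (x ^ (d + (d - j2)) * y ^ j2) = 0" "\<Lambda> (x ^ (d - 1 + (d - j2)) * y ^ Suc j2) = 0"
      using j d by (intro less.IH; simp)+
    then have "\<Lambda> (x ^ (d - j1) * y ^ j1 * (x ^ (d - j2) * y ^ j2)) = 0"
      using \<Lambda>_mult[OF monomial_forms[of "d - j1" j1] monomial_forms[of "d - j2" j2]] j(1,2)
      by (simp add: mult del: power_Suc)
    then show ?thesis
      by (simp add: j(5,6) power_add mult_ac)
  qed
qed

lemma \<Lambda>_binary_mult:
  assumes "i \<le> d"
  shows "\<Lambda> (x ^ d * (x ^ (d - i) * y ^ i)) = 0" "\<Lambda> (x ^ (d - 1) * y * (x ^ (d - i) * y ^ i)) = 0"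
proof -
  have "x ^ d * (x ^ (d - i) * y ^ i) = x ^ (d + (d - i)) * y ^ i"
    "x ^ (d - 1) * y * (x ^ (d - i) * y ^ i) = x ^ (d - 1 + (d - i)) * y ^ Suc i"
    by (simp_all add: power_add mult_ac)
  moreover have "\<Lambda> (x ^ (d + (d - i)) * y ^ i) = 0" "\<Lambda> (x ^ (d - 1 + (d - i)) * y ^ Suc i) = 0"
    using assms d by (intro \<Lambda>_binary; simp)+
  ultimately show "\<Lambda> (x ^ d * (x ^ (d - i) * y ^ i)) = 0" "\<Lambda> (x ^ (d - 1) * y * (x ^ (d - i) * y ^ i)) = 0"
    by (simp_all only:)
qed

text \<open>Apply \<open>\<Lambda>_mult\<close> to x^(d-i) y^i and x^(d-1-j) y^j z; the mixed terms
  without z vanish by \<open>\<Lambda>_binary\<close>. For fixed i this is a linear recursion in j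
  with characteristic polynomial \<chi> i.\<close>

lemma E_recursion:
  assumes "z \<in> Z" "i \<le> d" "j \<le> d - 1"
  shows "E (i + j) z = \<alpha>c i * E j z + \<gamma>c i * E (Suc j) z"
proof -
  have e: "2 * d - 1 - (i + j) = (d - i) + (d - 1 - j)" "2 * d - 1 - j = d + (d - 1 - j)"
    "2 * d - 1 - Suc j = (d - 1) + (d - 1 - j)"
    using d assms by auto
  have forms: "x ^ (d - i) * y ^ i \<in> forms n d" "x ^ (d - 1 - j) * y ^ j * z \<in> forms n d"
    using monomial_forms[of "d - i" i d] assms d
      forms_linear_mult[OF Z_forms[OF assms(1)] monomial_forms[of "d - 1 - j" j "d - 1"]]
    by (simp_all add: mult.commute)
  have "\<Lambda> (x ^ d * (x ^ (d - i) * y ^ i)) = 0" "\<Lambda> (x ^ (d - 1) * y * (x ^ (d - i) * y ^ i)) = 0"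
    using \<Lambda>_binary_mult assms by blast+
  then show ?thesis
    using \<Lambda>_mult[OF forms]
    unfolding E_def e \<alpha>c_def \<gamma>c_def by (simp add: power_add mult_ac)
qed

lemma E_zero:
  assumes "z \<in> Z" "E 0 z = 0" "E 1 z = 0" "k \<le> 2 * d - 1"
  shows "E k z = 0"
  using assms(4)
proof (induction k rule: less_induct)
  case (less k)
  show ?case
  proof (cases "k \<le> 1")
    case True
    then show ?thesis
      using assms(2,3) by (cases k) auto
  next
    case False
    define i j where "i = min k d" and "j = k - i"
    have ij: "k = i + j" "i \<le> d" "2 \<le> i" "j \<le> d - 1"
      using False less.prems d by (auto simp: i_def j_def)
    then show ?thesis
      using E_recursion[OF assms(1) ij(2,4)] less.IH[of j] less.IH[of "Suc j"] less.prems by auto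
  qed
qed

text \<open>A product with at least two factors from Z splits into two forms of degree d containing
  at least one of them each, and \<open>\<Lambda>_mult\<close> then leaves products with fewer such
  factors. No factor is \<open>\<Lambda>_binary\<close>, one factor is
  \<open>E_zero\<close>.\<close>

lemma \<Lambda>_products:
  assumes E: "\<And>z. z \<in> Z \<Longrightarrow> E 0 z = 0" "\<And>z. z \<in> Z \<Longrightarrow> E 1 z = 0"
  shows "set zs \<subseteq> Z \<Longrightarrow> i + j + length zs = 2 * d \<Longrightarrow> \<Lambda> (x ^ i * y ^ j * prod_list zs) = 0"
proof (induction zs arbitrary: i j rule: length_induct)
  case (1 zs)
  consider "zs = []" | z where "zs = [z]" | z w rest where "zs = z # w # rest"
    by (metis neq_Nil_conv)
  then show ?case
  proof cases
    case 1
    then show ?thesis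
      using \<Lambda>_binary "1.prems" by simp
  next
    case 2
    have "E j z = 0"
      using E_zero[of z j] E "1.prems" 2 d by auto
    moreover have "i = 2 * d - 1 - j"
      using "1.prems" 2 by auto
    ultimately show ?thesis
      using 2 by (simp add: E_def)
  next
    case 3
    have "i + j + length rest = 2 * (d - 1)"
      using "1.prems" 3 by auto
    then obtain i1 i2 j1 j2 r1 r2 where split: "i = i1 + i2" "j = j1 + j2" "rest = r1 @ r2"
      "i1 + j1 + length r1 = d - 1" "i2 + j2 + length r2 = d - 1"
      by (rule split_exponents)
    have sub: "z \<in> Z" "w \<in> Z" "set r1 \<subseteq> Z" "set r2 \<subseteq> Z"
      using "1.prems"(1) 3 split(3) by auto
    have forms: "x ^ a * y ^ b * prod_list (v # r) \<in> forms n d"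
      if "a + b + length r = d - 1" "v \<in> Z" "set r \<subseteq> Z" for a b v r
    proof -
      have "prod_list (v # r) \<in> forms n (length (v # r))"
        by (rule forms_prod_list) (use that Z_forms in auto)
      from forms_mult[OF monomial_forms[OF refl] this, of a b] show ?thesis
        using that(1) d by simp
    qed
    have IH: "\<Lambda> (x ^ d * (x ^ a * y ^ b * prod_list (v # r))) = 0"
      "\<Lambda> (x ^ (d - 1) * y * (x ^ a * y ^ b * prod_list (v # r))) = 0"
      if "a + b + length r = d - 1" "v \<in> Z" "set r \<subseteq> Z" "length r \<le> length rest" for a b v r
    proof -
      have "\<Lambda> (x ^ (d + a) * y ^ b * prod_list (v # r)) = 0"
        "\<Lambda> (x ^ (d - 1 + a) * y ^ Suc b * prod_list (v # r)) = 0"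
        using that d 3 by (intro "1.IH"[rule_format]; auto)+
      then show "\<Lambda> (x ^ d * (x ^ a * y ^ b * prod_list (v # r))) = 0"
        "\<Lambda> (x ^ (d - 1) * y * (x ^ a * y ^ b * prod_list (v # r))) = 0"
        by (simp_all add: power_add mult_ac)
    qed
    have "\<Lambda> ((x ^ i1 * y ^ j1 * prod_list (z # r1)) * (x ^ i2 * y ^ j2 * prod_list (w # r2))) = 0"
      using sub split
      by (subst \<Lambda>_mult) (simp_all only: forms IH length_append le_add1 le_add2 mult_zero_right add_0_right)
    moreover have "(x ^ i1 * y ^ j1 * prod_list (z # r1)) * (x ^ i2 * y ^ j2 * prod_list (w # r2)) =
        x ^ i * y ^ j * prod_list zs"
      unfolding 3 split(1-3) by (simp add: power_add mult_ac)
    ultimately show ?thesis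
      by simp
  qed
qed

lemma \<Lambda>_zero:
  assumes "\<And>z. z \<in> Z \<Longrightarrow> E 0 z = 0" "\<And>z. z \<in> Z \<Longrightarrow> E 1 z = 0" "p \<in> forms n (2 * d)"
  shows "\<Lambda> p = 0"
proof (rule functional_vanishes_on_products[OF lin_\<Lambda> _ \<Lambda>_products[OF assms(1,2)] assms(3)])
  show "\<exists>s t. \<exists>z\<in>Z. a = const_poly s * x + const_poly t * y + z" if "a \<in> forms n 1" for a
    using decompose[OF that] by blast
qed

lemma F_commute: "F k z w = F k w z"
  by (simp add: F_def mult_ac)

lemma product_forms:
  assumes "z \<in> Z" "i + j = d - 1" shows "x ^ i * y ^ j * z \<in> forms n d"
  using forms_linear_mult[OF Z_forms[OF assms(1)] monomial_forms[OF assms(2)]] d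
  by (simp add: mult.commute)

lemma F_eq:
  assumes "z \<in> Z" "w \<in> Z" "i \<le> d - 1" "j \<le> d - 1"
  shows "F (i + j) z w = \<alpha>b i z * E j w + \<gamma>b i z * E (Suc j) w + \<alpha>b j w * E i z + \<gamma>b j w * E (Suc i) z"
proof -
  have e: "2 * d - 2 - (i + j) = (d - 1 - i) + (d - 1 - j)" 
    "2 * d - 1 - i = d + (d - 1 - i)" "2 * d - 1 - j = d + (d - 1 - j)"
    "2 * d - 1 - Suc i = (d - 1) + (d - 1 - i)" "2 * d - 1 - Suc j = (d - 1) + (d - 1 - j)"
    using d assms by auto
  show ?thesis
    using \<Lambda>_mult[OF product_forms[OF assms(1), of "d - 1 - i" i] product_forms[OF assms(2), of "d - 1 - j" j]]
      assms(3,4)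
    unfolding F_def E_def e \<alpha>b_def \<gamma>b_def by (simp add: power_add mult_ac)
qed

lemma b_0: "z \<in> Z \<Longrightarrow> \<alpha>b 0 z = 0" "z \<in> Z \<Longrightarrow> \<gamma>b 0 z = 0"
  by (simp_all add: \<alpha>b_def \<gamma>b_def Z_def)

lemma F_eq_0:
  assumes "z \<in> Z" "w \<in> Z" "j \<le> d - 1"
  shows "F j z w = \<alpha>b j w * E 0 z + \<gamma>b j w * E 1 z"
  using F_eq[of z w 0 j] assms b_0 by simp

text \<open>Here z and w sit in the same half. The \<alpha>-term is F 0 z w, the value at x^(d-1) z
  times x^(d-1) w, and is zero since both lie in U.\<close>

lemma F_recursion:
  assumes "z \<in> Z" "w \<in> Z" "i \<le> d"
  shows "F i z w = \<gamma>c i * F 1 z w"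
proof -
  have e: "2 * d - 2 - i = (d - i) + (d - 2)" "2 * d - 2 = d + (d - 2)" 
    "2 * d - 2 - 1 = (d - 1) + (d - 2)"
    using d assms by auto
  have "z * (w * x ^ (d - 2)) \<in> forms n (Suc (Suc (d - 2)))"
    using assms by (intro forms_linear_mult Z_forms forms_power x)
  then have forms: "x ^ (d - i) * y ^ i \<in> forms n d" "x ^ (d - 2) * z * w \<in> forms n d"
    using monomial_forms[of "d - i" i d] assms d
    by (simp_all add: mult_ac Suc_diff_Suc numeral_2_eq_2)
  have "\<Lambda> (x ^ d * (x ^ (d - i) * y ^ i)) = 0" "\<Lambda> (x ^ (d - 1) * y * (x ^ (d - i) * y ^ i)) = 0"
    using \<Lambda>_binary_mult assms by blast+
  moreover have "\<Lambda> (x ^ d * (x ^ (d - 2) * z * w)) = 0"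
    using F_eq_0[OF assms(1,2), of 0] b_0 assms e(2)
    by (simp add: F_def power_add mult_ac)
  ultimately show ?thesis
    using \<Lambda>_mult[OF forms] unfolding F_def e(1,3) \<alpha>c_def \<gamma>c_def by (simp add: power_add mult_ac)
qed

end

context pencil
begin

text \<open>The constant 4 counts the binary forms in \<open>low\<close>; T holds the additional
  test vectors.\<close>

lemma square_codim_leI:
  assumes T: "finite T" "card T \<le> t"
    and zero: "\<And>\<Lambda> z. pencil_functional n d U \<alpha> \<gamma> x y \<Lambda> \<Longrightarrow> (\<And>s. s \<in> T \<Longrightarrow> \<Lambda> s = 0) \<Longrightarrow> z \<in> Z \<Longrightarrow>
      pencil_functional.E d x y \<Lambda> 0 z = 0 \<and> pencil_functional.E d x y \<Lambda> 1 z = 0"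
  shows "square_codim_le n d U (4 + t)"
  unfolding square_codim_le_def
proof (intro exI conjI allI impI ballI)
  let ?S = "(\<lambda>k. x ^ (2 * d - k) * y ^ k) ` {..<4}"
  show "finite (?S \<union> T)"
    using T(1) by simp
  have "card ?S \<le> 4"
    using card_image_le[of "{..<4::nat}"] by simp
  then show "card (?S \<union> T) \<le> 4 + t"
    using card_Un_le[of ?S T] T(2) by linarith
  fix \<Lambda> p assume *: "square_functional U \<Lambda>" "\<forall>s\<in>?S \<union> T. \<Lambda> s = 0" "p \<in> forms n (2 * d)"
  interpret pencil_functional n d U \<alpha> \<gamma> x y \<Lambda>
    by unfold_locales (use *(1,2) in auto)
  show "\<Lambda> p = 0"
    by (rule \<Lambda>_zero) (use zero[OF pencil_functional_axioms] *(2,3) in auto)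
qed

lemma \<chi>_0: "\<chi> 0 \<beta> = 0"
  using \<alpha>_x \<gamma>_x by (simp add: \<chi>_def \<alpha>c_def \<gamma>c_def)

end

section \<open>Distinct and double characteristic roots\<close>

context pencil_functional
begin

text \<open>The coefficient of \<beta>^k when E k z is written as a combination of the geometric
  sequences \<beta>^k and \<beta>'^k.\<close>

definition geo :: "complex \<Rightarrow> complex \<Rightarrow> cpoly \<Rightarrow> complex"
  where "geo \<beta> \<beta>' z = (E 1 z - \<beta>' * E 0 z) / (\<beta> - \<beta>')"

lemma E_2: "z \<in> Z \<Longrightarrow> E 2 z = \<alpha>c 2 * E 0 z + \<gamma>c 2 * E 1 z"
  using E_recursion[of z 2 0] d by simp

context
  fixes \<beta> \<beta>' :: complex
  assumes distinct: "\<beta> \<noteq> \<beta>'" and sum_roots: "\<gamma>c 2 = \<beta> + \<beta>'" and prod_roots: "\<alpha>c 2 = - (\<beta> * \<beta>')"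
begin

lemma E_geo_0: "E 0 z = geo \<beta> \<beta>' z + geo \<beta>' \<beta> z"
  and E_geo_1: "E 1 z = \<beta> * geo \<beta> \<beta>' z + \<beta>' * geo \<beta>' \<beta> z"
proof -
  have "geo \<beta>' \<beta> z = - (E 1 z - \<beta> * E 0 z) / (\<beta> - \<beta>')"
    unfolding geo_def using distinct by (simp add: field_simps)
  then show "E 0 z = geo \<beta> \<beta>' z + geo \<beta>' \<beta> z" "E 1 z = \<beta> * geo \<beta> \<beta>' z + \<beta>' * geo \<beta>' \<beta> z"
    unfolding geo_def using distinct by (simp_all add: divide_simps) (simp_all add: algebra_simps)
qed

lemma E_geo:
  assumes "z \<in> Z" "k \<le> Suc d"
  shows "E k z = \<beta> ^ k * geo \<beta> \<beta>' z + \<beta>' ^ k * geo \<beta>' \<beta> z"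
  using assms(2)
proof (induction k rule: less_induct)
  case (less k)
  consider "k = 0" | "k = 1" | j where "k = 2 + j"
    by (metis One_nat_def add_2_eq_Suc not0_implies_Suc)
  then show ?case
  proof cases
    case 3
    then have "E k z = \<alpha>c 2 * E j z + \<gamma>c 2 * E (Suc j) z"
      using E_recursion[OF assms(1), of 2 j] less.prems d by simp
    then show ?thesis
      using less.IH[of j] less.IH[of "Suc j"] less.prems 3 sum_roots prod_roots
      by (simp add: algebra_simps)
  qed (use E_geo_0 E_geo_1 in auto)
qed

text \<open>With A and B the two geometric coefficients, \<open>E_recursion\<close> at j = 0 and j =
  1 gives A \<chi>(\<beta>) + B \<chi>(\<beta>') = 0 and \<beta> A \<chi>(\<beta>) + \<beta>' B
  \<chi>(\<beta>') = 0 for \<chi> = \<chi> i. Distinct roots separate the two terms.\<close>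

lemma geo_\<chi>:
  assumes "z \<in> Z" "i \<le> d"
  shows "geo \<beta> \<beta>' z * \<chi> i \<beta> = 0"
proof -
  have "\<beta> ^ i * geo \<beta> \<beta>' z + \<beta>' ^ i * geo \<beta>' \<beta> z = \<alpha>c i * E 0 z + \<gamma>c i * E 1 z"
    using E_recursion[OF assms, of 0] E_geo[OF assms(1), of i] assms(2) by simp
  moreover have "\<beta> ^ Suc i * geo \<beta> \<beta>' z + \<beta>' ^ Suc i * geo \<beta>' \<beta> z = \<alpha>c i * E 1 z + \<gamma>c i * E 2 z"
    using E_recursion[OF assms, of 1] E_geo[OF assms(1), of "Suc i"] assms(2) d
    by (simp add: numeral_2_eq_2)
  moreover have "E 2 z = \<beta>\<^sup>2 * geo \<beta> \<beta>' z + \<beta>'\<^sup>2 * geo \<beta>' \<beta> z"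
    using E_geo[OF assms(1), of 2] d by simp
  moreover define b b' where "b = \<beta> ^ i" and "b' = \<beta>' ^ i"
  ultimately have "(\<beta> - \<beta>') * (geo \<beta> \<beta>' z * \<chi> i \<beta>) = 0"
    unfolding E_geo_0[of z] E_geo_1[of z] \<chi>_def power_Suc b_def[symmetric] b'_def[symmetric] by algebra
  then show ?thesis
    using distinct by simp
qed

lemma F_1_geo:
  assumes "z \<in> Z" "w \<in> Z"
  shows "F 1 z w = \<eta> w \<beta> * geo \<beta> \<beta>' z + \<eta> w \<beta>' * geo \<beta>' \<beta> z"
  using F_eq_0[OF assms, of 1] d unfolding E_geo_0[of z] E_geo_1[of z] \<eta>_def by (simp add: algebra_simps)

text \<open>Two relations are combined: F 1 z w is symmetric in z and w, and F 2 z w is computed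
  once from two halves with one factor of Z each (\<open>F_eq\<close>) and once from a half
  containing both (\<open>F_recursion\<close>).\<close>

lemma geo_cross:
  assumes "z \<in> Z" "w \<in> Z"
  shows "\<eta> w \<beta> * geo \<beta> \<beta>' z = \<eta> z \<beta>' * geo \<beta>' \<beta> w"
proof -
  define p q p' q' where "p = \<eta> w \<beta> * geo \<beta> \<beta>' z" and "q = \<eta> w \<beta>' * geo \<beta>' \<beta> z"
    and "p' = \<eta> z \<beta> * geo \<beta> \<beta>' w" and "q' = \<eta> z \<beta>' * geo \<beta>' \<beta> w"
  have E2: "E 2 v = \<beta>\<^sup>2 * geo \<beta> \<beta>' v + \<beta>'\<^sup>2 * geo \<beta>' \<beta> v" if "v \<in> Z" for v
    using E_geo[OF that, of 2] d by simp
  have sym: "p + q = p' + q'"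
    using F_1_geo[OF assms] F_1_geo[OF assms(2,1)] F_commute[of 1 z w] by (simp add: p_def q_def p'_def q'_def)
  have "F 2 z w = \<beta> * (p + p') + \<beta>' * (q + q')"
    using F_eq[OF assms, of 1 1] d E2[OF assms(1)] E2[OF assms(2)]
    unfolding p_def q_def p'_def q'_def \<eta>_def
    by (simp add: numeral_2_eq_2[symmetric] E_geo_1[unfolded One_nat_def] algebra_simps power2_eq_square)
  moreover have "F 2 z w = (\<beta> + \<beta>') * (p + q)"
    using F_recursion[OF assms d] F_1_geo[OF assms] sum_roots by (simp add: p_def q_def)
  ultimately have "(\<beta> - \<beta>') * (p - q') = 0"
    using sym by algebra
  then show ?thesis
    using distinct by (simp add: p_def q'_def)
qed

text \<open>The component at \<beta> dies by \<open>geo_\<chi>\<close>; the one at \<beta>' dies for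
  the same reason or by \<open>geo_cross\<close>. The hypothesis \<open>geo_\<chi>'\<close> is
  \<open>geo_\<chi>\<close> with the roots exchanged.\<close>

lemma E_zero_of_not_common:
  assumes "i \<le> d" "\<chi> i \<beta> \<noteq> 0"
    and "(\<exists>j\<le>d. \<chi> j \<beta>' \<noteq> 0) \<or> (\<exists>v\<in>Z. \<eta> v \<beta>' \<noteq> 0)" 
    and geo_\<chi>': "\<And>w j. w \<in> Z \<Longrightarrow> j \<le> d \<Longrightarrow> geo \<beta>' \<beta> w * \<chi> j \<beta>' = 0"
    and "z \<in> Z"
  shows "E 0 z = 0 \<and> E 1 z = 0"
proof -
  have P: "geo \<beta> \<beta>' w = 0" if "w \<in> Z" for w
    using geo_\<chi>[OF that assms(1)] assms(2) by simp
  have "geo \<beta>' \<beta> z = 0"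
    using assms(3)
  proof
    assume "\<exists>v\<in>Z. \<eta> v \<beta>' \<noteq> 0"
    then obtain v where "v \<in> Z" "\<eta> v \<beta>' \<noteq> 0"
      by blast
    then show ?thesis
      using geo_cross[of v z] P assms(5) by simp
  qed (use geo_\<chi>' assms(5) in auto)
  then show ?thesis
    using P[OF assms(5)] by (simp only: E_geo_0[of z] E_geo_1[of z]) simp
qed

text \<open>A single linear condition kills the \<beta>-component at w. By \<open>geo_cross\<close>
  this kills the \<beta>'-component everywhere, and then, through v, the \<beta>-component
  everywhere.\<close>

lemma E_zero_of_generic:
  assumes "v \<in> Z" "\<eta> v \<beta> \<noteq> 0" "w \<in> Z" "\<eta> w \<beta>' \<noteq> 0" "E 1 w = \<beta>' * E 0 w" "z \<in> Z"
  shows "E 0 z = 0 \<and> E 1 z = 0"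
proof -
  have "geo \<beta> \<beta>' w = 0"
    using assms(5) by (simp add: geo_def)
  then have Q: "geo \<beta>' \<beta> u = 0" if "u \<in> Z" for u
    using geo_cross[OF assms(3) that] assms(4) by simp
  then have "geo \<beta> \<beta>' z = 0"
    using geo_cross[OF assms(6,1)] assms(1,2) by simp
  then show ?thesis
    using Q[OF assms(6)] by (simp only: E_geo_0[of z] E_geo_1[of z]) simp
qed

text \<open>
  The hypotheses \<open>deriv\<close> are the derivatives in direction \<open>z\<close> of \<open>\<gamma>c 3 = (\<gamma>c 2)\<^sup>2 + \<alpha>c 2\<close> and
  \<open>\<alpha>c 3 = \<gamma>c 2 * \<alpha>c 2\<close>, the identities which say that \<open>\<chi> 2\<close> divides \<open>\<chi> 3\<close>.
\<close>

lemma geo_zero_of_common: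
  assumes "3 \<le> d" "\<chi> 3 \<beta> = 0" "\<chi> 3 \<beta>' = 0" "z \<in> Z" "w \<in> Z"
    and deriv: "3 * \<gamma>b 2 z = 4 * \<gamma>c 2 * \<gamma>b 1 z + 2 * \<alpha>b 1 z"
      "3 * \<alpha>b 2 z = 2 * \<gamma>b 1 z * \<alpha>c 2 + 2 * \<gamma>c 2 * \<alpha>b 1 z"
    and cross': "\<eta> w \<beta>' * geo \<beta>' \<beta> z = \<eta> z \<beta> * geo \<beta> \<beta>' w"
  shows "\<eta> z \<beta> * geo \<beta> \<beta>' w = 0"
proof -
  define p q where "p = \<eta> w \<beta> * geo \<beta> \<beta>' z" and "q = \<eta> w \<beta>' * geo \<beta>' \<beta> z"
  define \<theta> \<theta>' where "\<theta> = \<alpha>b 2 z + \<gamma>b 2 z * \<beta>" and "\<theta>' = \<alpha>b 2 z + \<gamma>b 2 z * \<beta>'"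
  define t t' where "t = \<theta> * geo \<beta> \<beta>' w" and "t' = \<theta>' * geo \<beta>' \<beta> w"
  have E2: "E 2 v = \<beta>\<^sup>2 * geo \<beta> \<beta>' v + \<beta>'\<^sup>2 * geo \<beta>' \<beta> v"
    and E3: "E 3 v = \<beta> ^ 3 * geo \<beta> \<beta>' v + \<beta>' ^ 3 * geo \<beta>' \<beta> v" if "v \<in> Z" for v
    using E_geo[OF that, of 2] E_geo[OF that, of 3] d by simp_all
  have F1: "F 1 z w = p + q"
    using F_1_geo[OF assms(4,5)] by (simp add: p_def q_def)
  have "F 2 w z = t + t'"
    using F_eq_0[OF assms(5,4), of 2] assms(1)
    unfolding E_geo_0[of w] E_geo_1[of w] t_def t'_def \<theta>_def \<theta>'_def by (simp add: algebra_simps)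
  then have F2: "t + t' = (\<beta> + \<beta>') * (p + q)"
    using F_recursion[OF assms(4,5) d] F1 sum_roots F_commute[of 2 z w] by simp
  \<comment> \<open>Both roots of \<chi> 2 are roots of \<chi> 3; subtracting the two equations
    determines \<open>\<gamma>c 3\<close>.\<close>
  have "(\<beta> - \<beta>') * (\<gamma>c 3 - (\<beta>\<^sup>2 + \<beta> * \<beta>' + \<beta>'\<^sup>2)) = 0"
    using assms(2,3) unfolding \<chi>_def by algebra
  then have c3: "\<gamma>c 3 = \<beta>\<^sup>2 + \<beta> * \<beta>' + \<beta>'\<^sup>2"
    using distinct by simp
  have "F 3 z w = \<alpha>b 2 z * E 1 w + \<gamma>b 2 z * E 2 w + \<alpha>b 1 w * E 2 z + \<gamma>b 1 w * E 3 z"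
    using F_eq[OF assms(4,5), of 2 1] assms(1) by (simp add: numeral_3_eq_3 numeral_2_eq_2)
  also have "\<dots> = \<beta>\<^sup>2 * p + \<beta>'\<^sup>2 * q + \<beta> * t + \<beta>' * t'"
    unfolding E2[OF assms(4)] E2[OF assms(5)] E3[OF assms(4)] E_geo_1[of w]
      p_def q_def t_def t'_def \<theta>_def \<theta>'_def \<eta>_def by algebra
  finally have F3: "\<beta>\<^sup>2 * p + \<beta>'\<^sup>2 * q + \<beta> * t + \<beta>' * t' = (\<beta>\<^sup>2 + \<beta> * \<beta>' + \<beta>'\<^sup>2) * (p + q)"
    using F_recursion[OF assms(4,5,1)] F1 c3 by simp
  \<comment> \<open>\<open>F3\<close> minus \<beta>' times \<open>F2\<close> eliminates
    \<open>t'\<close>.\<close>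
  have "(\<beta> - \<beta>') * (t - (\<beta> + \<beta>') * q) = 0"
    using F2 F3 by algebra
  then have t: "t = (\<beta> + \<beta>') * q"
    using distinct by simp
  have "3 * \<theta> = 2 * (2 * \<beta> + \<beta>') * \<eta> z \<beta>"
    using deriv unfolding \<theta>_def \<eta>_def sum_roots prod_roots by algebra
  \<comment> \<open>This second expression for \<open>t\<close> is compatible with the first only if
    (\<beta> - \<beta>') q = 0.\<close>
  then have "3 * t = 2 * (2 * \<beta> + \<beta>') * q"
    using cross' unfolding t_def q_def by algebra
  then have "(\<beta> - \<beta>') * q = 0"
    using t by algebra
  then show ?thesis
    using distinct cross' by (simp add: q_def)
qed

end

context
  fixes \<beta> :: complex
  assumes double_root: "\<gamma>c 2 = 2 * \<beta>" "\<alpha>c 2 = - \<beta>\<^sup>2"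
begin

text \<open>The solution of a recursion with double root \<beta> is A \<beta>^k + B k \<beta>^(k-1),
  stated for \<open>Suc k\<close> to avoid the exponent k - 1.\<close>

lemma E_double:
  assumes "z \<in> Z" "k \<le> d"
  shows "E (Suc k) z = \<beta> ^ Suc k * E 0 z + of_nat (Suc k) * \<beta> ^ k * (E 1 z - \<beta> * E 0 z)"
  using assms(2)
proof (induction k rule: less_induct)
  case (less k)
  consider "k = 0" | "k = 1" | j where "k = Suc (Suc j)"
    by (metis One_nat_def not0_implies_Suc)
  then show ?case
  proof cases
    case 2
    then show ?thesis
      using E_2[OF assms(1)] double_root by (simp add: numeral_2_eq_2[symmetric] algebra_simps power2_eq_square)
  next
    case 3
    then have "E (Suc k) z = \<alpha>c 2 * E (Suc j) z + \<gamma>c 2 * E (Suc (Suc j)) z"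
      using E_recursion[OF assms(1), of 2 "Suc j"] less.prems d by simp
    then show ?thesis
      using less.IH[of j] less.IH[of "Suc j"] less.prems 3 double_root
      by (simp add: algebra_simps power2_eq_square)
  qed simp
qed

text \<open>The same two instances of the recursion as in \<open>geo_\<chi>\<close>; the factor next
  to \<chi> in the second relation is the derivative of \<chi> (i+1) at \<beta>.\<close>

lemma double_relations:
  assumes "z \<in> Z" "Suc i \<le> d"
  shows "(E 1 z - \<beta> * E 0 z) * \<chi> (Suc i) \<beta> = 0"
    and "E 0 z * \<chi> (Suc i) \<beta> + (E 1 z - \<beta> * E 0 z) * (of_nat (Suc i) * \<beta> ^ i - \<gamma>c (Suc i)) = 0"
proof -
  define Q where "Q = E 1 z - \<beta> * E 0 z"
  have 1: "\<beta> ^ Suc i * E 0 z + of_nat (Suc i) * \<beta> ^ i * Q =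
      \<alpha>c (Suc i) * E 0 z + \<gamma>c (Suc i) * E 1 z"
    using E_recursion[OF assms(1,2), of 0] E_double[OF assms(1), of i] assms(2) by (simp add: Q_def)
  have 2: "\<beta> ^ Suc (Suc i) * E 0 z + (of_nat (Suc i) + 1) * \<beta> ^ Suc i * Q =
      \<alpha>c (Suc i) * E 1 z + \<gamma>c (Suc i) * E 2 z"
    using E_recursion[OF assms(1,2), of 1] E_double[OF assms(1), of "Suc i"] assms(2) d
    by (simp add: Q_def numeral_2_eq_2 algebra_simps)
  have 3: "E 2 z = 2 * \<beta> * E 1 z - \<beta>\<^sup>2 * E 0 z"
    using E_2[OF assms(1)] double_root by simp
  have E1: "E 1 z = Q + \<beta> * E 0 z"
    by (simp add: Q_def)
  define b N :: complex where "b = \<beta> ^ i" and "N = of_nat (Suc i)"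
  note fold = power_Suc b_def[symmetric] N_def[symmetric]
  show "Q * \<chi> (Suc i) \<beta> = 0"
    using 1 2 3 unfolding E1 \<chi>_def fold by algebra
  show "E 0 z * \<chi> (Suc i) \<beta> + Q * (of_nat (Suc i) * \<beta> ^ i - \<gamma>c (Suc i)) = 0"
    using 1 unfolding E1 \<chi>_def fold by algebra
qed

lemma E_zero_double:
  assumes "i \<le> d" "\<chi> i \<beta> \<noteq> 0" "z \<in> Z"
  shows "E 0 z = 0 \<and> E 1 z = 0"
proof -
  obtain j where j: "i = Suc j"
    using assms(2) \<chi>_0 by (cases i) auto
  have "E 1 z = \<beta> * E 0 z"
    using double_relations(1)[of z j] assms j by simp
  then show ?thesis
    using double_relations(2)[of z j] assms j by simp
qed

text \<open>A simple root of \<chi> (i+1) forces E 1 = \<beta> E 0. Then F 1 z v is a multiple of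
  \<eta> v \<beta> = 0, so F i z v = 0 as well, and this is a multiple of E 0 z. The hypothesis
  \<open>deriv\<close>, the derivative of \<chi> (i+1) = 0 along the moving double root, makes the
  multiple nonzero.\<close>

lemma E_zero_double':
  assumes i: "Suc i \<le> d" "of_nat (Suc i) * \<beta> ^ i \<noteq> \<gamma>c (Suc i)" "\<chi> (Suc i) \<beta> = 0"
    and v: "v \<in> Z" "\<gamma>b 1 v \<noteq> 0" "\<alpha>b 1 v = - \<beta> * \<gamma>b 1 v"
    and deriv: "of_nat (Suc i) * (\<alpha>b i v + \<gamma>b i v * \<beta>) =
      (of_nat (Suc i) * \<beta> ^ i - \<gamma>c (Suc i)) * \<gamma>b 1 v"
    and "z \<in> Z"
  shows "E 0 z = 0 \<and> E 1 z = 0"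
proof -
  have E1: "E 1 z = \<beta> * E 0 z"
    using double_relations(2)[OF assms(8) i(1)] i(2,3) by simp
  have "F 1 z v = 0"
    using F_eq_0[OF assms(8) v(1), of 1] d v(3) E1 by simp
  then have "F i z v = 0"
    using F_recursion[OF assms(8) v(1), of i] i(1) by simp
  then have "(\<alpha>b i v + \<gamma>b i v * \<beta>) * E 0 z = 0"
    using F_eq_0[OF assms(8) v(1), of i] i(1) d E1 by (simp add: algebra_simps)
  then have "of_nat (Suc i) * (\<alpha>b i v + \<gamma>b i v * \<beta>) * E 0 z = 0"
    by (simp only: mult.assoc mult_zero_right)
  then have "E 0 z = 0"
    unfolding deriv using i(2) v(2) by (simp del: of_nat_Suc)
  then show ?thesis
    using E1 by simp
qed

end

end

subsection \<open>The exceptional pencil\<close>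

text \<open>Since m b = 0, the value of \<phi> at (a + r b)^d is m(a)^(d-1) (g a + r g b); the
  claims compare coefficients of r and r^2.\<close>

lemma polarize_power_form:
  assumes \<phi>: "lin_functional \<phi>" and m: "lin_functional m" and g: "lin_functional g" and d: "2 \<le> d"
    and power: "\<And>a. a \<in> forms n 1 \<Longrightarrow> \<phi> (a ^ d) = m a ^ (d - 1) * g a"
    and a: "a \<in> forms n 1" and b: "b \<in> forms n 1" "m b = 0"
  shows "of_nat d * \<phi> (a ^ (d - 1) * b) = m a ^ (d - 1) * g b"
    and "\<phi> (a ^ (d - 2) * b\<^sup>2) = 0"
proof -
  define c where "c = (\<lambda>i::nat. if i = 0 then m a ^ (d - 1) * g a
    else if i = 1 then m a ^ (d - 1) * g b else 0)"
  have "(\<Sum>i\<le>d. (of_nat (d choose i) * \<phi> (1 * a ^ (d - i) * b ^ i)) * r ^ i) = (\<Sum>i\<le>d. c i * r ^ i)" for r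
  proof -
    have "(\<Sum>i\<le>d. (of_nat (d choose i) * \<phi> (1 * a ^ (d - i) * b ^ i)) * r ^ i) =
        \<phi> ((a + const_poly r * b) ^ d)"
      using lin_functional_binomial[OF \<phi>, of 1 a r b d] by simp
    also have "\<dots> = m a ^ (d - 1) * (g a + r * g b)"
      using power[OF forms_add[OF a forms_scale[OF b(1), of r]]] b(2)
      by (simp add: lin_functional_add[OF m] lin_functional_add[OF g]
          lin_functional_scale[OF m] lin_functional_scale[OF g])
    also have "\<dots> = (\<Sum>i\<in>{0, 1}. c i * r ^ i)"
      by (simp add: c_def algebra_simps)
    also have "\<dots> = (\<Sum>i\<le>d. c i * r ^ i)"
      using d by (intro sum.mono_neutral_left) (auto simp: c_def)
    finally show ?thesis .
  qed
  then have "\<forall>i\<le>d. of_nat (d choose i) * \<phi> (1 * a ^ (d - i) * b ^ i) = c i"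
    unfolding polyfun_eq_coeffs[symmetric] by blast
  then have coeff: "of_nat (d choose i) * \<phi> (a ^ (d - i) * b ^ i) = c i" if "i \<le> d" for i
    using that by simp
  show "of_nat d * \<phi> (a ^ (d - 1) * b) = m a ^ (d - 1) * g b"
    using coeff[of 1] d by (simp add: c_def)
  show "\<phi> (a ^ (d - 2) * b\<^sup>2) = 0"
    using coeff[of 2] d by (simp add: c_def binomial_eq_0_iff)
qed

text \<open>The r^2 coefficient in \<open>polarize_power_form\<close> is polarised in b, and powers
  a^(d-2) span the forms of degree d - 2.\<close>

lemma vanish_on_double_kernel:
  assumes \<phi>: "lin_functional \<phi>" and m: "lin_functional m" and g: "lin_functional g" and d: "2 \<le> d"
    and power: "\<And>a. a \<in> forms n 1 \<Longrightarrow> \<phi> (a ^ d) = m a ^ (d - 1) * g a"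
    and b: "b \<in> forms n 1" "m b = 0" and c: "c \<in> forms n 1" "m c = 0"
    and q: "q \<in> forms n (d - 2)"
  shows "\<phi> (b * c * q) = 0"
proof (rule functional_vanishes_on_forms[OF lin_functional_mult[OF \<phi>] _ q])
  fix a assume a: "a \<in> forms n 1"
  have square: "\<phi> (a ^ (d - 2) * b\<^sup>2) = 0" if "b \<in> forms n 1" "m b = 0" for b
    by (rule polarize_power_form(2)[OF \<phi> m g d power a that])
  have "\<phi> (a ^ (d - 2) * (b + c)\<^sup>2) = 0"
    using b c by (intro square forms_add; simp add: lin_functional_add[OF m])
  also have "a ^ (d - 2) * (b + c)\<^sup>2 = a ^ (d - 2) * b\<^sup>2 + a ^ (d - 2) * c\<^sup>2 + 2 * (b * c * a ^ (d - 2))"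
    by (simp add: power2_eq_square algebra_simps)
  finally show "\<phi> (b * c * a ^ (d - 2)) = 0"
    using square[OF b] square[OF c]
    by (simp add: lin_functional_add[OF \<phi>] lin_functional_numeral[OF \<phi>])
qed

text \<open>X is transverse to the kernel of m and killed by g and h, while Y and V span that kernel
  modulo the common zeros of g and h. Modulo U every form of degree d then reduces to X^(d-1) Y and
  X^(d-1) V.\<close>

locale exceptional_pencil =
  fixes n d :: nat and U :: "cpoly set" and \<phi> \<psi> m g h :: "cpoly \<Rightarrow> complex" and X Y V :: cpoly
  assumes d: "2 \<le> d"
    and lin: "lin_functional \<phi>" "lin_functional \<psi>" "lin_functional m" "lin_functional g" "lin_functional h"
    and U_eq: "U = {p \<in> forms n d. \<phi> p = 0 \<and> \<psi> p = 0}"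
    and \<phi>_power: "\<And>a. a \<in> forms n 1 \<Longrightarrow> \<phi> (a ^ d) = m a ^ (d - 1) * g a"
    and \<psi>_power: "\<And>a. a \<in> forms n 1 \<Longrightarrow> \<psi> (a ^ d) = m a ^ (d - 1) * h a"
    and X: "X \<in> forms n 1" "m X \<noteq> 0" "g X = 0" "h X = 0"
    and Y: "Y \<in> forms n 1" "m Y = 0" and V: "V \<in> forms n 1" "m V = 0"
    and span: "\<And>b. b \<in> forms n 1 \<Longrightarrow> m b = 0 \<Longrightarrow>
      \<exists>s t. g (b - const_poly s * Y - const_poly t * V) = 0 \<and> h (b - const_poly s * Y - const_poly t * V) = 0"
begin

definition K :: "cpoly set"
  where "K = {b \<in> forms n 1. m b = 0}"

lemma Y_K: "Y \<in> K" and V_K: "V \<in> K"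
  using Y V by (simp_all add: K_def)

lemma K_forms: "b \<in> K \<Longrightarrow> b \<in> forms n 1"
  by (simp add: K_def)

lemma product_U:
  assumes "b \<in> K" "c \<in> K" "q \<in> forms n (d - 2)"
  shows "b * c * q \<in> U"
proof -
  have "c * q \<in> forms n (Suc (d - 2))"
    using assms by (intro forms_linear_mult K_forms)
  then have "b * (c * q) \<in> forms n (Suc (Suc (d - 2)))"
    using assms by (intro forms_linear_mult K_forms)
  then have "b * c * q \<in> forms n d"
    using d by (simp add: mult.assoc Suc_diff_Suc numeral_2_eq_2)
  moreover have "\<phi> (b * c * q) = 0" "\<psi> (b * c * q) = 0"
    using assms unfolding K_def
    by (auto intro: vanish_on_double_kernel[OF lin(1,3,4) d \<phi>_power] vanish_on_double_kernel[OF lin(2,3,5) d \<psi>_power])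
  ultimately show ?thesis
    by (simp add: U_eq)
qed

lemma power_U: "X ^ d \<in> U"
  using X forms_power[OF X(1), of d] by (simp add: U_eq \<phi>_power \<psi>_power)

lemma tangent_U:
  assumes "b \<in> K" "g b = 0" "h b = 0"
  shows "X ^ (d - 1) * b \<in> U"
proof -
  have b: "b \<in> forms n 1" "m b = 0"
    using assms(1) by (simp_all add: K_def)
  have "X ^ (d - 1) * b \<in> forms n d"
    using forms_linear_mult[OF b(1) forms_power[OF X(1), of "d - 1"]] d by (simp add: mult.commute)
  then show ?thesis
    using polarize_power_form(1)[OF lin(1,3,4) d \<phi>_power X(1) b] 
      polarize_power_form(1)[OF lin(2,3,5) d \<psi>_power X(1) b] assms d
    by (simp add: U_eq)
qed

lemma functional_vanishes_on_K:
  assumes "lin_functional \<omega>" "\<omega> Y = 0" "\<omega> V = 0"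
    "\<And>z. z \<in> K \<Longrightarrow> g z = 0 \<Longrightarrow> h z = 0 \<Longrightarrow> \<omega> z = 0" "b \<in> K"
  shows "\<omega> b = 0"
proof -
  have b: "b \<in> forms n 1" "m b = 0"
    using assms(5) by (simp_all add: K_def)
  obtain s t where st: "g (b - const_poly s * Y - const_poly t * V) = 0"
      "h (b - const_poly s * Y - const_poly t * V) = 0"
    using span[OF b] by blast
  have "b - const_poly s * Y - const_poly t * V \<in> forms n 1"
    by (intro forms_diff forms_scale b Y V)
  then have "b - const_poly s * Y - const_poly t * V \<in> K"
    using b Y V by (simp add: K_def lin_functional_diff[OF lin(3)] lin_functional_scale[OF lin(3)])
  then have "\<omega> (b - const_poly s * Y - const_poly t * V) = 0"
    using st by (rule assms(4))
  then show ?thesis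
    using assms(2,3) by (simp add: lin_functional_diff[OF assms(1)] lin_functional_scale[OF assms(1)])
qed

text \<open>Monomials that the square of U may miss. For d at least 3, three factors from K fit into
  one element of U with partner X^d; for d = 2 they do not, which adds the four cubics in Y, V times
  X.\<close>

definition missing :: "cpoly set"
  where "missing = {X ^ (2 * d - 1) * Y, X ^ (2 * d - 1) * V} \<union>
    (if d = 2 then {X * Y * Y * Y, X * Y * Y * V, X * Y * V * V, X * V * V * V} else {})"

context
  fixes \<Lambda> :: "cpoly \<Rightarrow> complex"
  assumes square: "square_functional U \<Lambda>" and missing: "\<And>s. s \<in> missing \<Longrightarrow> \<Lambda> s = 0"
begin

lemma lin_\<Lambda>: "lin_functional \<Lambda>" and \<Lambda>_square: "p \<in> U \<Longrightarrow> q \<in> U \<Longrightarrow> \<Lambda> (p * q) = 0"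
  using square by (simp_all add: square_functional_def)

text \<open>If z in K is killed by g and h, then X z and a b lie in U. So each of the three factors
  from K may be replaced in turn by Y or V.\<close>

lemma \<Lambda>_cubic:
  assumes "d = 2" "a \<in> K" "b \<in> K" "c \<in> K"
  shows "\<Lambda> (X * a * b * c) = 0"
proof -
  have tangent: "\<Lambda> (X * a * b * z) = 0" if "a \<in> K" "b \<in> K" "z \<in> K" "g z = 0" "h z = 0" for a b z
    using \<Lambda>_square[OF tangent_U[OF that(3-5)] product_U[OF that(1,2), of 1]] assms(1)
    by (simp add: mult_ac)
  note reduce = functional_vanishes_on_K[OF lin_functional_mult[OF lin_\<Lambda>]]
  have miss: "\<Lambda> (X * Y * Y * Y) = 0" "\<Lambda> (X * Y * Y * V) = 0" "\<Lambda> (X * Y * V * V) = 0"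
    "\<Lambda> (X * V * V * V) = 0"
    by (rule missing, unfold missing_def, use assms(1) in simp)+
  then have miss': "\<Lambda> (X * Y * V * Y) = 0" "\<Lambda> (X * V * V * Y) = 0"
    by (simp_all add: mult_ac)
  have 1: "\<Lambda> (X * Y * Y * u) = 0" "\<Lambda> (X * Y * V * u) = 0" "\<Lambda> (X * V * V * u) = 0" if u: "u \<in> K" for u
    by (intro reduce[OF _ _ tangent u] miss miss' Y_K V_K; assumption)+
  have 2: "\<Lambda> (X * Y * u * v) = 0" "\<Lambda> (X * V * u * v) = 0" if u: "u \<in> K" "v \<in> K" for u v
  proof -
    have zero: "\<Lambda> (X * Y * u * Y) = 0" "\<Lambda> (X * Y * u * V) = 0" "\<Lambda> (X * V * u * Y) = 0"
      "\<Lambda> (X * V * u * V) = 0"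
      using 1[OF u(1)] by (simp_all add: mult_ac)
    show "\<Lambda> (X * Y * u * v) = 0" "\<Lambda> (X * V * u * v) = 0"
      by (intro reduce[OF _ _ tangent u(2)] zero Y_K V_K u(1); assumption)+
  qed
  have zero: "\<Lambda> (X * a * b * Y) = 0" "\<Lambda> (X * a * b * V) = 0"
    using 2[OF assms(2,3)] by (simp_all add: mult_ac)
  show ?thesis
    by (intro reduce[OF _ _ tangent assms(4)] zero assms(2,3))
qed

lemma \<Lambda>_many:
  assumes "set bs \<subseteq> K" "i + length bs = 2 * d" "4 \<le> length bs"
  shows "\<Lambda> (X ^ i * prod_list bs) = 0"
proof -
  obtain a b c e rest where bs: "bs = a # b # c # e # rest"
    using assms(3) by (auto simp: numeral_eq_Suc Suc_le_length_iff)
  have "i + 0 + length rest = 2 * (d - 2)"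
    using assms(2) bs by auto
  then obtain i1 i2 j1 j2 r1 r2 where split: "i = i1 + i2" "0 = j1 + j2" "rest = r1 @ r2"
    "i1 + j1 + length r1 = d - 2" "i2 + j2 + length r2 = d - 2"
    by (rule split_exponents)
  have forms: "X ^ i * prod_list r \<in> forms n (d - 2)" if "set r \<subseteq> K" "i + length r = d - 2" for i r
  proof -
    have "prod_list r \<in> forms n (length r)"
      by (rule forms_prod_list) (use that(1) K_forms in auto)
    from forms_mult[OF forms_power[OF X(1), of i] this] show ?thesis
      using that(2) by simp
  qed
  have "a * b * (X ^ i1 * prod_list r1) \<in> U" "c * e * (X ^ i2 * prod_list r2) \<in> U"
    using assms(1) split bs by (auto intro!: product_U forms)
  from \<Lambda>_square[OF this] show ?thesis
    using split(1) by (simp add: bs split(3) power_add mult_ac)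
qed

lemma \<Lambda>_zero:
  assumes "p \<in> forms n (2 * d)"
  shows "\<Lambda> p = 0"
\<comment> \<open>Linear forms are sums of multiples of X and elements of K, so the second generator
  is taken to be 0; its only nonzero power is 0^0 = 1.\<close>
proof (rule functional_vanishes_on_products[OF lin_\<Lambda> _ _ assms, of K X 0])
  fix a assume a: "a \<in> forms n 1"
  define s where "s = m a / m X"
  have "a - const_poly s * X \<in> forms n 1"
    by (intro forms_diff forms_scale a X)
  then have "a - const_poly s * X \<in> K"
    using X(2) by (simp add: K_def s_def lin_functional_diff[OF lin(3)] lin_functional_scale[OF lin(3)])
  moreover have "a = const_poly s * X + const_poly 0 * 0 + (a - const_poly s * X)"
    by simp
  ultimately show "\<exists>s t. \<exists>z\<in>K. a = const_poly s * X + const_poly t * 0 + z"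
    by blast
next
  fix i j bs assume bs: "set bs \<subseteq> K" "i + j + length bs = 2 * d"
  have "\<Lambda> (X ^ i * prod_list bs) = 0" if j: "j = 0"
  proof -
    \<comment> \<open>By the number of factors from K: none is X^d times X^d; one is X^d times a
      tangent element, modulo Y and V; from 2 to d fit into a single element of U beside X^d; four
      or more are shared with at least two on each side. Only three with d = 2 remain.\<close>
    consider "4 \<le> length bs" | "length bs = 0" | "length bs = 1" | "2 \<le> length bs" "length bs \<le> d"
      | "length bs = 3" "d = 2"
      using d by linarith
    then show ?thesis
    proof cases
      case 1
      then show ?thesis
        using \<Lambda>_many bs j by simp
    next
      case 2
      then show ?thesis
        using \<Lambda>_square[OF power_U power_U] bs j by (simp add: mult_2 power_add)
    next
      case 3
      then obtain b where b: "bs = [b]"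
        by (auto simp: length_Suc_conv)
      have i: "i = 2 * d - 1"
        using bs(2) b j by simp
      have "\<Lambda> (X ^ (2 * d - 1) * b) = 0"
      proof (rule functional_vanishes_on_K[OF lin_functional_mult[OF lin_\<Lambda>]])
        fix z assume z: "z \<in> K" "g z = 0" "h z = 0"
        have "2 * d - 1 = d + (d - 1)"
          using d by simp
        then show "\<Lambda> (X ^ (2 * d - 1) * z) = 0"
          using \<Lambda>_square[OF power_U tangent_U[OF z]] by (simp only: power_add mult.assoc)
      qed (use missing bs b in \<open>auto simp: missing_def\<close>)
      then show ?thesis
        using b i by simp
    next
      case 4
      then obtain a b rest where abr: "bs = a # b # rest"
        by (auto simp: numeral_eq_Suc Suc_le_length_iff)
      have "prod_list rest \<in> forms n (length rest)"
        by (rule forms_prod_list) (use bs(1) abr K_forms in auto)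
      from forms_mult[OF forms_power[OF X(1), of "d - length bs"] this]
      have "X ^ (d - length bs) * prod_list rest \<in> forms n (d - 2)"
        using 4 abr by simp
      then have "a * b * (X ^ (d - length bs) * prod_list rest) \<in> U"
        using bs(1) abr by (intro product_U) auto
      moreover have "i = d + (d - length bs)"
        using bs(2) 4 j by simp
      ultimately show ?thesis
        using \<Lambda>_square[OF power_U, of "a * b * (X ^ (d - length bs) * prod_list rest)"] abr
        by (simp only: power_add prod_list.Cons mult_ac)
    next
      case 5
      then obtain a b c where "bs = [a, b, c]"
        by (auto simp: numeral_eq_Suc length_Suc_conv)
      then show ?thesis
        using \<Lambda>_cubic[of a b c] bs 5 j by (simp add: mult_ac)
    qed
  qed
  then show "\<Lambda> (X ^ i * 0 ^ j * prod_list bs) = 0"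
    by (cases j) (simp_all add: lin_functional_zero[OF lin_\<Lambda>])
qed

end

lemma square_codim_le: "square_codim_le n d U (if d = 2 then 6 else 4)"
proof -
  have "card missing \<le> (if d = 2 then 6 else 4)"
  proof -
    have "card {X ^ (2 * d - 1) * Y, X ^ (2 * d - 1) * V} \<le> 2"
      by (simp add: card_insert_if)
    moreover have "card {X * Y * Y * Y, X * Y * Y * V, X * Y * V * V, X * V * V * V} \<le> 4"
      by (simp add: card_insert_if)
    moreover have "card missing \<le> card {X ^ (2 * d - 1) * Y, X ^ (2 * d - 1) * V} +
        card (if d = 2 then {X * Y * Y * Y, X * Y * Y * V, X * Y * V * V, X * V * V * V} else {})"
      unfolding missing_def by (rule card_Un_le)
    ultimately show ?thesis
      by (auto split: if_splits)
  qed
  moreover have "finite missing"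
    by (simp add: missing_def)
  ultimately show ?thesis
    unfolding square_codim_le_def using \<Lambda>_zero by blast
qed

end

section \<open>Codimension bounds for a fixed second variable\<close>

context pencil
begin

lemma codim_not_common:
  assumes "\<beta> \<noteq> \<beta>'" "\<gamma>c 2 = \<beta> + \<beta>'" "\<alpha>c 2 = - (\<beta> * \<beta>')" "i \<le> d" "\<chi> i \<beta> \<noteq> 0"
    and "(\<exists>j\<le>d. \<chi> j \<beta>' \<noteq> 0) \<or> (\<exists>v\<in>Z. \<eta> v \<beta>' \<noteq> 0)"
  shows "square_codim_le n d U 4"
proof -
  have "square_codim_le n d U (4 + 0)"
  proof (rule square_codim_leI[of "{}"])
    fix \<Lambda> z assume "pencil_functional n d U \<alpha> \<gamma> x y \<Lambda>" and z: "z \<in> Z"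
    then interpret pencil_functional n d U \<alpha> \<gamma> x y \<Lambda>
      by simp
    show "E 0 z = 0 \<and> E 1 z = 0"
    proof (rule E_zero_of_not_common[OF assms _ z])
      show "geo \<beta>' \<beta> w * \<chi> j \<beta>' = 0" if "w \<in> Z" "j \<le> d" for w j
        using geo_\<chi>[of \<beta>' \<beta>, OF _ _ _ that] assms(1-3) by (simp add: add.commute mult.commute)
    qed
  qed auto
  then show ?thesis
    by simp
qed

lemma codim_generic:
  assumes "\<beta> \<noteq> \<beta>'" "\<gamma>c 2 = \<beta> + \<beta>'" "\<alpha>c 2 = - (\<beta> * \<beta>')"
    and "v \<in> Z" "\<eta> v \<beta> \<noteq> 0" "w \<in> Z" "\<eta> w \<beta>' \<noteq> 0"
  shows "square_codim_le n d U 5"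
proof -
  \<comment> \<open>The fifth test vector, with value E 1 w - \<beta>' E 0 w; the exponents match
    \<open>E_def\<close> literally.\<close>
  let ?t = "x ^ (2 * d - 1 - 1) * y ^ 1 * w - const_poly \<beta>' * (x ^ (2 * d - 1 - 0) * y ^ 0 * w)"
  have "square_codim_le n d U (4 + 1)"
  proof (rule square_codim_leI[of "{?t}"])
    fix \<Lambda> z assume "pencil_functional n d U \<alpha> \<gamma> x y \<Lambda>" and z: "z \<in> Z"
      and t: "\<And>s. s \<in> {?t} \<Longrightarrow> \<Lambda> s = 0"
    then interpret pencil_functional n d U \<alpha> \<gamma> x y \<Lambda>
      by simp
    have "\<Lambda> ?t = 0"
      using t by blast
    then have "E 1 w = \<beta>' * E 0 w"
      unfolding E_def lin_functional_diff[OF lin_\<Lambda>] lin_functional_scale[OF lin_\<Lambda>] by simp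
    then show "E 0 z = 0 \<and> E 1 z = 0"
      by (rule E_zero_of_generic[OF assms _ z])
  qed auto
  then show ?thesis
    by simp
qed

lemma codim_common:
  assumes roots: "\<beta> \<noteq> \<beta>'" "\<gamma>c 2 = \<beta> + \<beta>'" "\<alpha>c 2 = - (\<beta> * \<beta>')"
    and "3 \<le> d" "\<chi> 3 \<beta> = 0" "\<chi> 3 \<beta>' = 0"
    and deriv: "\<And>z. z \<in> Z \<Longrightarrow> 3 * \<gamma>b 2 z = 4 * \<gamma>c 2 * \<gamma>b 1 z + 2 * \<alpha>b 1 z"
      "\<And>z. z \<in> Z \<Longrightarrow> 3 * \<alpha>b 2 z = 2 * \<gamma>b 1 z * \<alpha>c 2 + 2 * \<gamma>c 2 * \<alpha>b 1 z"
    and v: "v \<in> Z" "\<eta> v \<beta> \<noteq> 0" "\<eta> v \<beta>' \<noteq> 0"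
  shows "square_codim_le n d U 4"
proof -
  have "square_codim_le n d U (4 + 0)"
  proof (rule square_codim_leI[of "{}"])
    fix \<Lambda> z assume "pencil_functional n d U \<alpha> \<gamma> x y \<Lambda>" and z: "z \<in> Z"
    then interpret pencil_functional n d U \<alpha> \<gamma> x y \<Lambda>
      by simp
    have roots': "\<beta>' \<noteq> \<beta>" "\<gamma>c 2 = \<beta>' + \<beta>" "\<alpha>c 2 = - (\<beta>' * \<beta>)"
      using roots by (simp_all add: add.commute mult.commute)
    have "\<eta> v \<beta> * geo \<beta> \<beta>' z = 0"
      by (rule geo_zero_of_common[OF roots assms(4-6) v(1) z deriv[OF v(1)] geo_cross[OF roots' v(1) z]])
    moreover have "\<eta> v \<beta>' * geo \<beta>' \<beta> z = 0"
      by (rule geo_zero_of_common[OF roots' assms(4,6,5) v(1) z deriv[OF v(1)] geo_cross[OF roots v(1) z]])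
    ultimately have "geo \<beta> \<beta>' z = 0" "geo \<beta>' \<beta> z = 0"
      using v by simp_all
    then show "E 0 z = 0 \<and> E 1 z = 0"
      using E_geo_0[OF roots, of z] E_geo_1[OF roots, of z] by simp
  qed auto
  then show ?thesis
    by simp
qed

lemma codim_double:
  assumes "\<gamma>c 2 = 2 * \<beta>" "\<alpha>c 2 = - \<beta>\<^sup>2" "i \<le> d" "\<chi> i \<beta> \<noteq> 0"
  shows "square_codim_le n d U 4"
proof -
  have "square_codim_le n d U (4 + 0)"
  proof (rule square_codim_leI[of "{}"])
    fix \<Lambda> z assume "pencil_functional n d U \<alpha> \<gamma> x y \<Lambda>" and z: "z \<in> Z"
    then interpret pencil_functional n d U \<alpha> \<gamma> x y \<Lambda>
      by simp
    show "E 0 z = 0 \<and> E 1 z = 0"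
      by (rule E_zero_double[OF assms z])
  qed auto
  then show ?thesis
    by simp
qed

lemma codim_double':
  assumes "\<gamma>c 2 = 2 * \<beta>" "\<alpha>c 2 = - \<beta>\<^sup>2"
    and "Suc i \<le> d" "of_nat (Suc i) * \<beta> ^ i \<noteq> \<gamma>c (Suc i)" "\<chi> (Suc i) \<beta> = 0"
    and "v \<in> Z" "\<gamma>b 1 v \<noteq> 0" "\<alpha>b 1 v = - \<beta> * \<gamma>b 1 v"
    and "of_nat (Suc i) * (\<alpha>b i v + \<gamma>b i v * \<beta>) =
      (of_nat (Suc i) * \<beta> ^ i - \<gamma>c (Suc i)) * \<gamma>b 1 v"
  shows "square_codim_le n d U 4"
proof -
  have "square_codim_le n d U (4 + 0)"
  proof (rule square_codim_leI[of "{}"])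
    fix \<Lambda> z assume "pencil_functional n d U \<alpha> \<gamma> x y \<Lambda>" and z: "z \<in> Z"
    then interpret pencil_functional n d U \<alpha> \<gamma> x y \<Lambda>
      by simp
    show "E 0 z = 0 \<and> E 1 z = 0"
      by (rule E_zero_double'[OF assms z])
  qed auto
  then show ?thesis
    by simp
qed

end

subsection \<open>Moving the second variable\<close>

definition has_dir_deriv :: "(cpoly \<Rightarrow> complex) \<Rightarrow> cpoly \<Rightarrow> cpoly \<Rightarrow> complex \<Rightarrow> bool"
  where "has_dir_deriv f v z c \<longleftrightarrow>
    (\<exists>p. (\<forall>r. f (v + const_poly r * z) = poly p r) \<and> poly (pderiv p) 0 = c)"

lemma has_dir_deriv_value: "\<forall>r. f (v + const_poly r * z) = poly p r \<Longrightarrow> poly p 0 = f v"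
  by (metis add.right_neutral mult_zero_left single_zero)

lemma has_dir_deriv_const: "has_dir_deriv (\<lambda>v. c) v z 0"
  unfolding has_dir_deriv_def by (rule exI[of _ "[:c:]"]) (simp add: pderiv_pCons)

lemma has_dir_deriv_add:
  assumes "has_dir_deriv f v z c" "has_dir_deriv g v z e"
  shows "has_dir_deriv (\<lambda>v. f v + g v) v z (c + e)"
proof -
  obtain p q where "\<forall>r. f (v + const_poly r * z) = poly p r" "poly (pderiv p) 0 = c"
    "\<forall>r. g (v + const_poly r * z) = poly q r" "poly (pderiv q) 0 = e"
    using assms unfolding has_dir_deriv_def by blast
  then show ?thesis
    unfolding has_dir_deriv_def by (intro exI[of _ "p + q"]) (simp add: pderiv_add)
qed

lemma has_dir_deriv_mult:
  assumes "has_dir_deriv f v z c" "has_dir_deriv g v z e"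
  shows "has_dir_deriv (\<lambda>v. f v * g v) v z (c * g v + f v * e)"
proof -
  obtain p q where "\<forall>r. f (v + const_poly r * z) = poly p r" "poly (pderiv p) 0 = c"
    "\<forall>r. g (v + const_poly r * z) = poly q r" "poly (pderiv q) 0 = e"
    using assms unfolding has_dir_deriv_def by blast
  then show ?thesis
    unfolding has_dir_deriv_def using has_dir_deriv_value[of f v z p] has_dir_deriv_value[of g v z q]
    by (intro exI[of _ "p * q"]) (simp add: pderiv_mult algebra_simps)
qed

lemma has_dir_deriv_diff:
  assumes "has_dir_deriv f v z c" "has_dir_deriv g v z e"
  shows "has_dir_deriv (\<lambda>v. f v - g v) v z (c - e)"
  using has_dir_deriv_add[OF assms(1) has_dir_deriv_mult[OF has_dir_deriv_const[of "- 1"] assms(2)]]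
  by simp

lemma has_dir_deriv_power:
  assumes "has_dir_deriv f v z c"
  shows "has_dir_deriv (\<lambda>v. f v ^ Suc k) v z (of_nat (Suc k) * f v ^ k * c)"
proof (induction k)
  case (Suc k)
  show ?case
    using has_dir_deriv_mult[OF assms Suc] by (simp add: algebra_simps)
qed (use assms in simp)

lemma has_dir_deriv_functional:
  assumes "lin_functional \<phi>"
  shows "has_dir_deriv (\<lambda>v. \<phi> (q * (y + v) ^ Suc k)) v z (of_nat (Suc k) * \<phi> (q * (y + v) ^ k * z))"
  unfolding has_dir_deriv_def
  using poly_line_poly[OF lin_functional_mult[OF assms, of q], of "y + v" z "Suc k"]
    pderiv_line_poly[OF lin_functional_mult[OF assms, of q], of "y + v" z k 0]
  by (intro exI[of _ "line_poly (\<lambda>p. \<phi> (q * p)) (y + v) z (Suc k)"]) (simp add: add.assoc mult_ac)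

lemma has_dir_deriv_zero:
  assumes "has_dir_deriv f v z c" "\<And>r. f (v + const_poly r * z) = 0"
  shows "c = 0"
proof -
  obtain p where p: "\<forall>r. 0 = poly p r" "poly (pderiv p) 0 = c"
    using assms unfolding has_dir_deriv_def by auto
  then have "p = 0"
    using poly_all_0_iff_0[of p] by metis
  then show ?thesis
    using p(2) by simp
qed

text \<open>Polynomiality along lines stands in for polynomiality in coordinates of Z; it suffices
  for joining two points as in \<open>poly_on_nonzero\<close>.\<close>

definition poly_on :: "cpoly set \<Rightarrow> (cpoly \<Rightarrow> complex) \<Rightarrow> bool"
  where "poly_on Z f \<longleftrightarrow> (\<forall>v\<in>Z. \<forall>w\<in>Z. poly_fun (\<lambda>r. f (v + const_poly r * w)))"

lemma poly_on_const [intro!]: "poly_on Z (\<lambda>v. c)"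
  by (auto simp: poly_on_def)

lemma poly_on_add [intro!]: "poly_on Z f \<Longrightarrow> poly_on Z g \<Longrightarrow> poly_on Z (\<lambda>v. f v + g v)"
  by (auto simp: poly_on_def)

lemma poly_on_diff [intro!]: "poly_on Z f \<Longrightarrow> poly_on Z g \<Longrightarrow> poly_on Z (\<lambda>v. f v - g v)"
  by (auto simp: poly_on_def)

lemma poly_on_mult [intro!]: "poly_on Z f \<Longrightarrow> poly_on Z g \<Longrightarrow> poly_on Z (\<lambda>v. f v * g v)"
  by (auto simp: poly_on_def)

lemma poly_on_power [intro!]: "poly_on Z f \<Longrightarrow> poly_on Z (\<lambda>v. f v ^ k)"
  by (auto simp: poly_on_def)

lemma poly_on_functional:
  "lin_functional \<phi> \<Longrightarrow> poly_on Z (\<lambda>v. \<phi> (q * (y + v) ^ k))"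
  by (simp add: poly_on_def poly_fun_functional flip: add.assoc)

lemma complex_roots:
  fixes a b :: complex
  assumes "a\<^sup>2 + 4 * b \<noteq> 0"
  obtains \<beta> \<beta>' where "\<beta> \<noteq> \<beta>'" "a = \<beta> + \<beta>'" "b = - (\<beta> * \<beta>')"
proof -
  define s where "s = csqrt (a\<^sup>2 + 4 * b)"
  have s: "s\<^sup>2 = a\<^sup>2 + 4 * b" "s \<noteq> 0"
    using assms by (auto simp: s_def)
  show ?thesis
  proof (rule that[of "(a + s) / 2" "(a - s) / 2"])
    have "(a + s) / 2 * ((a - s) / 2) = (a\<^sup>2 - s\<^sup>2) / 4"
      by (simp add: field_simps power2_eq_square)
    then show "b = - ((a + s) / 2 * ((a - s) / 2))"
      using s(1) by simp
  qed (use s(2) in \<open>simp_all add: field_simps\<close>)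
qed

text \<open>The quadratic \<beta>^2 - a(r) \<beta> - b(r) varies with r, with a' = a1 + a2 r and b'
  = b1 + b2 r half the derivatives of a and b. \<open>res\<close> is the product of a' \<beta> + b'
  over its two roots, so it vanishes identically when no r moves both roots; then one root is fixed
  along the whole line.\<close>

lemma constant_root_on_line:
  fixes a0 a1 a2 b0 b1 b2 :: complex
  assumes disc: "a0\<^sup>2 + 4 * b0 \<noteq> 0"
    and res: "\<And>r. (b1 + b2 * r)\<^sup>2 + (a0 + 2 * a1 * r + a2 * r\<^sup>2) * (b1 + b2 * r) * (a1 + a2 * r)
      - (b0 + 2 * b1 * r + b2 * r\<^sup>2) * (a1 + a2 * r)\<^sup>2 = 0"
  shows "\<exists>\<beta>. \<beta>\<^sup>2 = a0 * \<beta> + b0 \<and> a1 * \<beta> + b1 = 0 \<and> a2 * \<beta> + b2 = 0"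
proof -
  define p where "p = [:b1, b2:]\<^sup>2 + [:a0, 2 * a1, a2:] * [:b1, b2:] * [:a1, a2:]
    - [:b0, 2 * b1, b2:] * [:a1, a2:]\<^sup>2"
  have "poly p r = 0" for r
    using res[of r] by (simp add: p_def algebra_simps power2_eq_square)
  then have "p = 0"
    using poly_all_0_iff_0 by blast
  then have coeff: "coeff p i = 0" for i
    by simp
  consider "a1 = 0 \<and> a2 = 0" | "a2 = 0 \<and> a1 \<noteq> 0" | "a2 \<noteq> 0"
    by blast
  then show ?thesis
  proof cases
    case 1
    then have "b1 = 0" "b2 = 0"
      using res[of 0] res[of 1] by auto
    moreover obtain \<beta> \<beta>' where "a0 = \<beta> + \<beta>'" "b0 = - (\<beta> * \<beta>')"
      using complex_roots[OF disc] by blast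
    then have "\<beta>\<^sup>2 = a0 * \<beta> + b0"
      by (simp add: algebra_simps power2_eq_square)
    ultimately show ?thesis
      using 1 by auto
  next
    case 2
    have c0: "b1\<^sup>2 + a0 * b1 * a1 - b0 * a1\<^sup>2 = 0"
      using coeff[of 0] 2 by (simp add: p_def power2_eq_square algebra_simps)
    have c1: "2 * b1 * b2 + a0 * b2 * a1 + 2 * a1 * b1 * a1 - 2 * b1 * a1\<^sup>2 = 0"
      using coeff[of 1] 2 by (simp add: p_def power2_eq_square algebra_simps)
    have c2: "b2\<^sup>2 + 2 * a1 * b2 * a1 - b2 * a1\<^sup>2 = 0"
      using coeff[of 2] 2 by (simp add: p_def power2_eq_square algebra_simps numeral_2_eq_2)
    \<comment> \<open>Otherwise the coefficients \<open>c1\<close> and \<open>c2\<close> make the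
      discriminant constant along the line, and \<open>c0\<close> makes it zero.\<close>
    have "b2 = 0"
    proof (rule ccontr)
      assume "b2 \<noteq> 0"
      have "b2 * (b2 + a1\<^sup>2) = 0"
        using c2 by algebra
      then have b2: "b2 = - a1\<^sup>2"
        using \<open>b2 \<noteq> 0\<close> by (simp add: eq_neg_iff_add_eq_0)
      have "b2 * (2 * b1 + a0 * a1) = 0"
        using c1 by algebra
      then have b1: "2 * b1 = - (a0 * a1)"
        using \<open>b2 \<noteq> 0\<close> by (simp add: eq_neg_iff_add_eq_0)
      have "a1\<^sup>2 * (a0\<^sup>2 + 4 * b0) = 0"
        using c0 b1 by algebra
      then show False
        using disc 2 by simp
    qed
    moreover define \<beta> where "\<beta> = - b1 / a1"
    have b1: "b1 = - \<beta> * a1"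
      using 2 by (simp add: \<beta>_def)
    have "a1\<^sup>2 * (\<beta>\<^sup>2 - a0 * \<beta> - b0) = 0"
      using c0 unfolding b1 by algebra
    then have "\<beta>\<^sup>2 - a0 * \<beta> - b0 = 0"
      using 2 by simp
    then have "\<beta>\<^sup>2 = a0 * \<beta> + b0"
      by (simp add: algebra_simps)
    ultimately show ?thesis
      using 2 b1 by (intro exI[of _ \<beta>]) simp
  next
    case 3
    define \<beta> where "\<beta> = - b2 / a2"
    have b2: "b2 = - \<beta> * a2"
      using 3 by (simp add: \<beta>_def)
    \<comment> \<open>At this r the factor a1 + a2 r vanishes and only the square remains; the value
      of r used for the root below makes the factor 1.\<close>
    have "(b1 + b2 * (- a1 / a2))\<^sup>2 = 0"
      using res[of "- a1 / a2"] 3 by simp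
    then have "b1 + b2 * (- a1 / a2) = 0"
      by simp
    then have b1: "b1 = - \<beta> * a1"
      using 3 by (simp add: \<beta>_def field_simps)
    have root: "(a1 + a2 * r)\<^sup>2 * (\<beta>\<^sup>2 - a0 * \<beta> - b0) = 0" for r
      using res[of r] unfolding b1 b2 by algebra
    have "\<beta>\<^sup>2 - a0 * \<beta> - b0 = 0"
      using root[of "(1 - a1) / a2"] 3 by simp
    then show ?thesis
      using b1 b2 by (intro exI[of _ \<beta>]) (simp add: algebra_simps)
  qed
qed

context pencil
begin

text \<open>The line through v and w stays in Z, and neither function vanishes identically on
  it.\<close>

lemma poly_on_nonzero:
  assumes "poly_on Z f" "poly_on Z g" "v \<in> Z" "f v \<noteq> 0" "w \<in> Z" "g w \<noteq> 0"
  obtains u where "u \<in> Z" "f u \<noteq> 0" "g u \<noteq> 0"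
proof -
  have w': "w + const_poly (- 1) * v \<in> Z"
    using assms by (intro Z_add Z_scale)
  have *: "v + const_poly 0 * (w + const_poly (- 1) * v) = v"
    "v + const_poly 1 * (w + const_poly (- 1) * v) = w"
    by (simp_all add: single_uminus)
  obtain t where "f (v + const_poly t * (w + const_poly (- 1) * v)) \<noteq> 0"
    "g (v + const_poly t * (w + const_poly (- 1) * v)) \<noteq> 0"
    using poly_fun_nonzero[of "\<lambda>t. f (v + const_poly t * (w + const_poly (- 1) * v))"
        "\<lambda>t. g (v + const_poly t * (w + const_poly (- 1) * v))" 0 1] assms w'
    unfolding * poly_on_def by blast
  then show ?thesis
    using that w' assms(3) Z_add Z_scale by blast
qed

lemma functional_power_expand:
  assumes "lin_functional \<phi>"
  shows "\<phi> ((const_poly s * x + const_poly e * u) ^ d) =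
    (\<Sum>k\<le>d. of_nat (d choose k) * s ^ (d - k) * e ^ k * \<phi> (x ^ (d - k) * u ^ k))"
proof -
  have "\<phi> ((const_poly s * x + const_poly e * u) ^ d) =
      (\<Sum>k\<le>d. (of_nat (d choose k) * \<phi> (1 * (const_poly s * x) ^ (d - k) * u ^ k)) * e ^ k)"
    using lin_functional_binomial[OF assms, of 1 "const_poly s * x" e u d] by simp
  also have "\<dots> = (\<Sum>k\<le>d. of_nat (d choose k) * s ^ (d - k) * e ^ k * \<phi> (x ^ (d - k) * u ^ k))"
    by (simp add: power_mult_distrib const_poly_power mult.assoc lin_functional_scale[OF assms])
      (simp add: mult_ac)
  finally show ?thesis .
qed

text \<open>A linear form with nonzero y-component has the shape s x + e (y + v) treated by
  \<open>generic\<close>. The others are limits at r = 0 of b + r y, where both sides are polynomial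
  in r.\<close>

lemma power_eq_by_continuity:
  assumes \<phi>: "lin_functional \<phi>"
    and R: "\<And>a. a \<in> forms n 1 \<Longrightarrow> poly_fun (\<lambda>r. R (a + const_poly r * y))"
    and generic: "\<And>s e v. e \<noteq> 0 \<Longrightarrow> v \<in> Z \<Longrightarrow>
      \<phi> ((const_poly s * x + const_poly e * (y + v)) ^ d) = R (const_poly s * x + const_poly e * (y + v))"
    and a: "a \<in> forms n 1"
  shows "\<phi> (a ^ d) = R a"
proof -
  have gen: "\<phi> (b ^ d) = R b" if b: "b \<in> forms n 1" "\<gamma> (x ^ (d - 1) * b) \<noteq> 0" for b
  proof -
    define s e where "s = \<alpha> (x ^ (d - 1) * b)" and "e = \<gamma> (x ^ (d - 1) * b)"
    obtain z where z: "z \<in> Z" "b = const_poly s * x + const_poly e * y + z"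
      using decompose[OF b(1)] unfolding s_def e_def by blast
    have "const_poly e * (const_poly (1 / e) * z) = z"
      using b(2) by (simp add: e_def mult_single flip: mult.assoc)
    then have "b = const_poly s * x + const_poly e * (y + const_poly (1 / e) * z)"
      using z(2) by (simp add: distrib_left add.assoc)
    then show ?thesis
      using generic[of e "const_poly (1 / e) * z" s] b(2) z(1) Z_scale by (simp add: e_def)
  qed
  define e where "e = \<gamma> (x ^ (d - 1) * a)"
  define b where "b = a - const_poly e * y"
  have ab: "a = b + const_poly e * y"
    by (simp add: b_def)
  have b: "b \<in> forms n 1" "\<gamma> (x ^ (d - 1) * b) = 0"
    unfolding b_def using a y \<gamma>_y
    by (auto intro!: forms_diff forms_scale simp: e_def right_diff_distrib functional_simps
        mult.left_commute[of _ "const_poly _"])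
  have gen_b: "\<phi> ((b + const_poly r * y) ^ d) = R (b + const_poly r * y)" if "r \<noteq> 0" for r
    using b y \<gamma>_y that by (intro gen forms_add forms_scale)
      (simp_all add: distrib_left functional_simps mult.left_commute[of _ "const_poly _"])
  have "\<phi> ((b + const_poly 0 * y) ^ d) = R (b + const_poly 0 * y)"
    using poly_fun_eq_continue[OF poly_fun_functional[OF \<phi>, of 1 b y d] R[OF b(1)]] gen_b by simp
  then show ?thesis
    using gen_b ab by (cases "e = 0") auto
qed

text \<open>The coefficients of the pencil with second variable y + v, as functions of v that can be
  restricted to lines and differentiated; \<open>shift_eqs\<close> makes the identification.\<close>

definition \<alpha>v :: "nat \<Rightarrow> cpoly \<Rightarrow> complex" where "\<alpha>v k v = \<alpha> (x ^ (d - k) * (y + v) ^ k)"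
definition \<gamma>v :: "nat \<Rightarrow> cpoly \<Rightarrow> complex" where "\<gamma>v k v = \<gamma> (x ^ (d - k) * (y + v) ^ k)"
definition \<alpha>d :: "nat \<Rightarrow> cpoly \<Rightarrow> cpoly \<Rightarrow> complex" where "\<alpha>d k v z = \<alpha> (x ^ (d - 1 - k) * (y + v) ^ k * z)"
definition \<gamma>d :: "nat \<Rightarrow> cpoly \<Rightarrow> cpoly \<Rightarrow> complex" where "\<gamma>d k v z = \<gamma> (x ^ (d - 1 - k) * (y + v) ^ k * z)"
definition \<chi>v :: "nat \<Rightarrow> cpoly \<Rightarrow> complex \<Rightarrow> complex" where "\<chi>v k v \<beta> = \<beta> ^ k - \<gamma>v k v * \<beta> - \<alpha>v k v"

lemma shift_eqs:
  assumes "v \<in> Z"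
  shows "pencil.\<alpha>c d \<alpha> x (y + v) k = \<alpha>v k v" "pencil.\<gamma>c d \<gamma> x (y + v) k = \<gamma>v k v"
    "pencil.\<alpha>b d \<alpha> x (y + v) k z = \<alpha>d k v z" "pencil.\<gamma>b d \<gamma> x (y + v) k z = \<gamma>d k v z"
    "pencil.\<chi> d \<alpha> \<gamma> x (y + v) k \<beta> = \<chi>v k v \<beta>"
    "pencil.\<eta> d \<alpha> \<gamma> x (y + v) z \<beta> = \<alpha>d 1 v z + \<gamma>d 1 v z * \<beta>"
proof -
  interpret s: pencil n d U \<alpha> \<gamma> x "y + v"
    using pencil_shift[OF assms] .
  show "s.\<alpha>c k = \<alpha>v k v" "s.\<gamma>c k = \<gamma>v k v" "s.\<alpha>b k z = \<alpha>d k v z" "s.\<gamma>b k z = \<gamma>d k v z"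
    "s.\<chi> k \<beta> = \<chi>v k v \<beta>" "s.\<eta> z \<beta> = \<alpha>d 1 v z + \<gamma>d 1 v z * \<beta>"
    by (simp_all add: s.\<alpha>c_def s.\<gamma>c_def s.\<alpha>b_def s.\<gamma>b_def s.\<chi>_def s.\<eta>_def \<alpha>v_def \<gamma>v_def \<alpha>d_def \<gamma>d_def \<chi>v_def)
qed

lemma poly_on_coefficients [intro!]:
  "poly_on Z (\<alpha>v k)" "poly_on Z (\<gamma>v k)" "poly_on Z (\<lambda>v. \<alpha>d k v z)" "poly_on Z (\<lambda>v. \<gamma>d k v z)"
proof -
  have *: "a * b * z = a * z * b" for a b :: cpoly
    by (simp add: mult_ac)
  show "poly_on Z (\<alpha>v k)" "poly_on Z (\<gamma>v k)" "poly_on Z (\<lambda>v. \<alpha>d k v z)" "poly_on Z (\<lambda>v. \<gamma>d k v z)"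
    unfolding \<alpha>v_def[abs_def] \<gamma>v_def[abs_def] \<alpha>d_def \<gamma>d_def *
    by (intro poly_on_functional lin_\<alpha> lin_\<gamma>)+
qed

lemma poly_on_\<chi>v [intro!]: "poly_on Z (\<lambda>v. \<chi>v k v \<beta>)"
  unfolding \<chi>v_def by auto

lemma coefficients_deriv:
  "has_dir_deriv (\<alpha>v (Suc k)) v z (of_nat (Suc k) * \<alpha>d k v z)"
  "has_dir_deriv (\<gamma>v (Suc k)) v z (of_nat (Suc k) * \<gamma>d k v z)"
  unfolding \<alpha>v_def[abs_def] \<gamma>v_def[abs_def] \<alpha>d_def \<gamma>d_def
  using has_dir_deriv_functional[OF lin_\<alpha>, of "x ^ (d - Suc k)"]
    has_dir_deriv_functional[OF lin_\<gamma>, of "x ^ (d - Suc k)"] by simp_all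

lemma coefficients_0_1:
  assumes "v \<in> Z"
  shows "\<alpha>v 0 v = 1" "\<gamma>v 0 v = 0" "\<alpha>v 1 v = 0" "\<gamma>v 1 v = 1"
  using \<alpha>_x \<gamma>_x \<alpha>_y \<gamma>_y assms
  by (simp_all add: \<alpha>v_def \<gamma>v_def Z_def distrib_left functional_simps)

text \<open>The binomial theorem gives the value (s + e \<beta>)^d of \<alpha> + \<beta> \<gamma> at
  the d-th power of s x + e (y + v). So on d-th powers this functional is m^d for a linear m, which
  \<open>base_pointI\<close> reads as a base point.\<close>

lemma base_point:
  assumes "\<And>k v. k \<le> d \<Longrightarrow> v \<in> Z \<Longrightarrow> \<chi>v k v \<beta> = 0"
  shows "\<not> base_point_free n U"
proof (rule base_pointI)
  define \<phi> where "\<phi> = (\<lambda>p. 1 * \<alpha> p + \<beta> * \<gamma> p)"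
  define m where "m = (\<lambda>a. 1 * \<alpha> (x ^ (d - 1) * a) + \<beta> * \<gamma> (x ^ (d - 1) * a))"
  show lin_\<phi>: "lin_functional \<phi>"
    unfolding \<phi>_def by (intro lin_functional_combination lin_\<alpha> lin_\<gamma>)
  show lin_m: "lin_functional m"
    unfolding m_def by (intro lin_functional_combination lin_functional_mult lin_\<alpha> lin_\<gamma>)
  have m_x: "m x = 1"
    using \<alpha>_x \<gamma>_x by (simp add: m_def power_d[unfolded One_nat_def])
  show "x \<in> forms n 1" "m x \<noteq> 0"
    using x m_x by simp_all
  show "U \<subseteq> forms n d" "\<And>p. p \<in> U \<Longrightarrow> \<phi> p = 0"
    by (auto simp: U_eq \<phi>_def)
  fix a assume "a \<in> forms n 1"
  then show "\<phi> (a ^ d) = m a ^ d"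
  proof (rule power_eq_by_continuity[OF lin_\<phi>, rotated 2])
    show "poly_fun (\<lambda>r. m (a + const_poly r * y) ^ d)" for a
      by (intro poly_fun_power poly_fun_functional_linear lin_m)
    fix s e :: complex and v assume v: "v \<in> Z"
    have "m (y + v) = \<beta>"
      using v \<alpha>_y \<gamma>_y by (simp add: m_def Z_def distrib_left functional_simps)
    then have m_a: "m (const_poly s * x + const_poly e * (y + v)) = s + e * \<beta>"
      using m_x by (simp add: lin_functional_add[OF lin_m] lin_functional_scale[OF lin_m])
    have "\<phi> (x ^ (d - k) * (y + v) ^ k) = \<beta> ^ k" if "k \<le> d" for k
      using assms[OF that v] by (simp add: \<phi>_def \<chi>v_def \<alpha>v_def \<gamma>v_def algebra_simps)
    then have "\<phi> ((const_poly s * x + const_poly e * (y + v)) ^ d) =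
        (\<Sum>k\<le>d. of_nat (d choose k) * s ^ (d - k) * e ^ k * \<beta> ^ k)"
      by (simp add: functional_power_expand[OF lin_\<phi>])
    also have "\<dots> = (e * \<beta> + s) ^ d"
      by (simp add: binomial_ring power_mult_distrib mult_ac)
    finally show "\<phi> ((const_poly s * x + const_poly e * (y + v)) ^ d) =
        m (const_poly s * x + const_poly e * (y + v)) ^ d"
      by (simp only: m_a add.commute[of s])
  qed
qed

end

text \<open>The coefficient of r^4 is a2^2.\<close>

lemma quartic_zero:
  fixes a0 a1 a2 b0 b1 b2 :: complex
  assumes "\<And>r. (a0 + 2 * a1 * r + a2 * r\<^sup>2)\<^sup>2 + 4 * (b0 + 2 * b1 * r + b2 * r\<^sup>2) = 0"
  shows "a2 = 0"
proof -
  define p where "p = [:a0, 2 * a1, a2:]\<^sup>2 + smult 4 [:b0, 2 * b1, b2:]"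
  have "poly p r = 0" for r
    using assms[of r] by (simp add: p_def algebra_simps power2_eq_square)
  then have "p = 0"
    using poly_all_0_iff_0 by blast
  then have "coeff p 4 = 0"
    by simp
  then show ?thesis
    by (simp add: p_def power2_eq_square numeral_eq_Suc)
qed

text \<open>The derivative with respect to \<beta> of the binomial expansion of (s + e
  \<beta>)^(m+1).\<close>

lemma weighted_binomial:
  fixes s e \<beta> :: complex
  shows "(\<Sum>k\<le>Suc m. of_nat (Suc m choose k) * s ^ (Suc m - k) * e ^ k * (of_nat k * \<beta> ^ (k - 1))) =
    of_nat (Suc m) * e * (s + e * \<beta>) ^ m"
proof -
  have "(\<Sum>k\<le>Suc m. of_nat (Suc m choose k) * s ^ (Suc m - k) * e ^ k * (of_nat k * \<beta> ^ (k - 1))) =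
      (\<Sum>k\<le>m. of_nat (Suc k * (Suc m choose Suc k)) * s ^ (m - k) * e ^ Suc k * \<beta> ^ k)"
    by (subst sum.atMost_Suc_shift) (simp add: mult_ac del: of_nat_Suc binomial_Suc_Suc mult_Suc)
  also have "\<dots> = of_nat (Suc m) * e * (\<Sum>k\<le>m. of_nat (m choose k) * (e * \<beta>) ^ k * s ^ (m - k))"
    unfolding Suc_times_binomial sum_distrib_left of_nat_mult
    by (simp add: power_mult_distrib mult_ac del: of_nat_Suc)
  finally show ?thesis
    by (simp only: binomial_ring add.commute[of s])
qed

section \<open>Case distinction on the roots of the quadratic\<close>

context pencil
begin

definition disc :: "cpoly \<Rightarrow> complex"
  where "disc v = (\<gamma>v 2 v)\<^sup>2 + 4 * \<alpha>v 2 v"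

text \<open>The product of \<open>\<eta> z \<beta>\<close> over the two roots \<open>\<beta>\<close> of \<open>\<chi> 2\<close>.\<close>

definition res :: "cpoly \<Rightarrow> cpoly \<Rightarrow> complex"
  where "res v z = (\<alpha>d 1 v z)\<^sup>2 + \<gamma>v 2 v * \<alpha>d 1 v z * \<gamma>d 1 v z - \<alpha>v 2 v * (\<gamma>d 1 v z)\<^sup>2"

lemma poly_on_disc [intro!]: "poly_on Z disc"
  unfolding disc_def[abs_def] by auto

lemma poly_on_res [intro!]: "poly_on Z (\<lambda>v. res v z)"
  unfolding res_def by auto

lemma roots_at:
  assumes "disc v \<noteq> 0"
  obtains \<beta> \<beta>' where "\<beta> \<noteq> \<beta>'" "\<gamma>v 2 v = \<beta> + \<beta>'" "\<alpha>v 2 v = - (\<beta> * \<beta>')"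
  using complex_roots[of "\<gamma>v 2 v" "\<alpha>v 2 v"] assms unfolding disc_def by blast

lemma bound_not_common:
  assumes v: "v \<in> Z" and "\<beta> \<noteq> \<beta>'" "\<gamma>v 2 v = \<beta> + \<beta>'" "\<alpha>v 2 v = - (\<beta> * \<beta>')"
    "i \<le> d" "\<chi>v i v \<beta> \<noteq> 0"
    "(\<exists>j\<le>d. \<chi>v j v \<beta>' \<noteq> 0) \<or> (\<exists>z\<in>Z. \<alpha>d 1 v z + \<gamma>d 1 v z * \<beta>' \<noteq> 0)"
  shows "square_codim_le n d U 4"
  using pencil.codim_not_common[OF pencil_shift[OF v], of \<beta> \<beta>' i] assms(2-) unfolding shift_eqs[OF v] by blast

text \<open>Both identities, which say that \<chi>v 2 divides \<chi>v 3, are differentiated along v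
  + r z; the results are the conditions \<open>deriv\<close> of \<open>codim_common\<close>.\<close>

lemma dividing_deriv:
  assumes "\<And>v. v \<in> Z \<Longrightarrow> \<gamma>v 3 v - (\<gamma>v 2 v)\<^sup>2 - \<alpha>v 2 v = 0"
    "\<And>v. v \<in> Z \<Longrightarrow> \<alpha>v 3 v - \<gamma>v 2 v * \<alpha>v 2 v = 0" and v: "v \<in> Z" "z \<in> Z"
  shows "3 * \<gamma>d 2 v z = 4 * \<gamma>v 2 v * \<gamma>d 1 v z + 2 * \<alpha>d 1 v z"
    and "3 * \<alpha>d 2 v z = 2 * \<gamma>d 1 v z * \<alpha>v 2 v + 2 * \<gamma>v 2 v * \<alpha>d 1 v z"
proof -
  have D: "has_dir_deriv (\<alpha>v 2) v z (2 * \<alpha>d 1 v z)" "has_dir_deriv (\<gamma>v 2) v z (2 * \<gamma>d 1 v z)"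
    "has_dir_deriv (\<alpha>v 3) v z (3 * \<alpha>d 2 v z)" "has_dir_deriv (\<gamma>v 3) v z (3 * \<gamma>d 2 v z)"
    using coefficients_deriv[of 1 v z] coefficients_deriv[of 2 v z]
    by (simp_all add: numeral_2_eq_2 numeral_3_eq_3)
  have line: "v + const_poly r * z \<in> Z" for r
    using v Z_add Z_scale by blast
  have "3 * \<gamma>d 2 v z - (2 * \<gamma>d 1 v z * \<gamma>v 2 v + \<gamma>v 2 v * (2 * \<gamma>d 1 v z)) - 2 * \<alpha>d 1 v z = 0"
    by (rule has_dir_deriv_zero[OF has_dir_deriv_diff[OF has_dir_deriv_diff[OF D(4)
            has_dir_deriv_mult[OF D(2,2)]] D(1)]])
      (use assms(1)[OF line] in \<open>simp add: power2_eq_square\<close>)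
  then show "3 * \<gamma>d 2 v z = 4 * \<gamma>v 2 v * \<gamma>d 1 v z + 2 * \<alpha>d 1 v z"
    by (simp add: algebra_simps)
  have "3 * \<alpha>d 2 v z - (2 * \<gamma>d 1 v z * \<alpha>v 2 v + \<gamma>v 2 v * (2 * \<alpha>d 1 v z)) = 0"
    by (rule has_dir_deriv_zero[OF has_dir_deriv_diff[OF D(3) has_dir_deriv_mult[OF D(2,1)]]])
      (use assms(2)[OF line] in simp)
  then show "3 * \<alpha>d 2 v z = 2 * \<gamma>d 1 v z * \<alpha>v 2 v + 2 * \<gamma>v 2 v * \<alpha>d 1 v z"
    by (simp add: algebra_simps)
qed

text \<open>At a suitable u the two roots are distinct and both move. For d = 2 one extra test
  vector suffices. For d at least 3, -G and -H are the coefficients of the remainder of \<chi>v 3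
  modulo \<chi>v 2: if one of them is nonzero somewhere, some root fails \<chi>v 3 at a good point;
  otherwise \<open>codim_common\<close> applies.\<close>

lemma bound_generic:
  assumes "v1 \<in> Z" "disc v1 \<noteq> 0" "v2 \<in> Z" "z \<in> Z" "res v2 z \<noteq> 0"
  shows "square_codim_le n d U (if d = 2 then 6 else 4)"
proof -
  obtain u where u: "u \<in> Z" "disc u \<noteq> 0" "res u z \<noteq> 0"
    using poly_on_nonzero[OF poly_on_disc poly_on_res assms(1,2,3,5)] .
  have res_eq: "res v z = (\<alpha>d 1 v z + \<gamma>d 1 v z * \<beta>) * (\<alpha>d 1 v z + \<gamma>d 1 v z * \<beta>')"
    if "\<gamma>v 2 v = \<beta> + \<beta>'" "\<alpha>v 2 v = - (\<beta> * \<beta>')" for v \<beta> \<beta>'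
    unfolding res_def that by algebra
  show ?thesis
  proof (cases "d = 2")
    case True
    obtain \<beta> \<beta>' where roots: "\<beta> \<noteq> \<beta>'" "\<gamma>v 2 u = \<beta> + \<beta>'" "\<alpha>v 2 u = - (\<beta> * \<beta>')"
      using roots_at[OF u(2)] .
    have "square_codim_le n d U 5"
      using pencil.codim_generic[OF pencil_shift[OF u(1)], of \<beta> \<beta>' z z] roots u(3) assms(4)
      unfolding shift_eqs[OF u(1)] res_eq[OF roots(2,3)] by auto
    then show ?thesis
      using True by (auto intro: square_codim_le_mono)
  next
    case False
    define G where "G = (\<lambda>v. \<gamma>v 3 v - (\<gamma>v 2 v)\<^sup>2 - \<alpha>v 2 v)"
    define H where "H = (\<lambda>v. \<alpha>v 3 v - \<gamma>v 2 v * \<alpha>v 2 v)"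
    have poly: "poly_on Z (\<lambda>v. disc v * res v z)" "poly_on Z G" "poly_on Z H"
      unfolding G_def H_def by auto
    have d3: "3 \<le> d"
      using False d by simp
    have not_divisible: "square_codim_le n d U 4" if v: "v \<in> Z" "disc v * res v z \<noteq> 0" "G v \<noteq> 0 \<or> H v \<noteq> 0" for v
    proof -
      obtain \<beta> \<beta>' where roots: "\<beta> \<noteq> \<beta>'" "\<gamma>v 2 v = \<beta> + \<beta>'" "\<alpha>v 2 v = - (\<beta> * \<beta>')"
        using roots_at[of v] v(2) by auto
      have roots': "\<beta>' \<noteq> \<beta>" "\<gamma>v 2 v = \<beta>' + \<beta>" "\<alpha>v 2 v = - (\<beta>' * \<beta>)"
        using roots by (simp_all add: add.commute mult.commute)
      have \<eta>: "\<alpha>d 1 v z + \<gamma>d 1 v z * \<beta> \<noteq> 0" "\<alpha>d 1 v z + \<gamma>d 1 v z * \<beta>' \<noteq> 0"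
        using v(2) res_eq[OF roots(2,3)] by auto
      have "\<chi>v 3 v \<beta> \<noteq> 0 \<or> \<chi>v 3 v \<beta>' \<noteq> 0"
      proof (rule ccontr)
        assume "\<not> ?thesis"
        then have 0: "\<chi>v 3 v \<beta> = 0" "\<chi>v 3 v \<beta>' = 0"
          by auto
        then have "(\<beta> - \<beta>') * G v = 0"
          unfolding G_def roots(2,3) \<chi>v_def by algebra
        then have "G v = 0"
          using roots(1) by simp
        moreover from this have "H v = 0"
          using 0(1) unfolding G_def H_def roots(2,3) \<chi>v_def by algebra
        ultimately show False
          using v(3) by simp
      qed
      then show ?thesis
        using bound_not_common[OF v(1) roots d3] bound_not_common[OF v(1) roots' d3] \<eta> assms(4) by blast
    qed
    have "square_codim_le n d U 4"
    proof (cases "\<exists>w\<in>Z. G w \<noteq> 0 \<or> H w \<noteq> 0")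
      case True
      then obtain w where w: "w \<in> Z" "G w \<noteq> 0 \<or> H w \<noteq> 0"
        by blast
      then show ?thesis
        using poly_on_nonzero[OF poly(1,2) u(1) _ w(1)] poly_on_nonzero[OF poly(1,3) u(1) _ w(1)] 
          not_divisible u(2,3) by (metis mult_eq_0_iff)
    next
      case False
      obtain \<beta> \<beta>' where roots: "\<beta> \<noteq> \<beta>'" "\<gamma>v 2 u = \<beta> + \<beta>'" "\<alpha>v 2 u = - (\<beta> * \<beta>')"
        using roots_at[OF u(2)] .
      have \<eta>: "\<alpha>d 1 u z + \<gamma>d 1 u z * \<beta> \<noteq> 0" "\<alpha>d 1 u z + \<gamma>d 1 u z * \<beta>' \<noteq> 0"
        using u(3) res_eq[OF roots(2,3)] by auto
      have GH: "\<gamma>v 3 v - (\<gamma>v 2 v)\<^sup>2 - \<alpha>v 2 v = 0" "\<alpha>v 3 v - \<gamma>v 2 v * \<alpha>v 2 v = 0" if "v \<in> Z" for v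
        using False that unfolding G_def H_def by blast+
      have "\<chi>v 3 u \<beta> = 0" "\<chi>v 3 u \<beta>' = 0"
        using GH[OF u(1)] unfolding \<chi>v_def roots(2,3) by algebra+
      then show ?thesis
        using pencil.codim_common[OF pencil_shift[OF u(1)], of \<beta> \<beta>' z] roots d3 \<eta> assms(4)
          dividing_deriv[OF GH u(1)]
        unfolding shift_eqs[OF u(1)] by blast
    qed
    then show ?thesis
      using False by simp
  qed
qed

lemma quadratic_along_line:
  "\<gamma>v 2 (v + const_poly r * w) = \<gamma>v 2 v + 2 * \<gamma>d 1 v w * r + \<gamma> (x ^ (d - 2) * w\<^sup>2) * r\<^sup>2"
  "\<alpha>v 2 (v + const_poly r * w) = \<alpha>v 2 v + 2 * \<alpha>d 1 v w * r + \<alpha> (x ^ (d - 2) * w\<^sup>2) * r\<^sup>2"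
  "\<gamma>d 1 (v + const_poly r * w) w = \<gamma>d 1 v w + \<gamma> (x ^ (d - 2) * w\<^sup>2) * r"
  "\<alpha>d 1 (v + const_poly r * w) w = \<alpha>d 1 v w + \<alpha> (x ^ (d - 2) * w\<^sup>2) * r"
proof -
  have e: "d - 1 - 1 = d - 2"
    by simp
  have sq: "x ^ (d - 2) * (y + (v + const_poly r * w))\<^sup>2 = x ^ (d - 2) * (y + v)\<^sup>2
      + const_poly r * (2 * (x ^ (d - 2) * (y + v) ^ 1 * w))
      + const_poly r * (const_poly r * (x ^ (d - 2) * w\<^sup>2))"
    by (simp add: power2_eq_square algebra_simps)
  show "\<gamma>v 2 (v + const_poly r * w) = \<gamma>v 2 v + 2 * \<gamma>d 1 v w * r + \<gamma> (x ^ (d - 2) * w\<^sup>2) * r\<^sup>2"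
    "\<alpha>v 2 (v + const_poly r * w) = \<alpha>v 2 v + 2 * \<alpha>d 1 v w * r + \<alpha> (x ^ (d - 2) * w\<^sup>2) * r\<^sup>2"
    unfolding \<gamma>v_def \<alpha>v_def \<gamma>d_def \<alpha>d_def e sq functional_simps by (simp_all add: power2_eq_square)
  have lin: "x ^ (d - 2) * (y + (v + const_poly r * w)) ^ 1 * w =
      x ^ (d - 2) * (y + v) ^ 1 * w + const_poly r * (x ^ (d - 2) * w\<^sup>2)"
    by (simp add: power2_eq_square algebra_simps)
  show "\<gamma>d 1 (v + const_poly r * w) w = \<gamma>d 1 v w + \<gamma> (x ^ (d - 2) * w\<^sup>2) * r"
    "\<alpha>d 1 (v + const_poly r * w) w = \<alpha>d 1 v w + \<alpha> (x ^ (d - 2) * w\<^sup>2) * r"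
    unfolding \<gamma>d_def \<alpha>d_def e lin functional_simps by simp_all
qed

lemma \<gamma>d_linear: "lin_functional (\<gamma>d 1 v)" and \<alpha>d_linear: "lin_functional (\<alpha>d 1 v)"
  unfolding \<gamma>d_def[abs_def] \<alpha>d_def[abs_def] by (intro lin_functional_mult lin_\<gamma> lin_\<alpha>)+

text \<open>On each line through v1 in Z one of the two roots at v1 stays fixed. If each root failed
  in some direction, then by \<open>poly_on_nonzero\<close> both would fail in a common one.\<close>

lemma constant_root:
  assumes v1: "v1 \<in> Z" "disc v1 \<noteq> 0" and res: "\<And>v z. v \<in> Z \<Longrightarrow> z \<in> Z \<Longrightarrow> res v z = 0"
  shows "\<exists>\<beta>. \<forall>v\<in>Z. \<beta>\<^sup>2 = \<gamma>v 2 v * \<beta> + \<alpha>v 2 v"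
proof -
  obtain \<beta>1 \<beta>2 where roots: "\<gamma>v 2 v1 = \<beta>1 + \<beta>2" "\<alpha>v 2 v1 = - (\<beta>1 * \<beta>2)"
    using roots_at[OF v1(2)] .
  \<comment> \<open>At v1 + r w the value of \<gamma>v 2 \<beta> + \<alpha>v 2 has changed by 2 r L
    \<beta> w + r^2 M \<beta> w.\<close>
  define L where "L = (\<lambda>\<beta> w. \<gamma>d 1 v1 w * \<beta> + \<alpha>d 1 v1 w)"
  define M where "M = (\<lambda>\<beta> w. \<gamma> (x ^ (d - 2) * w\<^sup>2) * \<beta> + \<alpha> (x ^ (d - 2) * w\<^sup>2))"
  have line: "v1 + const_poly r * w \<in> Z" if "w \<in> Z" for r w
    using v1(1) that Z_add Z_scale by blast
  have on_line: "(L \<beta>1 w = 0 \<and> M \<beta>1 w = 0) \<or> (L \<beta>2 w = 0 \<and> M \<beta>2 w = 0)" if w: "w \<in> Z" for w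
  proof -
    have "\<exists>\<beta>. \<beta>\<^sup>2 = \<gamma>v 2 v1 * \<beta> + \<alpha>v 2 v1 \<and> L \<beta> w = 0 \<and> M \<beta> w = 0"
      unfolding L_def M_def
    proof (rule constant_root_on_line)
      show "(\<gamma>v 2 v1)\<^sup>2 + 4 * \<alpha>v 2 v1 \<noteq> 0"
        using v1(2) by (simp add: disc_def)
      fix r
      show "(\<alpha>d 1 v1 w + \<alpha> (x ^ (d - 2) * w\<^sup>2) * r)\<^sup>2 +
          (\<gamma>v 2 v1 + 2 * \<gamma>d 1 v1 w * r + \<gamma> (x ^ (d - 2) * w\<^sup>2) * r\<^sup>2) *
          (\<alpha>d 1 v1 w + \<alpha> (x ^ (d - 2) * w\<^sup>2) * r) * (\<gamma>d 1 v1 w + \<gamma> (x ^ (d - 2) * w\<^sup>2) * r) -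
          (\<alpha>v 2 v1 + 2 * \<alpha>d 1 v1 w * r + \<alpha> (x ^ (d - 2) * w\<^sup>2) * r\<^sup>2) *
          (\<gamma>d 1 v1 w + \<gamma> (x ^ (d - 2) * w\<^sup>2) * r)\<^sup>2 = 0"
        using res[OF line[OF w] w, of r] unfolding res_def quadratic_along_line .
    qed
    then obtain \<beta> where \<beta>: "\<beta>\<^sup>2 = \<gamma>v 2 v1 * \<beta> + \<alpha>v 2 v1" "L \<beta> w = 0" "M \<beta> w = 0"
      by blast
    have "(\<beta> - \<beta>1) * (\<beta> - \<beta>2) = 0"
      using \<beta>(1) unfolding roots by algebra
    then show ?thesis
      using \<beta>(2,3) by auto
  qed
  have poly: "poly_on Z (L \<beta>)" "poly_on Z (M \<beta>)" for \<beta>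
  proof -
    have square: "poly_on Z (\<lambda>w. \<phi> (x ^ (d - 2) * w\<^sup>2))" if "lin_functional \<phi>" for \<phi>
      using poly_on_functional[OF that, of Z "x ^ (d - 2)" 0 2] by simp
    show "poly_on Z (M \<beta>)"
      unfolding M_def by (intro poly_on_add poly_on_mult poly_on_const square lin_\<alpha> lin_\<gamma>)
    have linear: "poly_on Z (\<lambda>w. \<phi> w)" if "lin_functional \<phi>" for \<phi>
      using poly_on_functional[OF that, of Z 1 0 1] by simp
    show "poly_on Z (L \<beta>)"
      unfolding L_def by (intro poly_on_add poly_on_mult poly_on_const linear[OF \<gamma>d_linear] linear[OF \<alpha>d_linear])
  qed
  have "\<exists>\<beta>. \<beta>\<^sup>2 = \<gamma>v 2 v1 * \<beta> + \<alpha>v 2 v1 \<and> (\<forall>w\<in>Z. L \<beta> w = 0 \<and> M \<beta> w = 0)"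
  proof (rule ccontr)
    assume neg: "\<not> ?thesis"
    have "\<beta>1\<^sup>2 = \<gamma>v 2 v1 * \<beta>1 + \<alpha>v 2 v1" "\<beta>2\<^sup>2 = \<gamma>v 2 v1 * \<beta>2 + \<alpha>v 2 v1"
      unfolding roots by (simp_all add: power2_eq_square algebra_simps)
    then obtain w1 w2 where w: "w1 \<in> Z" "L \<beta>1 w1 \<noteq> 0 \<or> M \<beta>1 w1 \<noteq> 0"
      "w2 \<in> Z" "L \<beta>2 w2 \<noteq> 0 \<or> M \<beta>2 w2 \<noteq> 0"
      using neg by blast
    obtain f where f: "poly_on Z f" "f w1 \<noteq> 0" "f = L \<beta>1 \<or> f = M \<beta>1"
      using w(2) poly by blast
    obtain g where g: "poly_on Z g" "g w2 \<noteq> 0" "g = L \<beta>2 \<or> g = M \<beta>2"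
      using w(4) poly by blast
    obtain u where "u \<in> Z" "f u \<noteq> 0" "g u \<noteq> 0"
      using poly_on_nonzero[OF f(1) g(1) w(1) f(2) w(3) g(2)] .
    then show False
      using on_line[of u] f(3) g(3) by auto
  qed
  then obtain \<beta> where \<beta>: "\<beta>\<^sup>2 = \<gamma>v 2 v1 * \<beta> + \<alpha>v 2 v1" "\<And>w. w \<in> Z \<Longrightarrow> L \<beta> w = 0 \<and> M \<beta> w = 0"
    by blast
  have "\<beta>\<^sup>2 = \<gamma>v 2 v * \<beta> + \<alpha>v 2 v" if v: "v \<in> Z" for v
  proof -
    define w where "w = v + const_poly (- 1) * v1"
    have w: "w \<in> Z"
      unfolding w_def by (intro Z_add Z_scale v v1(1))
    have v_eq: "v = v1 + const_poly 1 * w"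
      by (simp add: w_def single_uminus)
    have "\<gamma>v 2 v * \<beta> + \<alpha>v 2 v = \<gamma>v 2 v1 * \<beta> + \<alpha>v 2 v1 + 2 * L \<beta> w + M \<beta> w"
      unfolding v_eq quadratic_along_line L_def M_def by (simp add: algebra_simps)
    then show ?thesis
      using \<beta> w by simp
  qed
  then show ?thesis
    by blast
qed

lemma not_common_root:
  assumes "base_point_free n U"
  obtains k v where "k \<le> d" "v \<in> Z" "\<chi>v k v \<beta> \<noteq> 0"
  using base_point[of \<beta>] assms by blast

text \<open>Since \<beta> gives no base point, it fails some \<chi>v k. The other root either moves,
  so that its \<eta> is nonzero, or is constant too and fails some \<chi>v j for the same
  reason.\<close>

lemma bound_constant_root:
  assumes bpf: "base_point_free n U" and v1: "v1 \<in> Z" "disc v1 \<noteq> 0"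
    and root: "\<And>v. v \<in> Z \<Longrightarrow> \<beta>\<^sup>2 = \<gamma>v 2 v * \<beta> + \<alpha>v 2 v"
  shows "square_codim_le n d U 4"
proof -
  obtain k v2 where k: "k \<le> d" "v2 \<in> Z" "\<chi>v k v2 \<beta> \<noteq> 0"
    using not_common_root[OF bpf] .
  define \<beta>' where "\<beta>' = (\<lambda>v. \<gamma>v 2 v - \<beta>)"
  have roots: "\<gamma>v 2 v = \<beta> + \<beta>' v" "\<alpha>v 2 v = - (\<beta> * \<beta>' v)" if "v \<in> Z" for v
    using root[OF that] by (simp_all add: \<beta>'_def algebra_simps power2_eq_square)
  have distinct: "\<beta> \<noteq> \<beta>' v" if "v \<in> Z" "disc v \<noteq> 0" for v
    using that(2) roots[OF that(1)] by (auto simp: disc_def power2_eq_square algebra_simps)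
  have line: "v + const_poly r * z \<in> Z" if "v \<in> Z" "z \<in> Z" for v z r
    using that Z_add Z_scale by blast
  have deriv: "\<alpha>d 1 v z = - \<beta> * \<gamma>d 1 v z" if "v \<in> Z" "z \<in> Z" for v z
  proof -
    have D: "has_dir_deriv (\<alpha>v 2) v z (2 * \<alpha>d 1 v z)" "has_dir_deriv (\<gamma>v 2) v z (2 * \<gamma>d 1 v z)"
      using coefficients_deriv[of 1 v z] by (simp_all add: numeral_2_eq_2)
    have "0 - (0 * \<gamma>v 2 v + \<beta> * (2 * \<gamma>d 1 v z)) - 2 * \<alpha>d 1 v z = 0"
      by (rule has_dir_deriv_zero[OF has_dir_deriv_diff[OF has_dir_deriv_diff[OF
              has_dir_deriv_const[of "\<beta>\<^sup>2"] has_dir_deriv_mult[OF has_dir_deriv_const[of \<beta>] D(2)]] D(1)]])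
        (use root[OF line[OF that]] in \<open>simp add: algebra_simps\<close>)
    then have "2 * (\<alpha>d 1 v z + \<beta> * \<gamma>d 1 v z) = 0"
      by algebra
    then have "\<alpha>d 1 v z + \<beta> * \<gamma>d 1 v z = 0"
      unfolding mult_eq_0_iff by simp
    then show ?thesis
      by (simp add: eq_neg_iff_add_eq_0)
  qed
  obtain u where u: "u \<in> Z" "disc u \<noteq> 0" "\<chi>v k u \<beta> \<noteq> 0"
    using poly_on_nonzero[OF poly_on_disc poly_on_\<chi>v v1 k(2,3)] .
  show ?thesis
  proof (cases "\<exists>v\<in>Z. \<exists>z\<in>Z. \<gamma>d 1 v z \<noteq> 0")
    case True
    then obtain v z where vz: "v \<in> Z" "z \<in> Z" "\<gamma>d 1 v z \<noteq> 0"
      by blast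
    have f: "poly_on Z (\<lambda>v. disc v * \<chi>v k v \<beta>)" and g: "poly_on Z (\<lambda>v. \<gamma>d 1 v z)"
      and nz: "disc u * \<chi>v k u \<beta> \<noteq> 0"
      using u by auto
    obtain t where t: "t \<in> Z" "disc t * \<chi>v k t \<beta> \<noteq> 0" "\<gamma>d 1 t z \<noteq> 0"
      by (rule poly_on_nonzero[OF f g u(1) nz vz(1,3)])
    have "\<alpha>d 1 t z + \<gamma>d 1 t z * \<beta>' t = \<gamma>d 1 t z * (\<beta>' t - \<beta>)"
      using deriv[OF t(1) vz(2)] by (simp add: algebra_simps)
    moreover have "\<beta> \<noteq> \<beta>' t"
      using distinct[OF t(1)] t(2) by simp
    ultimately show ?thesis
      using t(2,3) vz(2) by (intro bound_not_common[OF t(1) _ roots[OF t(1)] k(1)] disjI2 bexI[of _ z]) auto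
  next
    case False
    have const: "\<gamma>v 2 v = \<gamma>v 2 u" if v: "v \<in> Z" for v
    proof -
      define w where "w = v + const_poly (- 1) * u"
      have w: "w \<in> Z"
        unfolding w_def by (intro Z_add Z_scale v u(1))
      have v_eq: "v = u + const_poly 1 * w"
        by (simp add: w_def single_uminus)
      have "\<gamma>d 1 u w = 0" "\<gamma>d 1 (u + const_poly 1 * w) w = 0"
        using False u(1) v w v_eq by metis+
      then show ?thesis
        unfolding v_eq quadratic_along_line by simp
    qed
    then have const': "\<beta>' v = \<beta>' u" if "v \<in> Z" for v
      using that by (simp add: \<beta>'_def)
    obtain j v3 where j: "j \<le> d" "v3 \<in> Z" "\<chi>v j v3 (\<beta>' u) \<noteq> 0"
      using not_common_root[OF bpf] .
    obtain t where t: "t \<in> Z" "\<chi>v k t \<beta> \<noteq> 0" "\<chi>v j t (\<beta>' u) \<noteq> 0"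
      using poly_on_nonzero[OF poly_on_\<chi>v poly_on_\<chi>v u(1,3) j(2,3)] .
    have "\<beta> \<noteq> \<beta>' t"
      using distinct[OF u(1,2)] const'[OF t(1)] by simp
    then show ?thesis
      using j(1) t(3) const'[OF t(1)]
      by (intro bound_not_common[OF t(1) _ roots[OF t(1)] k(1) t(2)] disjI1 exI[of _ j]) auto
  qed
qed

end

context pencil
begin

text \<open>The double root is affine in v with linear part \<mu>. If it fails some \<chi>v k,
  \<open>codim_double\<close> applies. Otherwise \<mu> is nonzero on Z, as a constant root would be
  a base point. Being a simple root of some \<chi>v (i+1) leads to \<open>codim_double'\<close>, and
  being a multiple root of all of them to the exceptional pencil.\<close>

lemma bound_double:
  assumes bpf: "base_point_free n U" and disc: "\<And>v. v \<in> Z \<Longrightarrow> disc v = 0"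
  shows "square_codim_le n d U (if d = 2 then 6 else 4)"
proof -
  define \<beta> where "\<beta> = (\<lambda>v. \<gamma>v 2 v * (1 / 2))"
  define \<mu> where "\<mu> = \<gamma>d 1 0"
  have lin_\<mu>: "lin_functional \<mu>"
    unfolding \<mu>_def by (rule \<gamma>d_linear)
  have double: "\<gamma>v 2 v = 2 * \<beta> v" "\<alpha>v 2 v = - (\<beta> v)\<^sup>2" if "v \<in> Z" for v
  proof -
    show 1: "\<gamma>v 2 v = 2 * \<beta> v"
      by (simp add: \<beta>_def)
    have "4 * (\<alpha>v 2 v + (\<beta> v)\<^sup>2) = 0"
      using disc[OF that] unfolding disc_def 1 by algebra
    then have "\<alpha>v 2 v + (\<beta> v)\<^sup>2 = 0"
      unfolding mult_eq_0_iff by simp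
    then show "\<alpha>v 2 v = - (\<beta> v)\<^sup>2"
      by (simp add: eq_neg_iff_add_eq_0)
  qed
  have line: "v + const_poly r * z \<in> Z" if "v \<in> Z" "z \<in> Z" for v z r
    using that Z_add Z_scale by blast
  have square_zero: "\<gamma> (x ^ (d - 2) * w\<^sup>2) = 0" if w: "w \<in> Z" for w
  proof (rule quartic_zero)
    fix r
    show "(\<gamma>v 2 0 + 2 * \<gamma>d 1 0 w * r + \<gamma> (x ^ (d - 2) * w\<^sup>2) * r\<^sup>2)\<^sup>2 +
        4 * (\<alpha>v 2 0 + 2 * \<alpha>d 1 0 w * r + \<alpha> (x ^ (d - 2) * w\<^sup>2) * r\<^sup>2) = 0"
      using disc[OF line[OF Z_zero w, of r]] unfolding disc_def quadratic_along_line .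
  qed
  have \<gamma>d_eq: "\<gamma>d 1 v z = \<mu> z" if vz: "v \<in> Z" "z \<in> Z" for v z
  proof -
    have "x ^ (d - 2) * (v + z)\<^sup>2 = x ^ (d - 2) * v\<^sup>2 + x ^ (d - 2) * z\<^sup>2 + 2 * (x ^ (d - 2) * v * z)"
      by (simp add: power2_eq_square algebra_simps)
    then have "\<gamma> (x ^ (d - 2) * v * z) = 0"
      using square_zero[OF Z_add[OF vz]] square_zero[OF vz(1)] square_zero[OF vz(2)]
      by (simp add: functional_simps)
    moreover have "x ^ (d - 2) * (y + v) * z = x ^ (d - 2) * y * z + x ^ (d - 2) * v * z"
      by (simp add: algebra_simps)
    ultimately show ?thesis
      by (simp add: \<mu>_def \<gamma>d_def functional_simps numeral_2_eq_2)
  qed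
  have \<beta>_eq: "\<beta> v = \<beta> 0 + \<mu> v" if "v \<in> Z" for v
    using quadratic_along_line(1)[of 0 1 v] square_zero[OF that] by (simp add: \<beta>_def \<mu>_def)
  have D\<beta>: "has_dir_deriv \<beta> v z (\<mu> z)" if "v \<in> Z" "z \<in> Z" for v z
    using has_dir_deriv_mult[OF coefficients_deriv(2)[of 1 v z] has_dir_deriv_const[of "1 / 2"]]
      \<gamma>d_eq[OF that] by (simp add: \<beta>_def numeral_2_eq_2)
  have \<alpha>d_eq: "\<alpha>d 1 v z = - \<beta> v * \<mu> z" if vz: "v \<in> Z" "z \<in> Z" for v z
  proof -
    have D\<alpha>: "has_dir_deriv (\<alpha>v 2) v z (2 * \<alpha>d 1 v z)"
      using coefficients_deriv(1)[of 1 v z] by (simp add: numeral_2_eq_2)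
    have "2 * \<alpha>d 1 v z + (\<mu> z * \<beta> v + \<beta> v * \<mu> z) = 0"
      by (rule has_dir_deriv_zero[OF has_dir_deriv_add[OF D\<alpha> has_dir_deriv_mult[OF D\<beta>[OF vz] D\<beta>[OF vz]]]])
        (use double(2)[OF line[OF vz]] in \<open>simp add: power2_eq_square\<close>)
    then have "2 * (\<alpha>d 1 v z + \<beta> v * \<mu> z) = 0"
      by algebra
    then have "\<alpha>d 1 v z + \<beta> v * \<mu> z = 0"
      unfolding mult_eq_0_iff by simp
    then show ?thesis
      by (simp add: eq_neg_iff_add_eq_0)
  qed
  show ?thesis
  proof (cases "\<exists>v\<in>Z. \<exists>k\<le>d. \<chi>v k v (\<beta> v) \<noteq> 0")
    case True
    then obtain v k where v: "v \<in> Z" "k \<le> d" "\<chi>v k v (\<beta> v) \<noteq> 0"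
      by blast
    have "square_codim_le n d U 4"
      using pencil.codim_double[OF pencil_shift[OF v(1)], of "\<beta> v" k] double[OF v(1)] v(2,3)
      unfolding shift_eqs[OF v(1)] by blast
    then show ?thesis
      by (rule square_codim_le_mono) simp
  next
    case False
    then have common: "\<chi>v k v (\<beta> v) = 0" if "v \<in> Z" "k \<le> d" for v k
      using that by blast
    have "\<exists>z\<in>Z. \<mu> z \<noteq> 0"
    proof (rule ccontr)
      assume "\<not> ?thesis"
      then have "\<beta> v = \<beta> 0" if "v \<in> Z" for v
        using \<beta>_eq[OF that] that by simp
      then have "\<not> base_point_free n U"
        using common by (intro base_point[of "\<beta> 0"]) metis
      then show False
        using bpf by simp
    qed
    then obtain z where z: "z \<in> Z" "\<mu> z \<noteq> 0"
      by blast
    show ?thesis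
    proof (cases "\<exists>v\<in>Z. \<exists>i. Suc i \<le> d \<and> of_nat (Suc i) * \<beta> v ^ i \<noteq> \<gamma>v (Suc i) v")
      case True
      then obtain v i where v: "v \<in> Z" and i: "Suc i \<le> d" "of_nat (Suc i) * \<beta> v ^ i \<noteq> \<gamma>v (Suc i) v"
        by blast
      \<comment> \<open>The derivative in direction z of the identity \<chi>v (i+1) v (\<beta> v) =
        0.\<close>
      have "of_nat (Suc i) * \<beta> v ^ i * \<mu> z -
          (of_nat (Suc i) * \<gamma>d i v z * \<beta> v + \<gamma>v (Suc i) v * \<mu> z) - of_nat (Suc i) * \<alpha>d i v z = 0"
        by (rule has_dir_deriv_zero[OF has_dir_deriv_diff[OF has_dir_deriv_diff[OF
                has_dir_deriv_power[OF D\<beta>[OF v z(1)]]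
                has_dir_deriv_mult[OF coefficients_deriv(2) D\<beta>[OF v z(1)]]] coefficients_deriv(1)]])
          (use common[OF line[OF v z(1)] i(1)] in \<open>simp only: \<chi>v_def\<close>)
      then have deriv: "of_nat (Suc i) * (\<alpha>d i v z + \<gamma>d i v z * \<beta> v) =
          (of_nat (Suc i) * \<beta> v ^ i - \<gamma>v (Suc i) v) * \<mu> z"
        by (simp add: algebra_simps del: of_nat_Suc)
      have "square_codim_le n d U 4"
        using pencil.codim_double'[OF pencil_shift[OF v], of "\<beta> v" i z] double[OF v] i
          common[OF v i(1)] z deriv \<alpha>d_eq[OF v z(1)]
        unfolding shift_eqs[OF v] \<gamma>d_eq[OF v z(1)] by blast
      then show ?thesis
        by (rule square_codim_le_mono) simp
    next
      case False
      \<comment> \<open>The vanishing of \<chi>v k and of its derivative at \<beta> v determines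
        both coefficients.\<close>
      have \<gamma>v_eq: "\<gamma>v k v = of_nat k * \<beta> v ^ (k - 1)" if "v \<in> Z" "k \<le> d" for v k
        using False that coefficients_0_1(2)[OF that(1)] by (cases k) auto
      have \<alpha>v_eq: "\<alpha>v k v = \<beta> v ^ k - \<beta> v * (of_nat k * \<beta> v ^ (k - 1))" if "v \<in> Z" "k \<le> d" for v k
        using common[OF that] \<gamma>v_eq[OF that] by (simp add: \<chi>v_def algebra_simps)
      \<comment> \<open>On p x + q (y + v) the functionals e, s, m take the values q, p and p + q
        \<beta> v. The zero summand in \<open>g\<close> gives it the shape of
        \<open>lin_functional_combination\<close>.\<close>
      define e where "e = (\<lambda>a. \<gamma> (x ^ (d - 1) * a))"
      define s where "s = (\<lambda>a. \<alpha> (x ^ (d - 1) * a))"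
      define m where "m = (\<lambda>a. 1 * \<gamma> ((x ^ (d - 2) * y) * a) + (- \<beta> 0) * e a)"
      define g where "g = (\<lambda>a. of_nat d * e a + 0 * e a)"
      define h where "h = (\<lambda>a. (1 - of_nat d) * m a + of_nat d * s a)"
      have lin: "lin_functional e" "lin_functional s" "lin_functional m" "lin_functional g" "lin_functional h"
      proof -
        show 1: "lin_functional e" "lin_functional s"
          unfolding e_def s_def by (intro lin_functional_mult lin_\<alpha> lin_\<gamma>)+
        show 2: "lin_functional m"
          unfolding m_def by (intro lin_functional_combination lin_functional_mult lin_\<gamma> 1)
        show "lin_functional g" "lin_functional h"
          unfolding g_def h_def by (intro lin_functional_combination 1 2)+
      qed
      note e_simps = lin_functional_simps[OF lin(1)] and s_simps = lin_functional_simps[OF lin(2)]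
        and m_simps = lin_functional_simps[OF lin(3)]
      have xx: "x ^ (d - 2) * y * x = x ^ (d - 1) * y"
        using d power_Suc2[of x "d - 2"] by (simp add: mult_ac Suc_diff_Suc numeral_2_eq_2)
      have e_x: "e x = 0" and s_x: "s x = 1" and m_x: "m x = 1"
        using \<alpha>_x \<gamma>_x \<gamma>_y power_d xx by (simp_all only: e_def s_def m_def) simp_all
      have e_y: "e y = 1" and s_y: "s y = 0"
        using \<alpha>_y \<gamma>_y by (simp_all add: e_def s_def)
      have m_y: "m y = \<beta> 0"
        using double(1)[OF Z_zero] e_y by (simp add: m_def \<gamma>v_def power2_eq_square mult.assoc)
      have e_v: "e v = 0" and s_v: "s v = 0" and m_v: "m v = \<mu> v" if "v \<in> Z" for v
      proof -
        show "e v = 0" "s v = 0"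
          using that by (simp_all add: Z_def e_def s_def)
        then show "m v = \<mu> v"
          by (simp add: m_def \<mu>_def \<gamma>d_def numeral_2_eq_2)
      qed
      have on_plane: "e (const_poly p * x + const_poly q * (y + v)) = q"
        "s (const_poly p * x + const_poly q * (y + v)) = p"
        "m (const_poly p * x + const_poly q * (y + v)) = p + q * \<beta> v" if "v \<in> Z" for p q v
        using that by (simp_all add: e_simps s_simps m_simps e_x s_x m_x e_y s_y m_y e_v s_v m_v \<beta>_eq[of v])
      obtain d' where d': "d = Suc d'"
        using d by (cases d) auto
      have weighted: "(\<Sum>k\<le>d. of_nat (d choose k) * p ^ (d - k) * q ^ k * (of_nat k * \<beta> v ^ (k - 1))) =
          of_nat d * q * (p + q * \<beta> v) ^ (d - 1)" for p q v
        using weighted_binomial[of d' p q "\<beta> v"] by (simp add: d' del: of_nat_Suc)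
      have \<gamma>_plane: "\<gamma> ((const_poly p * x + const_poly q * (y + v)) ^ d) =
          of_nat d * q * (p + q * \<beta> v) ^ (d - 1)" if v: "v \<in> Z" for p q v
      proof -
        have "\<gamma> ((const_poly p * x + const_poly q * (y + v)) ^ d) =
            (\<Sum>k\<le>d. of_nat (d choose k) * p ^ (d - k) * q ^ k * (of_nat k * \<beta> v ^ (k - 1)))"
          unfolding functional_power_expand[OF lin_\<gamma>] \<gamma>v_def[symmetric]
          by (intro sum.cong refl) (simp add: \<gamma>v_eq[OF v])
        then show ?thesis
          unfolding weighted .
      qed
      have \<alpha>_plane: "\<alpha> ((const_poly p * x + const_poly q * (y + v)) ^ d) =
          (p + q * \<beta> v) ^ d - \<beta> v * (of_nat d * q * (p + q * \<beta> v) ^ (d - 1))" if v: "v \<in> Z" for p q v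
      proof -
        have "\<alpha> ((const_poly p * x + const_poly q * (y + v)) ^ d) =
            (\<Sum>k\<le>d. of_nat (d choose k) * (q * \<beta> v) ^ k * p ^ (d - k) -
              \<beta> v * (of_nat (d choose k) * p ^ (d - k) * q ^ k * (of_nat k * \<beta> v ^ (k - 1))))"
          unfolding functional_power_expand[OF lin_\<alpha>] \<alpha>v_def[symmetric]
          by (intro sum.cong refl) (simp add: \<alpha>v_eq[OF v] power_mult_distrib right_diff_distrib mult_ac)
        also have "\<dots> = (q * \<beta> v + p) ^ d - \<beta> v * (of_nat d * q * (p + q * \<beta> v) ^ (d - 1))"
          unfolding sum_subtractf sum_distrib_left[symmetric] weighted
            binomial_ring[of "q * \<beta> v" p d, symmetric] ..
        finally show ?thesis
          by (simp only: add.commute[of p])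
      qed
      have poly_fun: "poly_fun (\<lambda>r. m (a + const_poly r * y) ^ (d - 1) * f (a + const_poly r * y))"
        if "lin_functional f" for f a
        by (intro poly_fun_mult poly_fun_power poly_fun_functional_linear lin that)
      have \<gamma>_power: "\<gamma> (a ^ d) = m a ^ (d - 1) * g a" if "a \<in> forms n 1" for a
        by (rule power_eq_by_continuity[OF lin_\<gamma> poly_fun[OF lin(4)] _ that])
          (simp add: \<gamma>_plane on_plane g_def)
      have \<alpha>_power: "\<alpha> (a ^ d) = m a ^ (d - 1) * h a" if "a \<in> forms n 1" for a
      proof (rule power_eq_by_continuity[OF lin_\<alpha> poly_fun[OF lin(5)] _ that])
        fix p q :: complex and v assume v: "v \<in> Z"
        define M where "M = (p + q * \<beta> v) ^ (d - 1)"
        have power: "(p + q * \<beta> v) ^ d = (p + q * \<beta> v) * M"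
          by (simp add: M_def d')
        show "\<alpha> ((const_poly p * x + const_poly q * (y + v)) ^ d) =
            m (const_poly p * x + const_poly q * (y + v)) ^ (d - 1) *
            h (const_poly p * x + const_poly q * (y + v))"
          unfolding \<alpha>_plane[OF v] h_def on_plane[OF v] M_def[symmetric] power by algebra
      qed
      define v where "v = const_poly (1 / \<mu> z) * z"
      have v: "v \<in> Z" "\<mu> v = 1"
        using z Z_scale by (simp_all add: v_def lin_functional_scale[OF lin_\<mu>])
      \<comment> \<open>Both x and v are killed by e, and the coefficient d - 1 makes h X = (1 - d)
        m X + d s X zero because \<mu> v = 1. Y and V are y and v moved into the kernel of m by
        multiples of x.\<close>
      define X Y V where "X = const_poly (of_nat d - 1) * x + v" and "Y = y - const_poly (\<beta> 0) * x"
        and "V = v - x"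
      have forms: "X \<in> forms n 1" "Y \<in> forms n 1" "V \<in> forms n 1"
        unfolding X_def Y_def V_def by (intro forms_add forms_diff forms_scale x y Z_forms v)+
      have at_basis: "e X = 0" "s X = of_nat d - 1" "m X = of_nat d" "e Y = 1" "s Y = - \<beta> 0" "m Y = 0"
        "e V = 0" "s V = - 1" "m V = 0"
        using v by (simp_all add: X_def Y_def V_def e_simps s_simps m_simps e_x s_x m_x e_y s_y m_y e_v s_v m_v)
      interpret exceptional_pencil n d U \<gamma> \<alpha> m g h X Y V
      proof
        show "m X \<noteq> 0" "g X = 0" "h X = 0"
          using d by (simp_all add: g_def h_def at_basis algebra_simps)
        show "U = {p \<in> forms n d. \<gamma> p = 0 \<and> \<alpha> p = 0}"
          using U_eq by auto
        fix b assume "b \<in> forms n 1" "m b = 0"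
        then have "g (b - const_poly (e b) * Y - const_poly (- s b - e b * \<beta> 0) * V) = 0"
          "h (b - const_poly (e b) * Y - const_poly (- s b - e b * \<beta> 0) * V) = 0"
          using at_basis by (simp_all add: g_def h_def e_simps s_simps m_simps)
        then show "\<exists>p q. g (b - const_poly p * Y - const_poly q * V) = 0 \<and>
            h (b - const_poly p * Y - const_poly q * V) = 0"
          by blast
      qed (use d lin lin_\<alpha> lin_\<gamma> forms at_basis \<gamma>_power \<alpha>_power in auto)
      show ?thesis
        by (rule square_codim_le)
    qed
  qed
qed

theorem square_codim_bound:
  assumes "base_point_free n U"
  shows "square_codim_le n d U (if d = 2 then 6 else 4)"
proof (cases "\<forall>v\<in>Z. disc v = 0")
  case True
  then show ?thesis
    using bound_double[OF assms] by blast
next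
  case False
  then obtain v where v: "v \<in> Z" "disc v \<noteq> 0"
    by blast
  show ?thesis
  proof (cases "\<exists>w\<in>Z. \<exists>z\<in>Z. res w z \<noteq> 0")
    case True
    then show ?thesis
      using bound_generic[OF v] by blast
  next
    case False
    then obtain \<beta> where "\<forall>v\<in>Z. \<beta>\<^sup>2 = \<gamma>v 2 v * \<beta> + \<alpha>v 2 v"
      using constant_root[OF v] by blast
    then have "square_codim_le n d U 4"
      using bound_constant_root[OF assms v, of \<beta>] by blast
    then show ?thesis
      by (rule square_codim_le_mono) simp
  qed
qed

end

theorem codim_square_space_bound:
  assumes "2 \<le> d" "bpf_subspace_codim2 n d U"
  shows "codim_in_forms n (2 * d) (square_space U) \<le> (if d = 2 then 6 else 4)"
proof -
  have U: "cpoly.subspace U" "U \<subseteq> forms n d" "codim_in_forms n d U = 2" "base_point_free n U"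
    using assms(2) by (simp_all add: bpf_subspace_codim2_def)
  obtain \<phi> \<psi> s t where lin: "lin_functional \<phi>" "lin_functional \<psi>"
    and U_eq: "U = {p \<in> forms n d. \<phi> p = 0 \<and> \<psi> p = 0}"
    and st: "s \<in> forms n d" "\<phi> s = 1" "\<psi> s = 0" "t \<in> forms n d" "\<phi> t = 0" "\<psi> t = 1"
    using codim2_functionals[OF U(1-3)] .
  obtain x y where xy: "x \<in> forms n 1" "y \<in> forms n 1"
    and jac: "\<phi> (x ^ d) * \<psi> (x ^ (d - 1) * y) \<noteq> \<psi> (x ^ d) * \<phi> (x ^ (d - 1) * y)"
    using jacobian_nonzero[OF lin _ st] assms(1) by auto
  define p q p' q' where "p = \<phi> (x ^ d)" and "q = \<phi> (x ^ (d - 1) * y)"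
    and "p' = \<psi> (x ^ d)" and "q' = \<psi> (x ^ (d - 1) * y)"
  define D where "D = p * q' - p' * q"
  have D: "D \<noteq> 0"
    using jac by (simp add: D_def p_def q_def p'_def q'_def)
  \<comment> \<open>The inverse of the matrix of (\<phi>, \<psi>) on x^d and x^(d-1) y yields the
    dual basis.\<close>
  define \<alpha> where "\<alpha> = (\<lambda>u. (q' / D) * \<phi> u + (- q / D) * \<psi> u)"
  define \<gamma> where "\<gamma> = (\<lambda>u. (- p' / D) * \<phi> u + (p / D) * \<psi> u)"
  have inv: "\<phi> u = p * \<alpha> u + q * \<gamma> u" "\<psi> u = p' * \<alpha> u + q' * \<gamma> u" for u
    using D by (simp_all add: \<alpha>_def \<gamma>_def field_simps) (simp_all add: D_def algebra_simps)
  interpret pencil n d U \<alpha> \<gamma> x y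
  proof
    show "lin_functional \<alpha>" "lin_functional \<gamma>"
      unfolding \<alpha>_def \<gamma>_def by (intro lin_functional_combination lin)+
    have "\<phi> u = 0 \<and> \<psi> u = 0 \<longleftrightarrow> \<alpha> u = 0 \<and> \<gamma> u = 0" for u
    proof
      assume "\<phi> u = 0 \<and> \<psi> u = 0"
      then show "\<alpha> u = 0 \<and> \<gamma> u = 0"
        by (simp add: \<alpha>_def \<gamma>_def)
    next
      assume "\<alpha> u = 0 \<and> \<gamma> u = 0"
      then show "\<phi> u = 0 \<and> \<psi> u = 0"
        by (simp add: inv)
    qed
    then show "U = {p \<in> forms n d. \<alpha> p = 0 \<and> \<gamma> p = 0}"
      using U_eq by simp
    show "\<alpha> (x ^ d) = 1" "\<gamma> (x ^ d) = 0" "\<alpha> (x ^ (d - 1) * y) = 0" "\<gamma> (x ^ (d - 1) * y) = 1"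
      using D unfolding \<alpha>_def \<gamma>_def p_def[symmetric] q_def[symmetric] p'_def[symmetric] q'_def[symmetric]
      by (simp_all add: divide_simps) (simp_all add: D_def algebra_simps)
  qed (use assms(1) xy in auto)
  show ?thesis
    by (rule codim_square_space_le[OF U(2) square_codim_bound[OF U(4)]])
qed

subsection \<open>Monomial subspaces\<close>

definition mono_poly :: "monom \<Rightarrow> cpoly"
  where "mono_poly m = Poly_Mapping.single m 1"

lemma mono_poly_mult: "mono_poly a * mono_poly b = mono_poly (a + b)"
  by (simp add: mono_poly_def mult_single)

lemma inj_mono_poly: "inj_on mono_poly S"
proof (rule inj_onI)
  fix a b assume "mono_poly a = mono_poly b"
  then have "Poly_Mapping.lookup (mono_poly a) a = Poly_Mapping.lookup (mono_poly b) a"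
    by simp
  then show "a = b"
    by (simp add: mono_poly_def lookup_single when_def split: if_splits)
qed

lemma lookup_lin_functional: "lin_functional (\<lambda>p. Poly_Mapping.lookup p m)"
  by (simp add: lin_functional_def lookup_add cscale_def Poly_Mapping.map.rep_eq when_def
      flip: cscale_eq_times)

lemma independent_mono_poly: "cpoly.independent (mono_poly ` S)"
  unfolding cpoly.dependent_def
proof safe
  fix m assume m: "mono_poly m \<in> cpoly.span (mono_poly ` S - {mono_poly m})"
  have "Poly_Mapping.lookup (mono_poly m) m = 0"
    by (rule span_functional_closed[OF lookup_lin_functional _ m])
      (auto simp: mono_poly_def lookup_single when_def)
  then show False
    by (simp add: mono_poly_def)
qed

lemma dim_span_mono_poly: "cpoly.dim (cpoly.span (mono_poly ` S)) = card S"
  using cpoly.dim_span_eq_card_independent[OF independent_mono_poly] card_image[OF inj_mono_poly]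
  by simp

lemma forms_eq_span: "forms n k = cpoly.span (mono_poly ` monoms n k)"
proof
  show "forms n k \<subseteq> cpoly.span (mono_poly ` monoms n k)"
  proof
    fix p assume p: "p \<in> forms n k"
    have "(\<Sum>m\<in>Poly_Mapping.keys p. cscale (Poly_Mapping.lookup p m) (mono_poly m))
        \<in> cpoly.span (mono_poly ` monoms n k)"
      using p by (intro cpoly.span_sum cpoly.span_scale cpoly.span_base) (auto simp: mem_forms_iff)
    then show "p \<in> cpoly.span (mono_poly ` monoms n k)"
      by (simp add: mono_poly_def cscale_eq_times mult_single flip: cpoly_sum_monomials)
  qed
  show "cpoly.span (mono_poly ` monoms n k) \<subseteq> forms n k"
    by (rule cpoly.span_minimal[OF _ subspace_forms]) (auto simp: mono_poly_def intro: single_forms)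
qed

lemma square_space_span: "square_space (cpoly.span S) = cpoly.span {p * q |p q. p \<in> S \<and> q \<in> S}"
  (is "_ = cpoly.span ?T")
proof
  have "p * q \<in> cpoly.span ?T" if pq: "p \<in> cpoly.span S" "q \<in> cpoly.span S" for p q
  proof (rule ccontr)
    assume "p * q \<notin> cpoly.span ?T"
    then obtain \<phi> where \<phi>: "lin_functional \<phi>" "\<And>t. t \<in> ?T \<Longrightarrow> \<phi> t = 0" "\<phi> (p * q) \<noteq> 0"
      using separating_functional by blast
    have "\<phi> (a * q) = 0" if "a \<in> S" for a
      by (rule span_functional_closed[OF lin_functional_mult[OF \<phi>(1)] _ pq(2)]) (use \<phi>(2) that in blast)
    then have "\<phi> (q * p) = 0"
      by (intro span_functional_closed[OF lin_functional_mult[OF \<phi>(1)] _ pq(1)]) (simp add: mult.commute)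
    then show False
      using \<phi>(3) by (simp add: mult.commute)
  qed
  then show "square_space (cpoly.span S) \<subseteq> cpoly.span ?T"
    unfolding square_space_def by (intro cpoly.span_minimal) auto
  show "cpoly.span ?T \<subseteq> square_space (cpoly.span S)"
    unfolding square_space_def by (rule cpoly.span_mono) (use cpoly.span_base in blast)
qed

lemma square_space_mono_poly:
  "square_space (cpoly.span (mono_poly ` S)) = cpoly.span (mono_poly ` {a + b |a b. a \<in> S \<and> b \<in> S})"
proof -
  have "{p * q |p q. p \<in> mono_poly ` S \<and> q \<in> mono_poly ` S} =
      mono_poly ` {a + b |a b. a \<in> S \<and> b \<in> S}"
  proof (intro subset_antisym subsetI)
    fix t assume "t \<in> mono_poly ` {a + b |a b. a \<in> S \<and> b \<in> S}"
    then obtain a b where "a \<in> S" "b \<in> S" "t = mono_poly a * mono_poly b"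
      by (auto simp: mono_poly_mult)
    then show "t \<in> {p * q |p q. p \<in> mono_poly ` S \<and> q \<in> mono_poly ` S}"
      by blast
  next
    fix t assume "t \<in> {p * q |p q. p \<in> mono_poly ` S \<and> q \<in> mono_poly ` S}"
    then obtain a b where ab: "a \<in> S" "b \<in> S" "t = mono_poly (a + b)"
      by (auto simp: mono_poly_mult)
    then have "a + b \<in> {a + b |a b. a \<in> S \<and> b \<in> S}"
      by blast
    then show "t \<in> mono_poly ` {a + b |a b. a \<in> S \<and> b \<in> S}"
      unfolding ab(3) by (rule imageI)
  qed
  then show ?thesis
    by (simp add: square_space_span)
qed

text \<open>At a point with nonzero i-th coordinate the d-th power of that variable does not vanish,
  so the pure powers exclude base points. Dimensions are numbers of monomials, and the square is
  spanned by the sumset of the exponents.\<close>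

lemma monomial_subspace:
  assumes S: "S \<subseteq> monoms n d" "\<And>i. i < n \<Longrightarrow> Poly_Mapping.single i d \<in> S" and d: "d > 0"
    and card: "card (monoms n d) = card S + 2"
  shows "bpf_subspace_codim2 n d (cpoly.span (mono_poly ` S))"
    and "codim_in_forms n (2 * d) (square_space (cpoly.span (mono_poly ` S))) =
      card (monoms n (2 * d)) - card {a + b |a b. a \<in> S \<and> b \<in> S}"
proof -
  have "base_point_free n (cpoly.span (mono_poly ` S))"
    unfolding base_point_free_def
  proof safe
    fix \<xi> i assume \<xi>: "\<forall>f\<in>cpoly.span (mono_poly ` S). poly_eval f \<xi> = 0" and i: "i < n" "\<xi> i \<noteq> 0"
    then have "poly_eval (mono_poly (Poly_Mapping.single i d)) \<xi> = 0"
      using S(2) cpoly.span_base by blast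
    then show False
      using i d by (simp add: mono_poly_def poly_eval_single eval_monom_def)
  qed
  moreover have "cpoly.span (mono_poly ` S) \<subseteq> forms n d"
    unfolding forms_eq_span using S(1) by (intro cpoly.span_mono) blast
  ultimately show "bpf_subspace_codim2 n d (cpoly.span (mono_poly ` S))"
    using card by (simp add: bpf_subspace_codim2_def codim_in_forms_def forms_eq_span
        dim_span_mono_poly del: cpoly.dim_span)
  show "codim_in_forms n (2 * d) (square_space (cpoly.span (mono_poly ` S))) =
      card (monoms n (2 * d)) - card {a + b |a b. a \<in> S \<and> b \<in> S}"
    by (simp add: codim_in_forms_def forms_eq_span square_space_mono_poly dim_span_mono_poly
        del: cpoly.dim_span)
qed

section \<open>Counting monomials by exponent triples\<close>

fun mon :: "nat \<times> nat \<times> nat \<Rightarrow> monom"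
  where "mon (i, j, k) = Poly_Mapping.single 0 i + Poly_Mapping.single 1 j + Poly_Mapping.single 2 k"

lemma lookup_mon:
  "Poly_Mapping.lookup (mon (i, j, k)) v = (if v = 0 then i else if v = 1 then j else if v = 2 then k else 0)"
  by (auto simp: lookup_add lookup_single)

lemma inj_mon: "inj_on mon A"
proof (rule inj_onI)
  fix a b assume eq: "mon a = mon b"
  obtain i j k i' j' k' where ab: "a = (i, j, k)" "b = (i', j', k')"
    by (metis prod_cases3)
  have "Poly_Mapping.lookup (mon a) v = Poly_Mapping.lookup (mon b) v" for v
    using eq by simp
  from this[of 0] this[of 1] this[of 2] show "a = b"
    unfolding ab lookup_mon by simp
qed

lemma keys_mon: "Poly_Mapping.keys (mon (i, j, k)) \<subseteq> {..<3}"
  by (auto simp: in_keys_iff lookup_mon simp del: mon.simps split: if_splits)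

lemma monom_degree_mon: "monom_degree (mon (i, j, k)) = i + j + k"
  by (simp add: monom_degree_add)

lemma monoms_3: "monoms 3 d = mon ` (\<lambda>(i, j). (i, j, d - i - j)) ` (SIGMA i:{..d}. {..d - i})"
proof (intro subset_antisym subsetI)
  fix m assume m: "m \<in> monoms 3 d"
  define i j k where "i = Poly_Mapping.lookup m 0" and "j = Poly_Mapping.lookup m 1"
    and "k = Poly_Mapping.lookup m 2"
  have "v \<notin> Poly_Mapping.keys m" if "v \<ge> 3" for v
    using m that by (auto simp: monoms_def)
  then have "Poly_Mapping.lookup m v = 0" if "v \<ge> 3" for v
    using that by (simp add: in_keys_iff)
  then have m_eq: "m = mon (i, j, k)"
    by (intro poly_mapping_eqI) (auto simp: lookup_mon i_def j_def k_def simp del: mon.simps)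
  then have "d = i + j + k"
    using m monom_degree_mon[of i j k] by (simp add: monoms_def)
  then show "m \<in> mon ` (\<lambda>(i, j). (i, j, d - i - j)) ` (SIGMA i:{..d}. {..d - i})"
    unfolding m_eq by (intro imageI image_eqI[of _ _ "(i, j)"]) auto
next
  fix m assume "m \<in> mon ` (\<lambda>(i, j). (i, j, d - i - j)) ` (SIGMA i:{..d}. {..d - i})"
  then obtain i j where "i \<le> d" "j \<le> d - i" "m = mon (i, j, d - i - j)"
    by auto
  then show "m \<in> monoms 3 d"
    using keys_mon[of i j "d - i - j"] monom_degree_mon[of i j "d - i - j"] by (simp add: monoms_def)
qed

lemma monoms_2: "monoms 2 d = mon ` (\<lambda>i. (i, d - i, 0)) ` {..d}"
proof (intro subset_antisym subsetI)
  fix m assume m: "m \<in> monoms 2 d"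
  define i j where "i = Poly_Mapping.lookup m 0" and "j = Poly_Mapping.lookup m 1"
  have "v \<notin> Poly_Mapping.keys m" if "v \<ge> 2" for v
    using m that by (auto simp: monoms_def)
  then have "Poly_Mapping.lookup m v = 0" if "v \<ge> 2" for v
    using that by (simp add: in_keys_iff)
  then have m_eq: "m = mon (i, j, 0)"
    by (intro poly_mapping_eqI) (auto simp: lookup_mon i_def j_def simp del: mon.simps)
  then have "d = i + j"
    using m monom_degree_mon[of i j 0] by (simp add: monoms_def)
  then show "m \<in> mon ` (\<lambda>i. (i, d - i, 0)) ` {..d}"
    unfolding m_eq by (intro imageI image_eqI[of _ _ i]) auto
next
  fix m assume "m \<in> mon ` (\<lambda>i. (i, d - i, 0)) ` {..d}"
  then obtain i where i: "i \<le> d" "m = mon (i, d - i, 0)"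
    by auto
  have "Poly_Mapping.keys m \<subseteq> {..<2}"
    unfolding i(2) by (auto simp: in_keys_iff lookup_mon simp del: mon.simps split: if_splits)
  then show "m \<in> monoms 2 d"
    using i monom_degree_mon[of i "d - i" 0] by (simp add: monoms_def)
qed

lemma card_monoms_3: "card (monoms 3 d) = (\<Sum>i\<le>d. d - i + 1)"
proof -
  have "inj_on (\<lambda>(i, j). (i, j, d - i - j)) A" for A
    by (auto simp: inj_on_def)
  then show ?thesis
    unfolding monoms_3 by (simp add: card_image inj_mon)
qed

lemma card_monoms_2: "card (monoms 2 d) = d + 1"
proof -
  have "inj_on (\<lambda>i. (i, d - i, 0 :: nat)) {..d}"
    by (auto simp: inj_on_def)
  then show ?thesis
    unfolding monoms_2 card_image[OF inj_mon] by (simp add: card_image)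
qed

fun add3 :: "nat \<times> nat \<times> nat \<Rightarrow> nat \<times> nat \<times> nat \<Rightarrow> nat \<times> nat \<times> nat"
  where "add3 (i, j, k) (i', j', k') = (i + i', j + j', k + k')"

lemma mon_add: "mon (add3 a b) = mon a + mon b"
  by (cases a; cases b) (simp add: single_add add_ac)

lemma card_sums: "card {a + b |a b. a \<in> mon ` A \<and> b \<in> mon ` A} = card (\<Union>a\<in>A. \<Union>b\<in>A. {add3 a b})"
proof -
  have "{a + b |a b. a \<in> mon ` A \<and> b \<in> mon ` A} = mon ` (\<Union>a\<in>A. \<Union>b\<in>A. {add3 a b})"
    by (auto simp: mon_add image_UN)
  then show ?thesis
    by (simp only: card_image[OF inj_mon])
qed

lemma less_3_cases: "(i::nat) < 3 \<Longrightarrow> i = 0 \<or> i = 1 \<or> i = 2"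
  by linarith

section \<open>Examples attaining the bounds\<close>

lemma tight_2:
  "\<exists>U. bpf_subspace_codim2 3 2 U \<and> codim_in_forms 3 (2 * 2) (square_space U) = 6"
proof -
  \<comment> \<open>The exceptional pencil with X the third variable. The square misses the six
    quartic monomials of odd degree in that variable: four of degree 1 and two of degree 3.\<close>
  define A :: "(nat \<times> nat \<times> nat) set" where "A = {(2, 0, 0), (1, 1, 0), (0, 2, 0), (0, 0, 2)}"
  have "mon ` A \<subseteq> monoms 3 2"
    using keys_mon monom_degree_mon by (auto simp: A_def monoms_def simp del: mon.simps)
  moreover have "Poly_Mapping.single i 2 \<in> mon ` A" if "i < 3" for i
    using less_3_cases[OF that] by (auto simp: A_def)
  moreover have "card (monoms 3 2) = card (mon ` A) + 2"
  proof -
    have "card A = 4"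
      by (simp add: A_def)
    then show ?thesis
      by (simp add: card_monoms_3 card_image[OF inj_mon] numeral_2_eq_2)
  qed
  ultimately have "bpf_subspace_codim2 3 2 (cpoly.span (mono_poly ` mon ` A))"
    and "codim_in_forms 3 (2 * 2) (square_space (cpoly.span (mono_poly ` mon ` A))) =
      card (monoms 3 (2 * 2)) - card (\<Union>a\<in>A. \<Union>b\<in>A. {add3 a b})"
    using monomial_subspace[of "mon ` A" 3 2] unfolding card_sums by auto
  moreover have "card (monoms 3 (2 * 2)) = 15"
    unfolding card_monoms_3 by code_simp
  moreover have "card (\<Union>a\<in>A. \<Union>b\<in>A. {add3 a b}) = 9"
    unfolding A_def by code_simp
  ultimately show ?thesis
    by auto
qed

text \<open>There are d + 1 binary monomials of degree d and 2 d + 1 of degree 2 d, so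
  \<open>card\<close> encodes the codimensions 2 and 4.\<close>

lemma tight_binary:
  assumes A: "A \<subseteq> (\<lambda>i. (i, d - i, 0)) ` {..d}" "(d, 0, 0) \<in> A" "(0, d, 0) \<in> A" "d > 0"
    and card: "card A + 1 = d" "card (\<Union>a\<in>A. \<Union>b\<in>A. {add3 a b}) + 4 = 2 * d + 1"
  shows "\<exists>U. bpf_subspace_codim2 2 d U \<and> codim_in_forms 2 (2 * d) (square_space U) = 4"
proof -
  have "mon ` A \<subseteq> monoms 2 d"
    unfolding monoms_2 using A(1) by blast
  moreover have "Poly_Mapping.single i d \<in> mon ` A" if "i < 2" for i
  proof -
    have "i = 0 \<or> i = 1"
      using that by linarith
    then show ?thesis
      using imageI[OF A(2), of mon] imageI[OF A(3), of mon] by auto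
  qed
  moreover have "card (monoms 2 d) = card (mon ` A) + 2"
    using card(1) by (simp add: card_monoms_2 card_image[OF inj_mon])
  ultimately have "bpf_subspace_codim2 2 d (cpoly.span (mono_poly ` mon ` A))"
    and "codim_in_forms 2 (2 * d) (square_space (cpoly.span (mono_poly ` mon ` A))) =
      card (monoms 2 (2 * d)) - card (\<Union>a\<in>A. \<Union>b\<in>A. {add3 a b})"
    using monomial_subspace[of "mon ` A" 2 d] A(4) unfolding card_sums by auto
  then show ?thesis
    using card(2) by (auto simp: card_monoms_2)
qed

text \<open>The square of the span of the two cubes contains three of the seven sextic
  monomials.\<close>

lemma tight_3: "\<exists>U. bpf_subspace_codim2 2 3 U \<and> codim_in_forms 2 (2 * 3) (square_space U) = 4"
  by (rule tight_binary[of "{(3, 0, 0), (0, 3, 0)}"]) (auto simp: card_insert_if)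

text \<open>Monomials with even exponents only: the square contains five of the nine monomials of
  degree 8.\<close>

lemma tight_4: "\<exists>U. bpf_subspace_codim2 2 4 U \<and> codim_in_forms 2 (2 * 4) (square_space U) = 4"
  by (rule tight_binary[of "{(4, 0, 0), (2, 2, 0), (0, 4, 0)}"]) (auto simp: card_insert_if)

theorem theorem5p8:
  shows "(\<forall>n d U. n \<ge> 2 \<longrightarrow> d \<ge> 2 \<longrightarrow> bpf_subspace_codim2 n d U \<longrightarrow>
            (d = 2 \<longrightarrow> codim_in_forms n (2 * d) (square_space U) \<le> 6) \<and>
            (d \<ge> 3 \<longrightarrow> codim_in_forms n (2 * d) (square_space U) \<le> 4)) \<and>
         (\<forall>d\<in>{2, 3, 4}. \<exists>n\<ge>2. \<exists>U. bpf_subspace_codim2 n d U \<and>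
            codim_in_forms n (2 * d) (square_space U) = (if d = 2 then 6 else 4))"
proof (intro conjI allI impI ballI)
  fix n d :: nat and U :: "cpoly set"
  assume "d \<ge> 2" "bpf_subspace_codim2 n d U"
  note bound = codim_square_space_bound[OF this]
  show "codim_in_forms n (2 * d) (square_space U) \<le> 6" if "d = 2"
    using bound that by simp
  show "codim_in_forms n (2 * d) (square_space U) \<le> 4" if "d \<ge> 3"
    using bound that by simp
next
  fix d :: nat assume "d \<in> {2, 3, 4}"
  then consider "d = 2" | "d = 3" | "d = 4"
    by auto
  then show "\<exists>n\<ge>2. \<exists>U. bpf_subspace_codim2 n d U \<and>
      codim_in_forms n (2 * d) (square_space U) = (if d = 2 then 6 else 4)"
  proof cases
    case 1
    show ?thesis
      unfolding 1 using tight_2 by (intro exI[of _ 3]) simp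
  next
    case 2
    show ?thesis
      unfolding 2 using tight_3 by (intro exI[of _ 2]) simp
  next
    case 3
    show ?thesis
      unfolding 3 using tight_4 by (intro exI[of _ 2]) simp
  qed
qed

end
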